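(* Let $(N,g)$ be a smooth compact $n$-dimensional Riemannian manifold, $1\le k\le n$, let $S$ be a $C^1$ symmetric $(0,2)$-tensor on $N$ with $S\in\Gamma_k^+$, let $f:N\to(0,\infty)$ be smooth, and let $\underline{\delta}<0<\overline{\delta}$ be constants. Then there exists a constant $C_1$ depending only upon $S,f,\underline{\delta},\overline{\delta}$ and $k$ (and on the fixed $(N,g)$) such that every $C^3$ solution $u$ of $$\sigma_k^{1/k}\left(\nabla^2u-du\otimes du+\frac{|\nabla u|^2}{2}g+S\right)=f(x)e^u$$ on $N$ satisfying $\underline{\delta}\le u(x)\le\overline{\delta}$ for all $x\in N$ satisfies $$|\nabla u|_{C^0}\le C_1.$$
   Context: Compact means compact without boundary. On $\mathbf{R}^n$, $\sigma_k(\lambda_1,\dots,\lambda_n)=\sum_{i_1<\dots<i_k}\lambda_{i_1}\cdots\lambda_{i_k}$, and $\Gamma_k^+\subset\mathbf{R}^n$ is the connected component of $\{\sigma_k>0\}$ containing the positive cone. For a symmetric $(0,2)$-tensor $A$ on $(N,g)$, the eigenvalues of $A$ at a point are those of the symmetric endomorphism obtained by raising an index with $g$; $\sigma_k(A)$ is $\sigma_k$ of these eigenvalues, and $A\in\Gamma_k^+$ means that at every point the eigenvalues of $A$ lie in $\Gamma_k^+$. $\nabla u$, $\nabla^2u$ and $du$ denote the gradient, Hessian and differential of $u$ with respect to $g$, and $|\cdot|_{C^0}$ is the supremum over $N$ of the pointwise norm. *)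

theory Defs
  imports "HOL-Analysis.Analysis" "HOL-Combinatorics.Combinatorics"
begin

section \<open>Differentiability classes on open subsets of Euclidean space\<close>

text \<open>Meant for open \<open>S\<close>: there, all iterated directional derivatives of order
  at most \<open>m\<close> exist and are continuous.\<close>

fun Ck_on :: "nat \<Rightarrow> ('a::real_normed_vector) set \<Rightarrow> ('a \<Rightarrow> 'b::real_normed_vector) \<Rightarrow> bool" where
  "Ck_on 0 S h \<longleftrightarrow> continuous_on S h"
| "Ck_on (Suc m) S h \<longleftrightarrow>
     (\<forall>x\<in>S. h differentiable (at x)) \<and>
     (\<forall>v. Ck_on m S (\<lambda>x. frechet_derivative h (at x) v))"

definition smooth_on :: "('a::real_normed_vector) set \<Rightarrow> ('a \<Rightarrow> 'b::real_normed_vector) \<Rightarrow> bool" where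
  "smooth_on S h \<longleftrightarrow> (\<forall>m. Ck_on m S h)"

definition partial :: "'n::finite \<Rightarrow> (real^'n \<Rightarrow> 'b::real_normed_vector) \<Rightarrow> real^'n \<Rightarrow> 'b" where
  "partial i h x = frechet_derivative h (at x) (axis i 1)"


section \<open>Smooth manifolds\<close>

text \<open>A chart is a pair of its domain and its coordinate map; the values of the coordinate
  map outside the domain are irrelevant.\<close>

type_synonym ('a, 'n) chart = "'a set \<times> ('a \<Rightarrow> real^'n)"

definition chart_image :: "('a, 'n::finite) chart \<Rightarrow> (real^'n) set" where
  "chart_image c = snd c ` fst c"

definition chart_inv :: "('a, 'n::finite) chart \<Rightarrow> real^'n \<Rightarrow> 'a" where
  "chart_inv c = inv_into (fst c) (snd c)"

definition is_chart :: "'a topology \<Rightarrow> ('a, 'n::finite) chart \<Rightarrow> bool" where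
  "is_chart X c \<longleftrightarrow>
     openin X (fst c) \<and> open (chart_image c) \<and>
     homeomorphic_map (subtopology X (fst c)) (top_of_set (chart_image c)) (snd c)"

definition transition :: "('a, 'n::finite) chart \<Rightarrow> ('a, 'n) chart \<Rightarrow> real^'n \<Rightarrow> real^'n" where
  "transition c d = snd d \<circ> chart_inv c"

text \<open>A smooth manifold without boundary, of dimension \<open>CARD('n)\<close>. The atlas \<open>\<A>\<close> need not be
  maximal.\<close>

definition smooth_manifold :: "'a topology \<Rightarrow> ('a, 'n::finite) chart set \<Rightarrow> bool" where
  "smooth_manifold X \<A> \<longleftrightarrow>
     Hausdorff_space X \<and> second_countable X \<and>
     (\<forall>c\<in>\<A>. is_chart X c) \<and>
     (\<Union>c\<in>\<A>. fst c) = topspace X \<and>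
     (\<forall>c\<in>\<A>. \<forall>d\<in>\<A>. smooth_on (snd c ` (fst c \<inter> fst d)) (transition c d))"

definition Ck_function :: "nat \<Rightarrow> ('a, 'n::finite) chart set \<Rightarrow> ('a \<Rightarrow> real) \<Rightarrow> bool" where
  "Ck_function m \<A> h \<longleftrightarrow> (\<forall>c\<in>\<A>. Ck_on m (chart_image c) (h \<circ> chart_inv c))"

definition smooth_function :: "('a, 'n::finite) chart set \<Rightarrow> ('a \<Rightarrow> real) \<Rightarrow> bool" where
  "smooth_function \<A> h \<longleftrightarrow> (\<forall>m. Ck_function m \<A> h)"


section \<open>Covariant 2-tensor fields\<close>

text \<open>A \<open>(0,2)\<close>-tensor field is given by its component matrix \<open>T c p\<close> at each point \<open>p\<close> of each
  chart \<open>c\<close>, the matrices in two charts being related by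
  \<open>T\<^sub>i\<^sub>j = (\<partial>y\<^sup>a / \<partial>x\<^sup>i) (\<partial>y\<^sup>b / \<partial>x\<^sup>j) T'\<^sub>a\<^sub>b\<close>.\<close>

type_synonym ('a, 'n) tensor_field = "('a, 'n) chart \<Rightarrow> 'a \<Rightarrow> real^'n^'n"

definition tensor_field :: "('a, 'n::finite) chart set \<Rightarrow> ('a, 'n) tensor_field \<Rightarrow> bool" where
  "tensor_field \<A> T \<longleftrightarrow>
     (\<forall>c\<in>\<A>. \<forall>d\<in>\<A>. \<forall>p\<in>fst c \<inter> fst d.
        let J = jacobian (transition c d) (at (snd c p))
        in T c p = transpose J ** T d p ** J)"

definition symmetric_tensor :: "('a, 'n::finite) chart set \<Rightarrow> ('a, 'n) tensor_field \<Rightarrow> bool" where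
  "symmetric_tensor \<A> T \<longleftrightarrow>
     tensor_field \<A> T \<and> (\<forall>c\<in>\<A>. \<forall>p\<in>fst c. transpose (T c p) = T c p)"

definition Ck_tensor :: "nat \<Rightarrow> ('a, 'n::finite) chart set \<Rightarrow> ('a, 'n) tensor_field \<Rightarrow> bool" where
  "Ck_tensor m \<A> T \<longleftrightarrow> (\<forall>c\<in>\<A>. Ck_on m (chart_image c) (T c \<circ> chart_inv c))"

definition riemannian_metric :: "('a, 'n::finite) chart set \<Rightarrow> ('a, 'n) tensor_field \<Rightarrow> bool" where
  "riemannian_metric \<A> g \<longleftrightarrow>
     symmetric_tensor \<A> g \<and> (\<forall>m. Ck_tensor m \<A> g) \<and>
     (\<forall>c\<in>\<A>. \<forall>p\<in>fst c. \<forall>v. v \<noteq> 0 \<longrightarrow> 0 < v \<bullet> (g c p *v v))"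


section \<open>Differential, gradient and Hessian in a chart\<close>

definition differential :: "('a \<Rightarrow> real) \<Rightarrow> ('a, 'n::finite) chart \<Rightarrow> 'a \<Rightarrow> real^'n" where
  "differential u c p = (\<chi> i. partial i (u \<circ> chart_inv c) (snd c p))"

definition gradient :: "('a, 'n::finite) tensor_field \<Rightarrow> ('a \<Rightarrow> real) \<Rightarrow> ('a, 'n) chart \<Rightarrow> 'a \<Rightarrow> real^'n" where
  "gradient g u c p = matrix_inv (g c p) *v differential u c p"

definition metric_norm :: "('a, 'n::finite) tensor_field \<Rightarrow> ('a, 'n) chart \<Rightarrow> 'a \<Rightarrow> real^'n \<Rightarrow> real" where
  "metric_norm g c p v = sqrt (v \<bullet> (g c p *v v))"

text \<open>\<open>christoffel g c p l i j\<close> is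
  \<open>\<Gamma>\<^sup>l\<^sub>i\<^sub>j = 1/2 g\<^sup>l\<^sup>m (\<partial>\<^sub>i g\<^sub>j\<^sub>m + \<partial>\<^sub>j g\<^sub>i\<^sub>m - \<partial>\<^sub>m g\<^sub>i\<^sub>j)\<close>,
  and the Hessian is \<open>\<partial>\<^sub>i\<partial>\<^sub>j u - \<Gamma>\<^sup>l\<^sub>i\<^sub>j \<partial>\<^sub>l u\<close>.\<close>

definition christoffel ::
    "('a, 'n::finite) tensor_field \<Rightarrow> ('a, 'n) chart \<Rightarrow> 'a \<Rightarrow> 'n \<Rightarrow> 'n \<Rightarrow> 'n \<Rightarrow> real" where
  "christoffel g c p l i j =
     (let dg = (\<lambda>a b m. partial a (\<lambda>x. g c (chart_inv c x) $ b $ m) (snd c p))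
      in 1/2 * (\<Sum>m\<in>UNIV. matrix_inv (g c p) $ l $ m * (dg i j m + dg j i m - dg m i j)))"

definition hessian :: "('a, 'n::finite) tensor_field \<Rightarrow> ('a \<Rightarrow> real) \<Rightarrow> ('a, 'n) tensor_field" where
  "hessian g u c p =
     (\<chi> i j. partial i (partial j (u \<circ> chart_inv c)) (snd c p)
        - (\<Sum>l\<in>UNIV. christoffel g c p l i j * differential u c p $ l))"

definition covector_tensor :: "real^'n::finite \<Rightarrow> real^'n \<Rightarrow> real^'n^'n" where
  "covector_tensor a b = (\<chi> i j. a $ i * b $ j)"

text \<open>The supremum of the pointwise norm over the manifold: the norm does not depend on the chart,
  so it makes no difference that a point may occur with several charts.\<close>

definition gradient_C0_norm ::
    "('a, 'n::finite) chart set \<Rightarrow> ('a, 'n) tensor_field \<Rightarrow> ('a \<Rightarrow> real) \<Rightarrow> real" where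
  "gradient_C0_norm \<A> g u =
     (SUP (c, p)\<in>(SIGMA c:\<A>. fst c). metric_norm g c p (gradient g u c p))"


section \<open>Elementary symmetric functions and the cones\<close>

definition sigma :: "nat \<Rightarrow> real^'n::finite \<Rightarrow> real" where
  "sigma k l = (\<Sum>I\<in>{I. I \<subseteq> UNIV \<and> card I = k}. \<Prod>i\<in>I. l $ i)"

definition Gamma :: "nat \<Rightarrow> (real^'n::finite) set" where
  "Gamma k = connected_component_set {l. 0 < sigma k l} (\<chi> i. 1)"

lemma sigma_pos:
  fixes l :: "real^'n::finite"
  assumes "k \<le> CARD('n)" "\<And>i. 0 < l $ i"
  shows "0 < sigma k l"
proof -
  obtain J :: "'n set" where "card J = k"
    using assms(1) by (metis obtain_subset_with_card_n)
  then have "{I :: 'n set. I \<subseteq> UNIV \<and> card I = k} \<noteq> {}" by blast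
  then show ?thesis
    unfolding sigma_def using assms(2) by (intro sum_pos prod_pos) auto
qed

text \<open>\<open>Gamma k\<close> is the unique component of \<open>{\<sigma>\<^sub>k > 0}\<close> that contains the positive cone.\<close>

lemma Gamma_unique:
  fixes C :: "(real^'n::finite) set"
  assumes "k \<le> CARD('n)"
  shows "C \<in> components {l. 0 < sigma k l} \<and> {l. \<forall>i. 0 < l $ i} \<subseteq> C \<longleftrightarrow> C = Gamma k"
proof -
  let ?P = "{l :: real^'n. \<forall>i. 0 < l $ i}" and ?S = "{l :: real^'n. 0 < sigma k l}"
  let ?e = "(\<chi> i. 1) :: real^'n"
  have e: "?e \<in> ?P" by simp
  have PS: "?P \<subseteq> ?S" using sigma_pos[OF assms] by blast
  have "convex ?P"
  proof (rule convexI)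
    fix x y :: "real^'n" and a b :: real
    assume "x \<in> ?P" "y \<in> ?P" "0 \<le> a" "0 \<le> b" "a + b = 1"
    then have "0 < a * x $ i + b * y $ i" for i
      by (cases "a = 0") (auto intro!: add_pos_nonneg simp: less_imp_le)
    then show "a *\<^sub>R x + b *\<^sub>R y \<in> ?P" by simp
  qed
  then have "connected ?P" by (rule convex_connected)
  then have sub: "?P \<subseteq> Gamma k"
    unfolding Gamma_def by (rule connected_component_maximal[OF e _ PS])
  have comp: "Gamma k \<in> components ?S"
    unfolding Gamma_def components_def using e PS by blast
  show ?thesis
    using sub comp e components_eq[of C ?S "Gamma k"] by blast
qed


section \<open>Eigenvalues of a tensor with respect to the metric\<close>

text \<open>\<open>l\<close> lists the eigenvalues of \<open>M\<close>, each as often as its multiplicity in the characteristic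
  polynomial.\<close>

definition lists_eigenvalues :: "real^'n^'n::finite \<Rightarrow> real^'n \<Rightarrow> bool" where
  "lists_eigenvalues M l \<longleftrightarrow> (\<forall>t. det (mat t - M) = (\<Prod>i\<in>UNIV. t - l $ i))"

text \<open>Raising an index of the tensor with components \<open>T\<close> by the metric with components \<open>G\<close> gives
  the endomorphism \<open>G\<^sup>-\<^sup>1 T\<close>, which is diagonalizable over the reals when \<open>T\<close> is symmetric and \<open>G\<close>
  is symmetric and positive definite. The list of its eigenvalues is unique up to a permutation.\<close>

definition eigenvalues :: "real^'n^'n::finite \<Rightarrow> real^'n^'n \<Rightarrow> real^'n" where
  "eigenvalues G T = (SOME l. lists_eigenvalues (matrix_inv G ** T) l)"

definition sigma_tensor ::
    "nat \<Rightarrow> ('a, 'n::finite) tensor_field \<Rightarrow> ('a, 'n) tensor_field \<Rightarrow> ('a, 'n) chart \<Rightarrow> 'a \<Rightarrow> real" where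
  "sigma_tensor k g T c p = sigma k (eigenvalues (g c p) (T c p))"

definition in_Gamma ::
    "nat \<Rightarrow> ('a, 'n::finite) chart set \<Rightarrow> ('a, 'n) tensor_field \<Rightarrow> ('a, 'n) tensor_field \<Rightarrow> bool" where
  "in_Gamma k \<A> g T \<longleftrightarrow> (\<forall>c\<in>\<A>. \<forall>p\<in>fst c. eigenvalues (g c p) (T c p) \<in> Gamma k)"

lemma lists_eigenvalues_unique:
  fixes M :: "real^'n^'n::finite"
  assumes "lists_eigenvalues M l" "lists_eigenvalues M l'"
  shows "\<exists>\<pi>. \<pi> permutes UNIV \<and> l' = (\<chi> i. l $ \<pi> i)"
proof -
  define P where "P l = (\<Prod>i\<in>UNIV. [:- (l $ i), 1:])" for l :: "real^'n"
  have "poly (P l) t = poly (P l') t" for t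
    using assms unfolding lists_eigenvalues_def P_def by (simp add: poly_prod)
  then have "P l = P l'" using poly_eqI2 poly_eq_poly_eq_iff by blast
  moreover have "proots (P l) = image_mset (($) l) (mset_set UNIV)" for l
    unfolding P_def by (subst proots_prod) (auto simp: sum_unfold_sum_mset)
  ultimately have "image_mset (($) l) (mset_set UNIV) = image_mset (($) l') (mset_set UNIV)"
    by metis
  then obtain \<pi> where "\<pi> permutes UNIV" "\<forall>i\<in>UNIV. l' $ i = l $ \<pi> i"
    by (metis image_mset_eq_implies_permutes finite)
  then show ?thesis by (auto simp: vec_eq_iff)
qed


section \<open>The equation\<close>

definition equation_tensor ::
    "('a, 'n::finite) tensor_field \<Rightarrow> ('a, 'n) tensor_field \<Rightarrow> ('a \<Rightarrow> real) \<Rightarrow> ('a, 'n) tensor_field" where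
  "equation_tensor g S u c p =
     hessian g u c p - covector_tensor (differential u c p) (differential u c p)
     + ((metric_norm g c p (gradient g u c p))\<^sup>2 / 2) *\<^sub>R g c p + S c p"

text \<open>The tensor is not required to lie in \<open>Gamma k\<close>. As \<open>root k\<close> has the sign of its argument, the
  equation forces \<open>\<sigma>\<^sub>k > 0\<close> when \<open>f > 0\<close>.\<close>

definition solves_equation ::
    "nat \<Rightarrow> ('a, 'n::finite) chart set \<Rightarrow> ('a, 'n) tensor_field \<Rightarrow> ('a, 'n) tensor_field \<Rightarrow>
     ('a \<Rightarrow> real) \<Rightarrow> ('a \<Rightarrow> real) \<Rightarrow> bool" where
  "solves_equation k \<A> g S f u \<longleftrightarrow>
     (\<forall>c\<in>\<A>. \<forall>p\<in>fst c. root k (sigma_tensor k g (equation_tensor g S u) c p) = f p * exp (u p))"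

end

theory Submission
  imports Defs
begin

text \<open>Write \<open>W\<close> for the tensor inside \<open>\<sigma>\<^sub>k\<close>, \<open>h =
  |\<nabla>u|\<^sup>2 / 2\<close> and \<open>\<psi> = f e\<^sup>u\<close>. The estimate is a maximum
principle for \<open>H = h / (1 - a e\<^sup>u)\<close> with \<open>a = exp (- \<delta>\<^sub>2) / 2\<close>, so that
  the denominator stays between \<open>1/2\<close> and
\<open>1\<close>. If \<open>H\<close> is largest at \<open>p\<close> and \<open>\<kappa> = a H(p)\<close>, then
  \<open>h + \<kappa> e\<^sup>u\<close> is largest at \<open>p\<close>. Put
\<open>q = \<kappa> e\<^sup>u\<close> at \<open>p\<close>; it is at least a fixed multiple of \<open>h\<close>.

Let \<open>P\<^sup>i\<^sup>j = \<partial>\<sigma>\<^sub>k / \<partial>W\<^sub>i\<^sub>j\<close> at \<open>p\<close>. It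
  is positive semidefinite because \<open>W\<close> lies in the cone. The second order
condition at \<open>p\<close>, contracted with \<open>P\<close>, bounds third derivatives of \<open>u\<close> from
  above, and the equation
\<open>\<sigma>\<^sub>k(W) = \<psi>\<^sup>k\<close>, differentiated in the direction \<open>\<nabla>u\<close>, computes
  the same third derivatives. Subtracting, and
using \<open>P\<^sup>i\<^sup>jW\<^sub>i\<^sub>j = k \<psi>\<^sup>k\<close>, all terms in \<open>P(du, du)\<close>
  cancel. They cancel because \<open>\<phi> = - ln (1 - a e\<^sup>u)\<close>
solves \<open>\<phi>'' = (\<phi>')\<^sup>2 + \<phi>'\<close>, and this explains the choice of \<open>H\<close>. What remains is
\<open>k \<psi>\<^sup>k\<^sup>-\<^sup>1 (\<partial>\<psi>(\<nabla>u) + q \<psi>) \<le> tr P (- q h + C q + C h)\<close>.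
For large \<open>h\<close> the right side is at most \<open>0\<close>, whereas the left side is positive, because
\<open>\<partial>\<psi>(\<nabla>u) = e\<^sup>u (\<langle>\<nabla>f, \<nabla>u\<rangle> + 2 f h)\<close> and
  \<open>f\<close> has a positive lower bound. Of \<open>P\<close>, only the sign is used.

The sign of \<open>P\<close> amounts to \<open>\<sigma>\<^sub>k\<^sub>-\<^sub>1(\<lambda> without \<lambda>\<^sub>i) >
  0\<close> for \<open>\<lambda>\<close> in the cone. Lemmas
\<open>esym_remove_pos\<close> and \<open>esym_pos_of_nonneg\<close> give this, together with the description of the cone by
\<open>\<sigma>\<^sub>1, \<dots>, \<sigma>\<^sub>k > 0\<close>, from two algebraic identities. That \<open>W\<close>
  lies in the cone at every point is lemma
\<open>everywhere_admissible\<close>: the set where it does not is open and closed, and at a minimum of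
  \<open>u\<close> over that set \<open>W\<close>
is \<open>S\<close> plus a positive semidefinite tensor.

The maximum principle is carried out in one chart, without covariant derivatives. Since
\<open>h = max\<^sub>v (du(v) - |v|\<^sup>2 / 2)\<close>, the function \<open>du(X) - |X|\<^sup>2 / 2\<close> touches
  \<open>h\<close> from below at \<open>p\<close> for every vector field
\<open>X\<close> that extends \<open>\<nabla>u(p)\<close>. For \<open>X\<close> one takes the affine field whose
  covariant derivative vanishes at \<open>p\<close>; the same
linear part moves the frame in which the equation is differentiated. Then all derivatives of \<open>u\<close> of order two and
three match, and what is left over (curvature and derivatives of \<open>S\<close>) is a remainder bounded by a multiple of
\<open>h\<close>, with a constant that is uniform on compact pieces of the chart. The quantities involved do not depend on the
chart, and finitely many compact pieces cover the manifold.\<close>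

section \<open>Elementary symmetric functions and the cone\<close>

text \<open>The index set is a parameter so that removing a variable means shrinking \<open>A\<close>.\<close>

definition esym :: "nat \<Rightarrow> 'b set \<Rightarrow> ('b \<Rightarrow> real) \<Rightarrow> real" where
  "esym k A l = (\<Sum>I\<in>{I. I \<subseteq> A \<and> card I = k}. \<Prod>i\<in>I. l i)"

lemma sigma_eq_esym: "sigma k l = esym k UNIV (($) l)"
  by (simp add: sigma_def esym_def)

lemma esym_0 [simp]: "finite A \<Longrightarrow> esym 0 A l = 1"
proof -
  assume "finite A"
  then have "{I. I \<subseteq> A \<and> card I = 0} = {{}}" using finite_subset[of _ A] by (auto simp: card_eq_0_iff)
  then show ?thesis by (simp add: esym_def)
qed

text \<open>Both sides run over the pairs of a set and one of its elements.\<close>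

lemma sum_subsets_remove:
  fixes F :: "'b \<Rightarrow> 'b set \<Rightarrow> real"
  assumes "finite A"
  shows "(\<Sum>I\<in>{I. I \<subseteq> A \<and> card I = Suc k}. \<Sum>i\<in>I. F i (I - {i}))
       = (\<Sum>i\<in>A. \<Sum>J\<in>{J. J \<subseteq> A - {i} \<and> card J = k}. F i J)"
proof -
  have fin: "finite {I. I \<subseteq> A \<and> card I = Suc k}" "\<And>I. I \<subseteq> A \<Longrightarrow> finite I"
    "\<And>i. finite {J. J \<subseteq> A - {i} \<and> card J = k}"
    using assms finite_subset by auto
  have "(\<Sum>I\<in>{I. I \<subseteq> A \<and> card I = Suc k}. \<Sum>i\<in>I. F i (I - {i}))
      = (\<Sum>(I, i)\<in>(SIGMA I:{I. I \<subseteq> A \<and> card I = Suc k}. I). F i (I - {i}))"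
    using fin by (intro sum.Sigma) auto
  also have "\<dots> = (\<Sum>(i, J)\<in>(SIGMA i:A. {J. J \<subseteq> A - {i} \<and> card J = k}). F i J)"
    by (rule sum.reindex_bij_witness[where i = "\<lambda>(i, J). (insert i J, i)" and j = "\<lambda>(I, i). (i, I - {i})"])
      (use fin finite_subset[OF _ assms] in \<open>auto simp: insert_absorb card_insert_if subset_Diff_insert\<close>)
  also have "\<dots> = (\<Sum>i\<in>A. \<Sum>J\<in>{J. J \<subseteq> A - {i} \<and> card J = k}. F i J)"
    using assms fin by (intro sum.Sigma[symmetric]) auto
  finally show ?thesis .
qed

lemma esym_remove:
  assumes "finite A" "i \<in> A"
  shows "esym (Suc k) A l = esym (Suc k) (A - {i}) l + l i * esym k (A - {i}) l"
proof -
  let ?P = "{I. I \<subseteq> A - {i} \<and> card I = Suc k}" and ?Q = "{J. J \<subseteq> A - {i} \<and> card J = k}"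
  have fin: "finite ?P" "finite ?Q" "\<And>J. J \<subseteq> A - {i} \<Longrightarrow> finite J"
    using assms finite_subset[of _ "A - {i}"] by auto
  have inj: "inj_on (insert i) ?Q" by (rule inj_onI) (auto dest: insert_ident)
  have eq: "{I. I \<subseteq> A \<and> card I = Suc k} = ?P \<union> insert i ` ?Q"
  proof (intro equalityI subsetI)
    fix I assume I: "I \<in> {I. I \<subseteq> A \<and> card I = Suc k}"
    then have "finite I" using assms finite_subset by auto
    show "I \<in> ?P \<union> insert i ` ?Q"
    proof (cases "i \<in> I")
      case True
      then have "I = insert i (I - {i})" "I - {i} \<in> ?Q" using I \<open>finite I\<close> by auto
      then show ?thesis by blast
    qed (use I in auto)
  qed (use assms fin in \<open>auto simp: card_insert_if subset_Diff_insert\<close>)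
  have "esym (Suc k) A l = (\<Sum>I\<in>?P. \<Prod>i\<in>I. l i) + (\<Sum>I\<in>insert i ` ?Q. \<Prod>i\<in>I. l i)"
    unfolding esym_def eq using fin by (intro sum.union_disjoint) auto
  also have "(\<Sum>I\<in>insert i ` ?Q. \<Prod>i\<in>I. l i) = (\<Sum>J\<in>?Q. \<Prod>i\<in>insert i J. l i)"
    by (simp add: sum.reindex[OF inj])
  also have "\<dots> = (\<Sum>J\<in>?Q. l i * (\<Prod>i\<in>J. l i))"
    by (intro sum.cong refl, subst prod.insert) (use fin in auto)
  finally show ?thesis by (simp add: esym_def sum_distrib_left)
qed

lemma esym_Suc:
  assumes "finite A"
  shows "real (Suc k) * esym (Suc k) A l = (\<Sum>i\<in>A. l i * esym k (A - {i}) l)"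
proof -
  have "(\<Sum>I\<in>{I. I \<subseteq> A \<and> card I = Suc k}. \<Sum>i\<in>I. l i * prod l (I - {i}))
      = (\<Sum>I\<in>{I. I \<subseteq> A \<and> card I = Suc k}. real (Suc k) * prod l I)"
  proof (rule sum.cong)
    fix I assume I: "I \<in> {I. I \<subseteq> A \<and> card I = Suc k}"
    then have "finite I" using assms finite_subset by auto
    then have "(\<Sum>i\<in>I. l i * prod l (I - {i})) = (\<Sum>i\<in>I. prod l I)"
      by (intro sum.cong refl) (simp add: prod.remove)
    then show "(\<Sum>i\<in>I. l i * prod l (I - {i})) = real (Suc k) * prod l I" using I by simp
  qed simp
  then show ?thesis
    using sum_subsets_remove[OF assms, where k = k and F = "\<lambda>i J. l i * prod l J"]
    by (simp add: esym_def sum_distrib_left)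
qed

text \<open>If \<open>\<sigma>\<^sub>k\<^sub>+\<^sub>1\<close> vanishes and the \<open>\<sigma>\<^sub>k\<close> of the
  remaining variables are nonnegative, this identity forces \<open>\<sigma>\<^sub>k\<^sub>+\<^sub>2 \<le> 0\<close>. Both
  positivity results below rest on this.\<close>

lemma esym_Suc_Suc:
  assumes "finite A"
  shows "real (Suc (Suc k)) * esym (Suc (Suc k)) A l
       = (\<Sum>i\<in>A. l i) * esym (Suc k) A l - (\<Sum>i\<in>A. (l i)\<^sup>2 * esym k (A - {i}) l)"
proof -
  have "l i * esym (Suc k) (A - {i}) l = l i * esym (Suc k) A l - (l i)\<^sup>2 * esym k (A - {i}) l"
    if "i \<in> A" for i
    using esym_remove[OF assms that, of k l] by (simp add: algebra_simps power2_eq_square)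
  then show ?thesis
    using esym_Suc[OF assms, of "Suc k" l] by (simp add: sum_subtractf sum_distrib_right)
qed

lemma sum_esym_remove:
  assumes "finite A"
  shows "(\<Sum>i\<in>A. esym k (A - {i}) l) = (real (card A) - real k) * esym k A l"
proof (cases k)
  case 0
  then show ?thesis using assms by simp
next
  case (Suc m)
  have "(\<Sum>i\<in>A. esym k (A - {i}) l) = (\<Sum>i\<in>A. esym k A l - l i * esym m (A - {i}) l)"
    unfolding Suc by (intro sum.cong refl) (use esym_remove[OF assms] in simp)
  also have "\<dots> = real (card A) * esym k A l - real k * esym k A l"
    using esym_Suc[OF assms, of m l] by (simp add: sum_subtractf Suc)
  finally show ?thesis by (simp add: algebra_simps)
qed

lemma has_derivative_esym_shift:
  assumes "finite A"
  shows "((\<lambda>t. esym (Suc k) A (\<lambda>i. l i + t))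
           has_real_derivative (real (card A) - real k) * esym k A (\<lambda>i. l i + t)) (at t)"
proof -
  have lin: "((\<lambda>t. l i + t) has_real_derivative 1) (at t)" for i
    by (auto intro!: derivative_eq_intros)
  have "((\<lambda>t. \<Prod>i\<in>I. l i + t) has_real_derivative (\<Sum>i\<in>I. 1 * (\<Prod>j\<in>I - {i}. l j +
    t))) (at t)" for I
    by (rule has_field_derivative_prod) (rule lin)
  then have "((\<lambda>t. esym (Suc k) A (\<lambda>i. l i + t)) has_real_derivative
      (\<Sum>I\<in>{I. I \<subseteq> A \<and> card I = Suc k}. \<Sum>i\<in>I. 1 * (\<Prod>j\<in>I - {i}. l j + t))) (at t)"
    unfolding esym_def by (intro DERIV_sum)
  moreover have "(\<Sum>I\<in>{I. I \<subseteq> A \<and> card I = Suc k}. \<Sum>i\<in>I. 1 * (\<Prod>j\<in>I - {i}. l j + t))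
      = (\<Sum>i\<in>A. esym k (A - {i}) (\<lambda>i. l i + t))"
    unfolding sum_subsets_remove[OF assms, where k = k and F = "\<lambda>i J. 1 * (\<Prod>j\<in>J. l j + t)"]
    by (simp only: esym_def mult_1)
  ultimately show ?thesis
    by (simp only: sum_esym_remove[OF assms])
qed

lemma continuous_esym_shift: "isCont (\<lambda>t. esym k A (\<lambda>i. l i + t)) t"
  unfolding esym_def by (intro continuous_intros)

lemma esym_pos: "\<lbrakk>finite A; k \<le> card A; \<And>i. i \<in> A \<Longrightarrow> 0 < l i\<rbrakk>
  \<Longrightarrow> 0 < esym k A l"
  unfolding esym_def
proof (rule sum_pos)
  assume "finite A" "k \<le> card A"
  then obtain J where "J \<subseteq> A" "card J = k" by (metis obtain_subset_with_card_n)
  then show "{I. I \<subseteq> A \<and> card I = k} \<noteq> {}" by blast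
qed (auto intro!: prod_pos)

lemma esym_nonzero_card: "finite A \<Longrightarrow> esym k A l \<noteq> 0 \<Longrightarrow> k \<le> card A"
  unfolding esym_def by (metis (mono_tags, lifting) card_mono mem_Collect_eq sum.not_neutral_contains_not_neutral)

text \<open>Each function increases along the diagonal direction as long as its predecessor is positive.\<close>

lemma esym_shift_pos:
  assumes "finite A" "k \<le> card A" "\<And>j. j \<le> k \<Longrightarrow> 0 \<le> esym j A l" "0 < t"
  shows "0 < esym k A (\<lambda>i. l i + t)"
  using assms(2-4)
proof (induction k arbitrary: t)
  case 0
  then show ?case using assms(1) by simp
next
  case (Suc k)
  have "esym (Suc k) A (\<lambda>i. l i + 0) < esym (Suc k) A (\<lambda>i. l i + t)"
  proof (rule DERIV_pos_imp_increasing_open[OF \<open>0 < t\<close>])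
    fix x :: real assume "0 < x" "x < t"
    then have "0 < (real (card A) - real k) * esym k A (\<lambda>i. l i + x)"
      using Suc.IH[of x] Suc.prems by (intro mult_pos_pos) auto
    then show "\<exists>y. DERIV (\<lambda>t. esym (Suc k) A (\<lambda>i. l i + t)) x :> y \<and> 0 < y"
      using has_derivative_esym_shift[OF assms(1)] by blast
  qed (auto intro!: continuous_at_imp_continuous_on continuous_esym_shift)
  then show ?case using Suc.prems(2)[of "Suc k"] by simp
qed

lemma isCont_nonneg_right:
  fixes f :: "real \<Rightarrow> real"
  assumes "isCont f a" "a < b" "\<And>t. a < t \<Longrightarrow> t < b \<Longrightarrow> 0 \<le> f t"
  shows "0 \<le> f a"
proof (rule tendsto_lowerbound)
  show "(f \<longlongrightarrow> f a) (at_right a)"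
    using assms(1) by (simp add: isCont_def filterlim_at_split)
  show "\<forall>\<^sub>F t in at_right a. 0 \<le> f t"
    unfolding eventually_at_right_field using assms by blast
qed simp

text \<open>Induction on \<open>k\<close>. Moving along \<open>l + t (1, \<dots>, 1)\<close> keeps the first \<open>k +
  1\<close> functions positive and
  ends in the positive cone. If \<open>\<sigma>\<^sub>k\<close> of the remaining variables were not positive at the
    start, it would have a last
  zero on the way, and at that point lemma \<open>esym_Suc_Suc\<close> contradicts
    \<open>\<sigma>\<^sub>k\<^sub>+\<^sub>1 > 0\<close>.\<close>

lemma esym_remove_pos:
  assumes "finite A" "i \<in> A" "\<And>j. j \<le> Suc k \<Longrightarrow> 0 < esym j A l"
  shows "\<forall>j\<le>k. 0 < esym j (A - {i}) l"
  using assms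
proof (induction k arbitrary: A i l)
  case 0
  then show ?case by simp
next
  case (Suc k)
  let ?f = "\<lambda>t. esym (Suc k) (A - {i}) (\<lambda>j. l j + t)"
  have low: "0 < esym j (A - {i}) l" if "j \<le> k" for j
    using Suc.IH[OF Suc.prems(1,2)] Suc.prems(3) that by simp
  have card: "Suc (Suc k) \<le> card A"
    using esym_nonzero_card[OF Suc.prems(1), of "Suc (Suc k)" l] Suc.prems(3)[of "Suc (Suc k)"] by simp
  have shift: "0 < esym j A (\<lambda>j. l j + t)" if "j \<le> Suc (Suc k)" "0 \<le> t" for j t
  proof (cases "t = 0")
    case False
    then show ?thesis
      by (intro esym_shift_pos) (use that card Suc.prems in \<open>auto intro: less_imp_le\<close>)
  qed (use Suc.prems that in simp)
  have "0 < ?f 0"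
  proof (rule ccontr)
    assume neg: "\<not> 0 < ?f 0"
    (* at \<open>l + T\<close> all variables are positive *)
    define T where "T = 1 + (\<Sum>j\<in>A. \<bar>l j\<bar>)"
    have "\<bar>l j\<bar> \<le> (\<Sum>j\<in>A. \<bar>l j\<bar>)" if "j \<in> A" for j
      using Suc.prems(1) that by (intro member_le_sum) auto
    then have "0 < l j + T" if "j \<in> A" for j using that unfolding T_def by fastforce
    then have fT: "0 < ?f T" using card Suc.prems(1,2) by (intro esym_pos) auto
    have T: "0 < T" unfolding T_def by (smt (verit) sum_nonneg)
    let ?Z = "{t \<in> {0..T}. ?f t \<le> 0}"
    have "compact ?Z"
    proof -
      have "closed {t. ?f t \<le> 0}"
        by (intro closed_Collect_le) (auto intro!: continuous_at_imp_continuous_on continuous_esym_shift)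
      then have "compact ({0..T} \<inter> {t. ?f t \<le> 0})" by (intro compact_Int_closed compact_Icc)
      then show ?thesis by (simp add: Int_def)
    qed
    moreover have "0 \<in> ?Z" using neg T by auto
    ultimately obtain s where s: "s \<in> ?Z" "\<And>t. t \<in> ?Z \<Longrightarrow> t \<le> s"
      using compact_attains_sup[of ?Z] by blast
    have sT: "s < T" using s fT by (cases "s = T") auto
    have pos: "0 < ?f t" if "s < t" "t < T" for t
    proof (rule ccontr)
      assume "\<not> 0 < ?f t"
      then have "t \<in> ?Z" using s(1) that unfolding mem_Collect_eq atLeastAtMost_iff by linarith
      from s(2)[OF this] that show False by linarith
    qed
    have fs: "?f s = 0"
    proof -
      have "0 \<le> ?f s"
        by (rule isCont_nonneg_right[OF continuous_esym_shift sT]) (rule less_imp_le[OF pos])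
      then show ?thesis using s(1) by simp
    qed
    let ?m = "\<lambda>j. l j + s"
    have nn: "0 \<le> esym k (A - {i} - {j}) ?m" if j: "j \<in> A - {i}" for j
    proof (rule isCont_nonneg_right[OF continuous_esym_shift sT])
      fix t assume t: "s < t" "t < T"
      have "\<forall>j\<le>k. 0 < esym j (A - {i}) (\<lambda>j. l j + t)"
        by (rule Suc.IH) (use Suc.prems shift s t in auto)
      then have "0 < esym m (A - {i}) (\<lambda>j. l j + t)" if "m \<le> Suc k" for m
        using pos[OF t] that by (auto simp: le_Suc_eq)
      then have "\<forall>m\<le>k. 0 < esym m (A - {i} - {j}) (\<lambda>j. l j + t)"
        by (intro Suc.IH) (use Suc.prems j in auto)
      then show "0 \<le> esym k (A - {i} - {j}) (\<lambda>j. l j + t)" by (simp add: less_imp_le)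
    qed
    have "0 \<le> (\<Sum>j\<in>A - {i}. (?m j)\<^sup>2 * esym k (A - {i} - {j}) ?m)"
      by (intro sum_nonneg mult_nonneg_nonneg zero_le_power2 nn)
    then have "real (Suc (Suc k)) * esym (Suc (Suc k)) (A - {i}) ?m \<le> 0"
      using Suc.prems(1) fs by (subst esym_Suc_Suc) auto
    then have "esym (Suc (Suc k)) (A - {i}) ?m \<le> 0" by (simp add: mult_le_0_iff)
    then have "esym (Suc (Suc k)) A ?m \<le> 0"
      using esym_remove[OF Suc.prems(1,2), of "Suc k" ?m] fs by simp
    then show False using shift[of "Suc (Suc k)" s] s by simp
  qed
  then show ?case using low by (auto simp: le_Suc_eq)
qed

lemma esym_remove_nonneg:
  assumes "finite A" "i \<in> A" "Suc k \<le> card A" "\<And>j. j \<le> Suc k \<Longrightarrow> 0 \<le> esym j A l"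
  shows "0 \<le> esym k (A - {i}) l"
proof -
  have "0 \<le> esym k (A - {i}) (\<lambda>j. l j + 0)"
  proof (rule isCont_nonneg_right[OF continuous_esym_shift])
    fix t :: real assume "0 < t" "t < 1"
    then have "0 < esym j A (\<lambda>j. l j + t)" if "j \<le> Suc k" for j
      by (intro esym_shift_pos) (use assms that in auto)
    then show "0 \<le> esym k (A - {i}) (\<lambda>j. l j + t)"
      using esym_remove_pos[OF assms(1,2), of k] by (simp add: less_imp_le)
  qed simp
  then show ?thesis by simp
qed

text \<open>This is what makes the cone closed in \<open>{\<sigma>\<^sub>k > 0}\<close>. If
  \<open>\<sigma>\<^sub>j\<close> vanished and \<open>\<sigma>\<^sub>j\<^sub>+\<^sub>1\<close> did not, one would have
  \<open>\<sigma>\<^sub>j\<^sub>+\<^sub>1 \<le> 0\<close> by lemma \<open>esym_Suc_Suc\<close>.\<close>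

lemma esym_pos_of_nonneg:
  assumes "finite A" "0 < esym k A l" "\<And>j. j \<le> k \<Longrightarrow> 0 \<le> esym j A l" "j \<le> k"
  shows "0 < esym j A l"
  using \<open>j \<le> k\<close>
proof (induction j rule: inc_induct)
  case base
  show ?case using assms by simp
next
  case (step m)
  show ?case
  proof (cases m)
    case 0
    then show ?thesis using assms by simp
  next
    case (Suc j)
    have card: "Suc m \<le> card A"
      using esym_nonzero_card[OF assms(1)] step.IH by (metis less_irrefl)
    show ?thesis
    proof (rule ccontr)
      assume "\<not> 0 < esym m A l"
      then have z: "esym (Suc j) A l = 0" using assms(3)[of m] step Suc by simp
      have "0 \<le> esym j (A - {i}) l" if "i \<in> A" for i
        by (rule esym_remove_nonneg) (use assms that card step Suc in auto)
      then have "real (Suc (Suc j)) * esym (Suc (Suc j)) A l \<le> 0"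
        using assms(1) z by (subst esym_Suc_Suc) (auto intro!: sum_nonneg)
      then show False using step.IH Suc by (simp add: mult_le_0_iff)
    qed
  qed
qed

lemma continuous_on_sigma: "continuous_on UNIV (sigma k)"
  unfolding sigma_def by (intro continuous_intros)

text \<open>The set where all of \<open>\<sigma>\<^sub>0, \<dots>, \<sigma>\<^sub>k\<close> are positive is open and
  closed in \<open>{\<sigma>\<^sub>k > 0}\<close>, hence contains the
  connected component of \<open>(1, \<dots>, 1)\<close>.\<close>

lemma Gamma_imp_sigma_pos:
  fixes l :: "real^'n::finite"
  assumes "k \<le> CARD('n)" "l \<in> Gamma k" "j \<le> k"
  shows "0 < sigma j l"
proof -
  let ?P = "\<Inter>j\<in>{..k}. {l :: real^'n. 0 < sigma j l}" and ?N = "\<Union>j\<in>{..k}. {l :: real^'n. sigma j l < 0}"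
  have op: "open ?P" "open ?N"
    by (intro open_INT open_UN ballI open_Collect_less continuous_on_sigma continuous_on_const finite_atMost)+
  have conn: "connected (Gamma k :: (real^'n) set)" unfolding Gamma_def by simp
  have one: "(\<chi> i. 1) \<in> Gamma k \<inter> ?P"
    unfolding Gamma_def by (auto simp: connected_component_refl_eq intro!: sigma_pos assms(1) order_trans[OF _ assms(1)])
  have pos: "0 < sigma k m" if "m \<in> Gamma k" for m :: "real^'n"
    using that connected_component_subset unfolding Gamma_def by fastforce
  have cover: "Gamma k \<subseteq> ?P \<union> ?N"
  proof
    fix m :: "real^'n" assume m: "m \<in> Gamma k"
    show "m \<in> ?P \<union> ?N"
    proof (cases "m \<in> ?N")
      case False
      then have "\<forall>j\<le>k. 0 \<le> esym j UNIV (($) m)" by (auto simp: sigma_eq_esym not_less)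
      then have "m \<in> ?P"
        using esym_pos_of_nonneg[of UNIV k "($) m"] pos[OF m] by (auto simp: sigma_eq_esym)
      then show ?thesis ..
    qed simp
  qed
  have "?P \<inter> ?N \<inter> Gamma k = {}" by force
  then have "?N \<inter> Gamma k = {}"
    using connectedD[OF conn op _ cover] one by blast
  then show ?thesis using cover assms by blast
qed

section \<open>Symmetric functions of a pencil of matrices\<close>

text \<open>The coefficients of \<open>det (t A + B)\<close>. For \<open>A = G\<close> and \<open>B = T\<close> they
  are \<open>det G\<close> times \<open>\<sigma>\<^sub>k\<close> of the eigenvalues of
  \<open>G\<^sup>-\<^sup>1 T\<close>. They are polynomials in the entries and behave well under congruence, so no
    inverse matrix has
  to be differentiated.\<close>

definition mixed :: "nat \<Rightarrow> real^'n^'n::finite \<Rightarrow> real^'n^'n \<Rightarrow> real" where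
  "mixed k A B = (\<Sum>I\<in>{I. I \<subseteq> UNIV \<and> card I = k}. det (\<chi> i. if i \<in> I then B $ i else A $ i))"

lemma sum_Pow_by_card:
  fixes F :: "'n::finite set \<Rightarrow> real"
  shows "(\<Sum>I\<in>Pow UNIV. F I) = (\<Sum>k\<le>CARD('n). \<Sum>I\<in>{I. I \<subseteq> UNIV \<and> card I = k}. F I)"
proof -
  have "(\<Sum>k\<le>CARD('n). \<Sum>I\<in>{I \<in> Pow UNIV. card I = k}. F I) = (\<Sum>I\<in>Pow UNIV. F I)"
    by (rule sum.group) (auto intro: card_mono)
  then show ?thesis by simp
qed

lemma prod_shift_esym:
  fixes l :: "'n::finite \<Rightarrow> real"
  shows "(\<Prod>i\<in>UNIV. l i + t) = (\<Sum>k\<le>CARD('n). esym k UNIV l * t ^ (CARD('n) - k))"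
proof -
  have "(\<Prod>i\<in>UNIV. l i + t) = (\<Sum>I\<in>Pow UNIV. (\<Prod>i\<in>I. l i) * t ^ (CARD('n) - card I))"
    by (subst prod_add) (simp_all add: card_Diff_subset del: Pow_UNIV)
  also have "\<dots> = (\<Sum>k\<le>CARD('n). esym k UNIV l * t ^ (CARD('n) - k))"
    unfolding sum_Pow_by_card esym_def sum_distrib_right by (intro sum.cong refl) auto
  finally show ?thesis .
qed

lemma det_pencil:
  fixes A B :: "real^'n^'n::finite"
  shows "det (t *\<^sub>R A + B) = (\<Sum>k\<le>CARD('n). mixed k A B * t ^ (CARD('n) - k))"
proof -
  let ?P = "{p. p permutes (UNIV :: 'n set)}"
  let ?M = "\<lambda>I. (\<chi> i. if i \<in> I then B $ i else A $ i) :: real^'n^'n"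
  have 1: "(\<Prod>i\<in>I. B $ i $ p i) * (\<Prod>i\<in>UNIV - I. t * A $ i $ p i)
     = t ^ (CARD('n) - card I) * (\<Prod>i\<in>UNIV. ?M I $ i $ p i)" for I p
  proof -
    have "(\<Prod>i\<in>UNIV. ?M I $ i $ p i) = (\<Prod>i\<in>I. ?M I $ i $ p i) * (\<Prod>i\<in>UNIV - I. ?M I $ i $ p i)"
      by (subst prod.subset_diff[OF subset_UNIV finite, of _ I]) (rule mult.commute)
    also have "\<dots> = (\<Prod>i\<in>I. B $ i $ p i) * (\<Prod>i\<in>UNIV - I. A $ i $ p i)"
      by (intro arg_cong2[where f = "(*)"] prod.cong) auto
    finally show ?thesis by (simp add: prod.distrib card_Diff_subset)
  qed
  have "det (t *\<^sub>R A + B) = (\<Sum>p\<in>?P. of_int (sign p) * (\<Prod>i\<in>UNIV. B $ i $ p i + t * A $ i $ p i))"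
    by (simp add: det_def add.commute)
  also have "\<dots> = (\<Sum>p\<in>?P. \<Sum>I\<in>Pow UNIV. of_int (sign p) * (t ^ (CARD('n) - card I) *
    (\<Prod>i\<in>UNIV. ?M I $ i $ p i)))"
    by (subst prod_add) (simp_all only: 1 sum_distrib_left finite_class.finite_UNIV)
  also have "\<dots> = (\<Sum>I\<in>Pow UNIV. \<Sum>p\<in>?P. of_int (sign p) * (t ^ (CARD('n) - card I) *
    (\<Prod>i\<in>UNIV. ?M I $ i $ p i)))"
    by (rule sum.swap)
  also have "\<dots> = (\<Sum>I\<in>Pow UNIV. t ^ (CARD('n) - card I) * det (?M I))"
    unfolding det_def by (intro sum.cong refl) (simp only: sum_distrib_left mult.left_commute)
  also have "\<dots> = (\<Sum>k\<le>CARD('n). mixed k A B * t ^ (CARD('n) - k))"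
    unfolding sum_Pow_by_card mixed_def sum_distrib_right by (intro sum.cong refl) auto
  finally show ?thesis .
qed

text \<open>For comparing coefficients of pencils, whose powers of \<open>t\<close> descend.\<close>

lemma rev_coeffs_unique:
  fixes a b :: "nat \<Rightarrow> real"
  assumes "\<And>t. (\<Sum>k\<le>n. a k * t ^ (n - k)) = (\<Sum>k\<le>n. b k * t ^ (n - k))" "k \<le> n"
  shows "a k = b k"
proof -
  have rev: "(\<Sum>k\<le>n. c k * t ^ (n - k)) = (\<Sum>i\<le>n. c (n - i) * t ^ i)" for c :: "nat \<Rightarrow> real" and t
    by (rule sum.reindex_bij_witness[where i = "\<lambda>i. n - i" and j = "\<lambda>i. n - i"]) auto
  have "a (n - (n - k)) = b (n - (n - k))"
    using polyfun_eq_coeffs[of "\<lambda>i. a (n - i)" n "\<lambda>i. b (n - i)"] assms(1) unfolding rev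
    by (metis diff_le_self)
  then show ?thesis using assms(2) by simp
qed

lemma mixed_eqI:
  fixes A B C D :: "real^'n^'n::finite"
  assumes "\<And>t. det (t *\<^sub>R A + B) = c * det (t *\<^sub>R C + D)" "k \<le> CARD('n)"
  shows "mixed k A B = c * mixed k C D"
  by (rule rev_coeffs_unique[where a = "\<lambda>k. mixed k A B", OF _ assms(2)])
    (use assms(1) in \<open>simp add: det_pencil sum_distrib_left mult.assoc\<close>)

lemma scaleR_matrix_mul_left: "(c *\<^sub>R (A :: real^'b^'c)) ** (B :: real^'d^'b) = c *\<^sub>R (A ** B)"
  by (simp add: matrix_matrix_mult_def vec_eq_iff sum_distrib_left mult.assoc)

lemma scaleR_matrix_mul_right: "(A :: real^'b^'c) ** (c *\<^sub>R (B :: real^'d^'b)) = c *\<^sub>R (A ** B)"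
  by (simp add: matrix_matrix_mult_def vec_eq_iff sum_distrib_left mult.left_commute)

lemma matrix_add_rdistrib: "((A :: real^'b^'c) + B) ** (C :: real^'d^'b) = A ** C + B ** C"
  by (simp add: matrix_matrix_mult_def vec_eq_iff sum.distrib algebra_simps)

lemma matrix_inv_inverse:
  assumes "invertible (A :: real^'n^'n::finite)"
  shows "A ** matrix_inv A = mat 1" "matrix_inv A ** A = mat 1"
  using someI_ex[OF assms[unfolded invertible_def]] unfolding matrix_inv_def by auto

lemma mixed_congruence:
  fixes A B E :: "real^'n^'n::finite"
  assumes "k \<le> CARD('n)"
  shows "mixed k (transpose E ** A ** E) (transpose E ** B ** E) = (det E)\<^sup>2 * mixed k A B"
proof (rule mixed_eqI[OF _ assms])
  fix t
  have "t *\<^sub>R (transpose E ** A ** E) + transpose E ** B ** E = transpose E ** (t *\<^sub>R A + B) ** E"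
    by (simp only: matrix_add_ldistrib matrix_add_rdistrib scaleR_matrix_mul_left scaleR_matrix_mul_right)
  then show "det (t *\<^sub>R (transpose E ** A ** E) + transpose E ** B ** E) = (det E)\<^sup>2 * det (t *\<^sub>R A + B)"
    by (simp add: det_mul power2_eq_square)
qed

lemma mixed_0 [simp]: "mixed 0 A B = det A"
proof -
  have "{I :: 'a set. I \<subseteq> UNIV \<and> card I = 0} = {{}}" by auto
  then show ?thesis by (simp add: mixed_def)
qed

lemma mixed_eigenvalues:
  fixes G T :: "real^'n^'n::finite"
  assumes "invertible G" "lists_eigenvalues (matrix_inv G ** T) l" "k \<le> CARD('n)"
  shows "mixed k G T = det G * sigma k l"
proof -
  let ?M = "matrix_inv G ** T"
  have G: "G ** matrix_inv G = mat 1" using assms(1) by (rule matrix_inv_inverse)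
  have "det (t *\<^sub>R G + T) = det G * (\<Prod>i\<in>UNIV. l $ i + t)" for t
  proof -
    have GM: "G ** ?M = T" by (simp add: matrix_mul_assoc G)
    have "t *\<^sub>R G + T = G ** (mat t + ?M)"
      by (simp add: matrix_add_ldistrib GM)
        (simp add: matrix_matrix_mult_def mat_def vec_eq_iff if_distrib cong: if_cong)
    moreover have "mat t + ?M = - (mat (- t) - ?M)"
      by (simp add: vec_eq_iff mat_def)
    moreover have "det (- N) = (- 1) ^ CARD('n) * det N" for N :: "real^'n^'n"
      by (simp add: det_def prod_uminus sum_distrib_left mult_ac)
    ultimately have "det (t *\<^sub>R G + T) = det (G ** (- (mat (- t) - ?M)))"
      "det (- (mat (- t) - ?M)) = (- 1) ^ CARD('n) * det (mat (- t) - ?M)" by metis+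
    then have "det (t *\<^sub>R G + T) = det G * ((- 1) ^ CARD('n) * (\<Prod>i\<in>UNIV. - t - l $ i))"
      using assms(2) by (simp only: det_mul lists_eigenvalues_def)
    also have "(- 1) ^ CARD('n) * (\<Prod>i\<in>UNIV. - t - l $ i) = (\<Prod>i\<in>UNIV. l $ i + t)"
      by (subst prod_uminus[symmetric]) (simp add: add.commute)
    finally show ?thesis .
  qed
  then show ?thesis
    using assms(3) unfolding sigma_eq_esym
    by (intro rev_coeffs_unique[where b = "\<lambda>k. det G * esym k UNIV (($) l)"])
      (simp_all add: det_pencil prod_shift_esym sum_distrib_left mult.assoc)
qed

text \<open>A permutation other than the identity moves at least two indices, so its product vanishes to second order.\<close>

lemma has_derivative_det_at_diagonal:
  fixes M :: "real \<Rightarrow> real^'n^'n::finite"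
  assumes der: "\<And>i j. ((\<lambda>t. M t $ i $ j) has_real_derivative M' $ i $ j) (at s)"
    and diag: "\<And>i j. M s $ i $ j = (if i = j then d i else 0)"
  shows "((\<lambda>t. det (M t)) has_real_derivative (\<Sum>m\<in>UNIV. M' $ m $ m * (\<Prod>j\<in>UNIV - {m}. d j))) (at s)"
proof -
  let ?P = "{p. p permutes (UNIV :: 'n set)}"
  let ?D = "\<lambda>p. \<Sum>m\<in>UNIV. M' $ m $ p m * (\<Prod>j\<in>UNIV - {m}. M s $ j $ p j)"
  have "((\<lambda>t. det (M t)) has_real_derivative (\<Sum>p\<in>?P. of_int (sign p) * ?D p)) (at s)"
    unfolding det_def by (intro DERIV_sum DERIV_cmult has_field_derivative_prod der)
  also have "(\<Sum>p\<in>?P. of_int (sign p) * ?D p) = (\<Sum>p\<in>{id}. of_int (sign p) * ?D p)"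
  proof (rule sum.mono_neutral_right)
    show "\<forall>p\<in>?P - {id}. of_int (sign p) * ?D p = 0"
    proof
      fix p assume "p \<in> ?P - {id}"
      then have p: "p permutes UNIV" "p \<noteq> id" by auto
      then obtain a where a: "p a \<noteq> a" by fastforce
      have "p (p a) \<noteq> p a" using a permutes_inj[OF p(1)] by (simp add: inj_eq)
      then have "\<exists>j. j \<noteq> m \<and> p j \<noteq> j" for m using a by metis
      then have z: "(\<Prod>j\<in>UNIV - {m}. M s $ j $ p j) = 0" for m
      proof -
        obtain j where "j \<noteq> m" "p j \<noteq> j" using \<open>\<And>m. \<exists>j. j \<noteq> m \<and> p j
          \<noteq> j\<close> by blast
        then have "M s $ j $ p j = 0" "j \<in> UNIV - {m}" using diag[of j "p j"] by auto
        then show ?thesis by (intro prod_zero) auto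
      qed
      show "of_int (sign p) * ?D p = 0" by (simp only: z mult_zero_right sum.neutral_const)
    qed
  qed (auto simp: permutes_id)
  finally show ?thesis by (simp add: diag sign_id)
qed

text \<open>In a frame that diagonalizes both matrices and stays orthonormal to first order, only the diagonal entries of the
  derivative matter, with weights \<open>\<partial>\<sigma>\<^sub>k\<^sub>+\<^sub>1 /
    \<partial>\<lambda>\<^sub>m\<close>.\<close>

lemma has_derivative_mixed_at_diagonal:
  fixes A B :: "real \<Rightarrow> real^'n^'n::finite"
  assumes A: "\<And>i j. ((\<lambda>t. A t $ i $ j) has_real_derivative 0) (at s)" "A s = mat 1"
    and B: "\<And>i j. ((\<lambda>t. B t $ i $ j) has_real_derivative B' $ i $ j) (at s)"
      "\<And>i j. B s $ i $ j = (if i = j then l i else 0)"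
  shows "((\<lambda>t. mixed (Suc k) (A t) (B t)) has_real_derivative
           (\<Sum>m\<in>UNIV. B' $ m $ m * esym k (UNIV - {m}) l)) (at s)"
proof -
  have summand: "((\<lambda>t. det (\<chi> i. if i \<in> I then B t $ i else A t $ i)) has_real_derivative
      (\<Sum>m\<in>I. B' $ m $ m * (\<Prod>j\<in>I - {m}. l j))) (at s)" for I
  proof -
    have 1: "((\<lambda>t. det (\<chi> i. if i \<in> I then B t $ i else A t $ i)) has_real_derivative
      (\<Sum>m\<in>UNIV. (\<chi> i. if i \<in> I then B' $ i else 0) $ m $ m * (\<Prod>j\<in>UNIV - {m}. if j \<in> I
        then l j else 1))) (at s)"
    proof (rule has_derivative_det_at_diagonal)
      show "((\<lambda>t. (\<chi> i. if i \<in> I then B t $ i else A t $ i) $ i $ j) has_real_derivative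
          (\<chi> i. if i \<in> I then B' $ i else 0) $ i $ j) (at s)" for i j
        using A(1)[of i j] B(1)[of i j] by (cases "i \<in> I") simp_all
      show "(\<chi> i. if i \<in> I then B s $ i else A s $ i) $ i $ j = (if i = j then if i \<in> I then l i else 1
        else 0)" for i j
        by (simp add: B(2) A(2) mat_def)
    qed
    have 2: "(\<Sum>m\<in>UNIV. (\<chi> i. if i \<in> I then B' $ i else 0) $ m $ m * (\<Prod>j\<in>UNIV - {m}. if j
      \<in> I then l j else 1))
       = (\<Sum>m\<in>UNIV. if m \<in> I then B' $ m $ m * (\<Prod>j\<in>I - {m}. l j) else 0)"
    proof (intro sum.cong refl)
      fix m
      have "(\<Prod>j\<in>UNIV - {m}. if j \<in> I then l j else 1) = (\<Prod>j\<in>I - {m}. l j)"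
      proof -
        have "(UNIV - {m}) \<inter> I = I - {m}" by auto
        then show ?thesis using prod.inter_restrict[OF finite, of l "UNIV - {m}" I] by metis
      qed
      then show "(\<chi> i. if i \<in> I then B' $ i else 0) $ m $ m * (\<Prod>j\<in>UNIV - {m}. if j \<in> I then l j else 1)
        = (if m \<in> I then B' $ m $ m * (\<Prod>j\<in>I - {m}. l j) else 0)"
        by (cases "m \<in> I") simp_all
    qed
    also have "\<dots> = (\<Sum>m\<in>I. B' $ m $ m * (\<Prod>j\<in>I - {m}. l j))"
      by (rule trans[OF sum.inter_restrict[OF finite, symmetric]]) (simp only: Int_UNIV_left)
    finally show ?thesis by (rule DERIV_cong[OF 1])
  qed
  have der: "((\<lambda>t. mixed (Suc k) (A t) (B t)) has_real_derivative
      (\<Sum>I\<in>{I. I \<subseteq> UNIV \<and> card I = Suc k}. \<Sum>m\<in>I. B' $ m $ m * (\<Prod>j\<in>I - {m}. l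
        j))) (at s)"
    unfolding mixed_def by (rule DERIV_sum[where f = "\<lambda>t I. det (\<chi> i. if i \<in> I then B t $ i else A t $
      i)"]) (rule summand)
  have "(\<Sum>I\<in>{I. I \<subseteq> UNIV \<and> card I = Suc k}. \<Sum>m\<in>I. B' $ m $ m * (\<Prod>j\<in>I - {m}. l j))
      = (\<Sum>m\<in>UNIV. \<Sum>J\<in>{J. J \<subseteq> UNIV - {m} \<and> card J = k}. B' $ m $ m * (\<Prod>j\<in>J. l j))"
    by (rule sum_subsets_remove[OF finite, where F = "\<lambda>m J. B' $ m $ m * (\<Prod>j\<in>J. l j)"])
  also have "\<dots> = (\<Sum>m\<in>UNIV. B' $ m $ m * esym k (UNIV - {m}) l)"
    unfolding esym_def by (rule sum.cong[OF refl]) (rule sum_distrib_left[symmetric])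
  finally show ?thesis by (rule DERIV_cong[OF der])
qed

lemma mixed_diagonal:
  fixes B :: "real^'n^'n::finite"
  assumes "\<And>i j. B $ i $ j = (if i = j then l i else 0)"
  shows "mixed k (mat 1) B = esym k UNIV l"
proof -
  have "det (\<chi> i. if i \<in> I then B $ i else mat 1 $ i) = (\<Prod>i\<in>I. l i)" for I
  proof -
    have "det (\<chi> i. if i \<in> I then B $ i else mat 1 $ i) = (\<Prod>i\<in>UNIV. if i \<in> I then l i else 1)"
      by (subst det_diagonal) (auto simp: assms mat_def intro!: prod.cong)
    then show ?thesis
      using prod.inter_restrict[OF finite, of l UNIV I] by (simp only: Int_UNIV_left)
  qed
  then show ?thesis by (simp add: mixed_def esym_def)
qed

lemma continuous_on_det:
  fixes M :: "'b::topological_space \<Rightarrow> real^'n^'n::finite"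
  assumes "continuous_on S M"
  shows "continuous_on S (\<lambda>x. det (M x))"
  unfolding det_def by (intro continuous_intros assms)

lemma continuous_on_mixed:
  fixes A B :: "'b::topological_space \<Rightarrow> real^'n^'n::finite"
  assumes "continuous_on S A" "continuous_on S B"
  shows "continuous_on S (\<lambda>x. mixed k (A x) (B x))"
proof -
  have "continuous_on S (\<lambda>x. if i \<in> I then B x $ i else A x $ i)" for i I
    using assms by (cases "i \<in> I") (auto intro!: continuous_intros)
  then show ?thesis
    unfolding mixed_def by (intro continuous_intros continuous_on_det continuous_on_vec_lambda)
qed

section \<open>Simultaneous diagonalization and admissible pairs\<close>

definition bilin :: "real^'n^'n::finite \<Rightarrow> real^'n \<Rightarrow> real^'n \<Rightarrow> real" where
  "bilin M a b = a \<bullet> (M *v b)"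

lemma bilin_add_left: "bilin M (a + b) c = bilin M a c + bilin M b c"
  and bilin_add_right: "bilin M a (b + c) = bilin M a b + bilin M a c"
  and bilin_scaleR_left: "bilin M (r *\<^sub>R a) c = r * bilin M a c"
  and bilin_scaleR_right: "bilin M a (r *\<^sub>R c) = r * bilin M a c"
  and bilin_diff_left: "bilin M (a - b) c = bilin M a c - bilin M b c"
  and bilin_diff_right: "bilin M a (b - c) = bilin M a b - bilin M a c"
  and bilin_minus_left: "bilin M (- a) c = - bilin M a c"
  and bilin_minus_right: "bilin M a (- c) = - bilin M a c"
  and bilin_zero_left: "bilin M 0 c = 0"
  and bilin_zero_right: "bilin M a 0 = 0"
  unfolding bilin_def
  by (simp_all add: inner_add_left inner_add_right inner_diff_left inner_diff_right matrix_vector_right_distrib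
      matrix_vector_mult_diff_distrib matrix_vector_mult_scaleR linear_neg[OF matrix_vector_mul_linear])

lemmas bilin_simps = bilin_add_left bilin_add_right bilin_scaleR_left bilin_scaleR_right bilin_diff_left bilin_diff_right
  bilin_minus_left bilin_minus_right bilin_zero_left bilin_zero_right

lemma bilin_add_matrix: "bilin (M + N) a b = bilin M a b + bilin N a b"
  and bilin_scaleR_matrix: "bilin (r *\<^sub>R M) a b = r * bilin M a b"
  by (simp_all add: bilin_def matrix_vector_mult_add_rdistrib inner_add_right scaleR_matrix_vector_assoc[symmetric])

lemma bilin_sym: "transpose M = M \<Longrightarrow> bilin M a b = bilin M b a"
  unfolding bilin_def by (metis dot_lmul_matrix inner_commute transpose_matrix_vector)

lemma bilin_sum: "bilin M a b = (\<Sum>i\<in>UNIV. \<Sum>j\<in>UNIV. a $ i * M $ i $ j * b $ j)"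
  by (simp add: bilin_def inner_vec_def matrix_vector_mult_def sum_distrib_left mult.assoc)

lemma bilin_axis: "bilin M (axis i 1) (axis j 1) = M $ i $ j"
  by (simp add: bilin_def matrix_vector_mult_basis column_def inner_axis')

lemma bilin_congruence: "bilin (transpose E ** M ** E) a b = bilin M (E *v a) (E *v b)"
  unfolding bilin_def
  by (simp add: matrix_vector_mul_assoc[symmetric] dot_lmul_matrix[symmetric] transpose_matrix_vector[symmetric] del:
    transpose_matrix_vector)

lemma congruence_entry: "(transpose E ** M ** E) $ i $ j = bilin M (column i E) (column j E)"
  by (metis bilin_axis bilin_congruence matrix_vector_mult_basis)

definition posdef :: "real^'n^'n::finite \<Rightarrow> bool" where
  "posdef G \<longleftrightarrow> transpose G = G \<and> (\<forall>v. v \<noteq> 0 \<longrightarrow> 0 < bilin G v v)"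

lemma continuous_on_bilin:
  assumes "continuous_on S M" "continuous_on S a" "continuous_on S b"
  shows "continuous_on S (\<lambda>x. bilin (M x) (a x) (b x))"
  unfolding bilin_sum using assms by (intro continuous_intros)

lemma posdef_coercive:
  assumes "posdef (G :: real^'n^'n::finite)"
  obtains c where "0 < c" "\<And>v. c * (norm v)\<^sup>2 \<le> bilin G v v"
proof -
  have cont: "continuous_on (sphere 0 1) (\<lambda>v. bilin G v v)" by (intro continuous_on_bilin continuous_intros)
  have "sphere (0::real^'n) 1 \<noteq> {}" by simp
  then obtain w where w: "w \<in> sphere 0 1" "\<And>v. v \<in> sphere 0 1 \<Longrightarrow> bilin G w w \<le> bilin G v v"
    using continuous_attains_inf[OF compact_sphere _ cont] by blast
  have "bilin G w w * (norm v)\<^sup>2 \<le> bilin G v v" for v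
  proof (cases "v = 0")
    case False
    then have "bilin G w w \<le> bilin G (v /\<^sub>R norm v) (v /\<^sub>R norm v)" by (intro w) simp
    then show ?thesis using False by (simp add: bilin_simps field_simps power2_eq_square)
  qed (simp add: bilin_simps)
  moreover have "w \<noteq> 0" using w(1) by auto
  then have "0 < bilin G w w" using assms unfolding posdef_def by blast
  ultimately show ?thesis using that by blast
qed

text \<open>The first order condition behind the Rayleigh quotient below.\<close>

lemma linear_le_quadratic_imp_zero:
  fixes a b :: real
  assumes "\<And>t. t * a \<le> t\<^sup>2 * b"
  shows "a = 0"
proof -
  define c where "c = \<bar>b\<bar> + 1"
  have c: "0 < c" "b \<le> c - 1" unfolding c_def by auto
  have "a / (2 * c) * a * (4 * c\<^sup>2) \<le> (a / (2 * c))\<^sup>2 * b * (4 * c\<^sup>2)"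
    using assms[of "a / (2 * c)"] by (intro mult_right_mono) auto
  then have "2 * c * a\<^sup>2 \<le> a\<^sup>2 * b"
    using c(1) by (simp add: power2_eq_square field_simps)
  also have "\<dots> \<le> a\<^sup>2 * c" using c(2) by (intro mult_left_mono) auto
  finally have "c * a\<^sup>2 \<le> 0" by (simp add: mult.commute)
  then show ?thesis using c(1) by (simp add: mult_le_0_iff)
qed

lemma exists_constrained_maximum:
  fixes G T :: "real^'n^'n::finite" and V :: "(real^'n) set"
  assumes G: "posdef G" and V: "subspace V" "v \<in> V" "v \<noteq> 0"
  obtains w where "w \<in> V" "bilin G w w = 1" "\<And>x. x \<in> V \<Longrightarrow> bilin T x x \<le> bilin T w w *
    bilin G x x"
proof -
  obtain c where c: "0 < c" "\<And>v. c * (norm v)\<^sup>2 \<le> bilin G v v" by (rule posdef_coercive[OF G]) blast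
  let ?C = "V \<inter> {x. bilin G x x = 1}"
  have "closed {x. bilin G x x = 1}"
    by (intro closed_Collect_eq continuous_on_bilin continuous_intros)
  then have "closed ?C" using closed_subspace[OF V(1)] by blast
  moreover have "norm x \<le> 1 + 1 / c" if "x \<in> ?C" for x
  proof -
    have "(norm x)\<^sup>2 \<le> 1 / c" using c(2)[of x] that c(1) by (simp add: field_simps)
    also have "\<dots> \<le> (1 + 1 / c)\<^sup>2" using c(1) by (simp add: power2_eq_square field_simps)
    finally show ?thesis using c(1) by (simp add: power2_le_iff_abs_le)
  qed
  ultimately have comp: "compact ?C" by (auto simp: compact_eq_bounded_closed bounded_iff)
  have unit: "x /\<^sub>R sqrt (bilin G x x) \<in> ?C" if "x \<in> V" "x \<noteq> 0" for x
  proof -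
    have "0 < bilin G x x" using G that unfolding posdef_def by blast
    then show ?thesis
      using that subspace_scale[OF V(1)] by (simp add: bilin_simps field_simps)
  qed
  then have ne: "?C \<noteq> {}" using V by blast
  have cont: "continuous_on ?C (\<lambda>x. bilin T x x)" by (intro continuous_on_bilin continuous_intros)
  obtain w where w: "w \<in> ?C" "\<And>x. x \<in> ?C \<Longrightarrow> bilin T x x \<le> bilin T w w"
    using continuous_attains_sup[OF comp ne cont] by blast
  have "bilin T x x \<le> bilin T w w * bilin G x x" if "x \<in> V" for x
  proof (cases "x = 0")
    case False
    then have "0 < bilin G x x" using G unfolding posdef_def by blast
    then show ?thesis using w(2)[OF unit[OF that False]] by (simp add: bilin_simps field_simps)
  qed (simp add: bilin_simps)
  then show ?thesis using that w(1) by blast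
qed

text \<open>The next vector maximizes the quotient of the two forms on the orthogonal complement of the previous ones.\<close>

lemma generalized_eigenbasis:
  fixes G T :: "real^'n^'n::finite"
  assumes G: "posdef G" and T: "transpose T = T"
  shows "\<exists>(e :: 'n \<Rightarrow> real^'n) l. (\<forall>i\<in>S. \<forall>j\<in>S. bilin G (e i) (e j) = (if i =
    j then 1 else 0)) \<and>
               (\<forall>i\<in>S. \<forall>w. bilin T (e i) w = l i * bilin G (e i) w)"
  using finite[of S]
proof (induction S rule: finite_induct)
  case empty
  then show ?case by simp
next
  case (insert s S)
  then obtain e :: "'n \<Rightarrow> real^'n" and l where
    on: "\<And>i j. i \<in> S \<Longrightarrow> j \<in> S \<Longrightarrow> bilin G (e i) (e j) = (if i = j then 1 else 0)" and
    ev: "\<And>i w. i \<in> S \<Longrightarrow> bilin T (e i) w = l i * bilin G (e i) w" by blast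
  have sG: "bilin G a b = bilin G b a" and sT: "bilin T a b = bilin T b a" for a b
    using G T bilin_sym unfolding posdef_def by blast+
  let ?V = "{v. \<forall>i\<in>S. bilin G (e i) v = 0}"
  have sub: "subspace ?V" by (auto simp: subspace_def bilin_simps)
  have "card S < CARD('n)" using insert.hyps by (metis UNIV_I finite_code psubsetI psubset_card_mono subset_UNIV)
  then have "dim ((\<lambda>i. e i v* G) ` S) < DIM(real^'n)"
    using dim_le_card'[of "(\<lambda>i. e i v* G) ` S"] card_image_le[of S "\<lambda>i. e i v* G"] insert.hyps by simp
  then obtain v where v: "v \<noteq> 0" "\<And>y. y \<in> span ((\<lambda>i. e i v* G) ` S) \<Longrightarrow> orthogonal v y"
    using orthogonal_to_subspace_exists by blast
  have "bilin G (e i) v = 0" if "i \<in> S" for i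
  proof -
    have "orthogonal v (e i v* G)" by (intro v(2) span_base) (use that in auto)
    then show ?thesis unfolding bilin_def orthogonal_def by (metis dot_lmul_matrix inner_commute)
  qed
  then have vV: "v \<in> ?V" by blast
  obtain w where w: "w \<in> ?V" "bilin G w w = 1" and
    max: "\<And>x. x \<in> ?V \<Longrightarrow> bilin T x x \<le> bilin T w w * bilin G x x"
    by (rule exists_constrained_maximum[OF G sub vV v(1), of T]) blast
  let ?l = "bilin T w w"
  have crit: "bilin T w x = ?l * bilin G w x" if x: "x \<in> ?V" for x
  proof -
    have "t * (2 * (bilin T w x - ?l * bilin G w x)) \<le> t\<^sup>2 * (?l * bilin G x x - bilin T x x)" for t
      using max[of "w + t *\<^sub>R x"] w x sG[of x w] sT[of x w]
      by (simp add: bilin_simps algebra_simps power2_eq_square)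
    then show ?thesis using linear_le_quadratic_imp_zero by fastforce
  qed
  have ev': "bilin T w x = ?l * bilin G w x" for x
  proof -
    (* \<open>y\<close> is the projection of \<open>x\<close> to the complement, on which \<open>crit\<close> applies *)
    define y where "y = x - (\<Sum>i\<in>S. bilin G (e i) x *\<^sub>R e i)"
    have lin: "bilin M a (\<Sum>i\<in>S. f i *\<^sub>R e i) = (\<Sum>i\<in>S. f i * bilin M a (e i))" for M a f
      using insert.hyps(1) by (induction S rule: finite_induct) (simp_all add: bilin_simps)
    have "bilin G (e j) y = 0" if "j \<in> S" for j
    proof -
      have "(\<Sum>i\<in>S. bilin G (e i) x * bilin G (e j) (e i)) = (\<Sum>i\<in>S. if i = j then bilin G (e i) x else 0)"
        by (intro sum.cong refl) (use on that in auto)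
      then show ?thesis using insert.hyps that by (simp add: y_def bilin_simps lin)
    qed
    then have "bilin T w y = ?l * bilin G w y" by (intro crit) simp
    moreover have "bilin G w (e i) = 0" "bilin T w (e i) = 0" if "i \<in> S" for i
      using w(1) ev[OF that, of w] sG[of w] sT[of w] that by auto
    ultimately show ?thesis by (simp add: y_def bilin_simps lin)
  qed
  obtain L where L: "\<And>x. bilin T w x = L * bilin G w x" using ev' by blast
  have "bilin G w (e i) = 0" "bilin G (e i) w = 0" if "i \<in> S" for i using w(1) sG[of w] that by auto
  then show ?case
    using insert.hyps(2) on ev w(2) L
    by (intro exI[of _ "e(s := w)"] exI[of _ "l(s := L)"]) auto
qed

lemma simultaneous_diagonalization:
  fixes G T :: "real^'n^'n::finite"
  assumes G: "posdef G" and T: "transpose T = T"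
  obtains E :: "real^'n^'n" and l where "transpose E ** G ** E = mat 1"
    "\<And>i j. (transpose E ** T ** E) $ i $ j = (if i = j then l i else 0)"
proof -
  obtain e :: "'n \<Rightarrow> real^'n" and l where
    "\<forall>i\<in>UNIV. \<forall>j\<in>UNIV. bilin G (e i) (e j) = (if i = j then 1 else 0)"
    "\<forall>i\<in>UNIV. \<forall>w. bilin T (e i) w = l i * bilin G (e i) w"
    using generalized_eigenbasis[OF G T, of UNIV] by (elim exE conjE) (rule that)
  then have e: "bilin G (e i) (e j) = (if i = j then 1 else 0)" "bilin T (e i) w = l i * bilin G (e i) w" for i j w
    by simp_all
  define E :: "real^'n^'n" where "E = (\<chi> a i. e i $ a)"
  have col: "column i E = e i" for i by (simp add: E_def column_def vec_eq_iff)
  show ?thesis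
  proof
    show "transpose E ** G ** E = mat 1"
      by (simp add: vec_eq_iff congruence_entry col e mat_def)
    show "(transpose E ** T ** E) $ i $ j = (if i = j then l i else 0)" for i j
      by (simp add: congruence_entry col e)
  qed
qed

lemma frame_det:
  fixes G E :: "real^'n^'n::finite"
  assumes "transpose E ** G ** E = mat 1"
  shows "(det E)\<^sup>2 * det G = 1" "det E \<noteq> 0" "0 < det G"
proof -
  have "det (transpose E ** G ** E) = 1" by (simp add: assms)
  then show *: "(det E)\<^sup>2 * det G = 1" by (simp add: det_mul power2_eq_square mult_ac)
  then show "det E \<noteq> 0" by auto
  show "0 < det G" using * by (metis mult_not_zero not_less zero_le_power2 zero_less_mult_iff zero_less_one order_less_le)
qed

lemma posdef_det_pos: "posdef (G :: real^'n^'n::finite) \<Longrightarrow> 0 < det G"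
  by (rule simultaneous_diagonalization[of G G]) (auto simp: posdef_def dest: frame_det)

lemma posdef_invertible: "posdef (G :: real^'n^'n::finite) \<Longrightarrow> invertible G"
  using posdef_det_pos invertible_det_nz by fastforce

lemma lists_eigenvalues_eigenvalues:
  fixes G T :: "real^'n^'n::finite"
  assumes G: "posdef G" and T: "transpose T = T"
  shows "lists_eigenvalues (matrix_inv G ** T) (eigenvalues G T)"
proof -
  obtain E :: "real^'n^'n" and l where E: "transpose E ** G ** E = mat 1"
    "\<And>i j. (transpose E ** T ** E) $ i $ j = (if i = j then l i else 0)"
    by (rule simultaneous_diagonalization[OF G T]) blast
  note GG = matrix_inv_inverse[OF posdef_invertible[OF G]]
  have "det (mat t - matrix_inv G ** T) = (\<Prod>i\<in>UNIV. t - (\<chi> i. l i) $ i)" for t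
  proof -
    have sub: "A ** (B - C) = A ** B - A ** C" "(B - C) ** A = B ** A - C ** A" for A B C :: "real^'n^'n"
      by (simp_all add: matrix_matrix_mult_def vec_eq_iff algebra_simps sum_subtractf)
    have mt: "A ** mat t = t *\<^sub>R A" for A :: "real^'n^'n"
      by (simp add: matrix_matrix_mult_def mat_def vec_eq_iff if_distrib cong: if_cong)
    have "(det E)\<^sup>2 * (det G * det (mat t - matrix_inv G ** T)) = det (transpose E ** (G ** (mat t - matrix_inv G
      ** T)) ** E)"
      by (simp add: det_mul power2_eq_square mult_ac)
    also have "G ** (mat t - matrix_inv G ** T) = t *\<^sub>R G - T"
      by (simp add: sub mt matrix_mul_assoc GG)
    also have "transpose E ** (t *\<^sub>R G - T) ** E = t *\<^sub>R mat 1 - transpose E ** T ** E"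
      by (simp only: sub scaleR_matrix_mul_left scaleR_matrix_mul_right E(1))
    also have "det \<dots> = (\<Prod>i\<in>UNIV. t - l i)"
      by (subst det_diagonal) (auto simp: E(2) mat_def intro!: prod.cong)
    finally show ?thesis using frame_det(1)[OF E(1)] by (simp flip: mult.assoc)
  qed
  then have "lists_eigenvalues (matrix_inv G ** T) (\<chi> i. l i)" by (simp add: lists_eigenvalues_def)
  then show ?thesis unfolding eigenvalues_def by (rule someI)
qed

lemma mixed_eq_sigma:
  fixes G T :: "real^'n^'n::finite"
  assumes "posdef G" "transpose T = T" "k \<le> CARD('n)"
  shows "mixed k G T = det G * sigma k (eigenvalues G T)"
  using mixed_eigenvalues[OF posdef_invertible lists_eigenvalues_eigenvalues] assms by blast

lemma mixed_frame:
  fixes G T E :: "real^'n^'n::finite"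
  assumes "transpose E ** G ** E = mat 1"
    "\<And>i j. (transpose E ** T ** E) $ i $ j = (if i = j then l i else 0)" "k \<le> CARD('n)"
  shows "mixed k G T = det G * esym k UNIV l"
proof -
  have "(det E)\<^sup>2 * mixed k G T = esym k UNIV l"
    using mixed_congruence[OF assms(3), of E G T] mixed_diagonal[OF assms(2), of k] assms(1) by simp
  then have "((det E)\<^sup>2 * det G) * mixed k G T = det G * esym k UNIV l" by (simp add: mult_ac)
  then show ?thesis using frame_det(1)[OF assms(1)] by simp
qed

text \<open>The eigenvalues of \<open>G\<^sup>-\<^sup>1 T\<close> satisfy \<open>\<sigma>\<^sub>0, \<dots>,
  \<sigma>\<^sub>k > 0\<close>, expressed without eigenvalues; positivity is
  insensitive to the factor \<open>det G\<close>.\<close>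

definition admissible :: "nat \<Rightarrow> real^'n^'n::finite \<Rightarrow> real^'n^'n \<Rightarrow> bool" where
  "admissible k G T \<longleftrightarrow> (\<forall>j\<le>k. 0 < mixed j G T)"

lemma admissible_congruence:
  fixes G T E :: "real^'n^'n::finite"
  assumes "det E \<noteq> 0" "k \<le> CARD('n)"
  shows "admissible k (transpose E ** G ** E) (transpose E ** T ** E) \<longleftrightarrow> admissible k G T"
  unfolding admissible_def using assms
  by (auto simp: mixed_congruence zero_less_mult_iff)

lemma admissible_of_nonneg:
  fixes G T :: "real^'n^'n::finite"
  assumes G: "posdef G" and T: "transpose T = T" and k: "k \<le> CARD('n)"
    and "0 < mixed k G T" "\<And>j. j \<le> k \<Longrightarrow> 0 \<le> mixed j G T"
  shows "admissible k G T"
proof -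
  obtain E :: "real^'n^'n" and l where E: "transpose E ** G ** E = mat 1"
    "\<And>i j. (transpose E ** T ** E) $ i $ j = (if i = j then l i else 0)"
    by (rule simultaneous_diagonalization[OF G T]) blast
  have eq: "mixed j G T = det G * esym j UNIV l" if "j \<le> k" for j
    using mixed_frame[OF E] that k by simp
  note d = posdef_det_pos[OF G]
  have "0 < esym j UNIV l" if "j \<le> k" for j
    by (rule esym_pos_of_nonneg[OF finite _ _ that]) (use assms(4,5) eq d in \<open>auto simp: zero_less_mult_iff
      zero_le_mult_iff\<close>)
  then show ?thesis unfolding admissible_def using eq d by simp
qed

lemma in_Gamma_admissible:
  fixes G T :: "real^'n^'n::finite"
  assumes "posdef G" "transpose T = T" "k \<le> CARD('n)" "eigenvalues G T \<in> Gamma k"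
  shows "admissible k G T"
  unfolding admissible_def
  using assms mixed_eq_sigma[OF assms(1,2)] Gamma_imp_sigma_pos[OF assms(3,4)] posdef_det_pos[OF assms(1)]
  by simp

lemma mixed_psd_derivative:
  fixes G T H :: "real^'n^'n::finite"
  assumes G: "posdef G" and T: "transpose T = T" "transpose H = H" and H: "\<And>v. 0 \<le> bilin H v v"
    and k: "Suc k \<le> CARD('n)" and adm: "admissible (Suc k) G (T + s *\<^sub>R H)"
  shows "\<exists>y. ((\<lambda>t. mixed (Suc k) G (T + t *\<^sub>R H)) has_real_derivative y) (at s) \<and> 0 \<le> y"
proof -
  have sym: "transpose (T + s *\<^sub>R H) = T + s *\<^sub>R H"
    using T by (simp add: transpose_def vec_eq_iff)
  obtain E :: "real^'n^'n" and l where E: "transpose E ** G ** E = mat 1"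
    "\<And>i j. (transpose E ** (T + s *\<^sub>R H) ** E) $ i $ j = (if i = j then l i else 0)"
    by (rule simultaneous_diagonalization[OF G sym]) blast
  note d = frame_det[OF E(1)]
  have pos: "0 < esym j UNIV l" if "j \<le> Suc k" for j
    using adm that mixed_frame[OF E, of j] k d(3) unfolding admissible_def by (auto simp: zero_less_mult_iff)
  let ?H = "transpose E ** H ** E"
  have "((\<lambda>t. mixed (Suc k) (mat 1) (transpose E ** (T + t *\<^sub>R H) ** E)) has_real_derivative
      (\<Sum>m\<in>UNIV. ?H $ m $ m * esym k (UNIV - {m}) l)) (at s)"
  proof (rule has_derivative_mixed_at_diagonal[where A = "\<lambda>t. mat 1"])
    show "(transpose E ** (T + s *\<^sub>R H) ** E) $ i $ j = (if i = j then l i else 0)" for i j by (rule E(2))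
  next
    fix i j
    have "(transpose E ** (T + t *\<^sub>R H) ** E) $ i $ j = (transpose E ** T ** E) $ i $ j + t * ?H $ i $ j" for t
      by (simp add: matrix_add_ldistrib matrix_add_rdistrib scaleR_matrix_mul_left scaleR_matrix_mul_right)
    then show "((\<lambda>t. (transpose E ** (T + t *\<^sub>R H) ** E) $ i $ j) has_real_derivative ?H $ i $ j) (at s)"
      by (auto intro!: derivative_eq_intros)
  qed auto
  moreover have "mixed (Suc k) (mat 1) (transpose E ** (T + t *\<^sub>R H) ** E) = (det E)\<^sup>2 * mixed (Suc k) G (T
    + t *\<^sub>R H)" for t
    using mixed_congruence[OF k, of E G "T + t *\<^sub>R H"] E(1) by simp
  ultimately have "((\<lambda>t. (det E)\<^sup>2 * mixed (Suc k) G (T + t *\<^sub>R H)) has_real_derivative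
      (\<Sum>m\<in>UNIV. ?H $ m $ m * esym k (UNIV - {m}) l)) (at s)" by simp
  from DERIV_cdivide[OF this, of "(det E)\<^sup>2"] d(2)
  have "((\<lambda>t. mixed (Suc k) G (T + t *\<^sub>R H)) has_real_derivative
      (\<Sum>m\<in>UNIV. ?H $ m $ m * esym k (UNIV - {m}) l) / (det E)\<^sup>2) (at s)" by simp
  moreover have "0 \<le> (\<Sum>m\<in>UNIV. ?H $ m $ m * esym k (UNIV - {m}) l)"
  proof (intro sum_nonneg mult_nonneg_nonneg)
    show "0 \<le> ?H $ m $ m" for m unfolding congruence_entry by (rule H)
    show "0 \<le> esym k (UNIV - {m}) l" for m
      using esym_remove_pos[of UNIV m k l] pos by (simp add: less_imp_le)
  qed
  ultimately show ?thesis by (blast intro: divide_nonneg_nonneg zero_le_power2)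
qed

text \<open>Along \<open>T + t H\<close> the functions cannot decrease while the pair is admissible, by lemma
  \<open>mixed_psd_derivative\<close>, so
  there is no first time at which admissibility fails.\<close>

lemma admissible_add_psd:
  fixes G T H :: "real^'n^'n::finite"
  assumes G: "posdef G" and T: "transpose T = T" "transpose H = H" and H: "\<And>v. 0 \<le> bilin H v v"
    and k: "k \<le> CARD('n)" and adm: "admissible k G T"
  shows "admissible k G (T + H)"
proof (rule ccontr)
  let ?f = "\<lambda>j t. mixed j G (T + t *\<^sub>R H)"
  assume neg: "\<not> admissible k G (T + H)"
  have cont: "continuous_on A (?f j)" for A j
    by (intro continuous_on_mixed continuous_intros)
  let ?Z = "{0..1} \<inter> (\<Union>j\<in>{..k}. {t. ?f j t \<le> 0})"
  have "compact ?Z"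
    by (intro compact_Int_closed compact_Icc closed_UN finite_atMost ballI closed_Collect_le cont continuous_on_const)
  moreover have "1 \<in> ?Z" using neg by (auto simp: admissible_def not_less)
  ultimately obtain s where s: "s \<in> ?Z" "\<And>t. t \<in> ?Z \<Longrightarrow> s \<le> t"
    using compact_attains_inf[of ?Z] by blast
  have "?f j 0 \<le> ?f j s" if "j \<le> k" for j
  proof (cases j)
    case (Suc i)
    show ?thesis
    proof (rule DERIV_nonneg_imp_increasing_open[where f = "?f j" and a = 0 and b = s])
      fix x assume x: "0 < x" "x < s"
      have "x \<notin> ?Z"
      proof
        assume "x \<in> ?Z"
        from s(2)[OF this] x show False by simp
      qed
      have "admissible k G (T + x *\<^sub>R H)"
        unfolding admissible_def
      proof (intro allI impI, rule ccontr)
        fix i assume i: "i \<le> k" "\<not> 0 < ?f i x"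
        have "x \<in> {0..1}" using x s(1) by simp
        then have "x \<in> ?Z" using i by fastforce
        with \<open>x \<notin> ?Z\<close> show False ..
      qed
      then have "admissible (Suc i) G (T + x *\<^sub>R H)" using that Suc by (simp add: admissible_def)
      then show "\<exists>y. DERIV (?f j) x :> y \<and> 0 \<le> y"
        unfolding Suc using mixed_psd_derivative[OF G T H] that Suc k by simp
    qed (use s(1) cont in auto)
  qed simp
  moreover have "0 < ?f j 0" if "j \<le> k" for j using adm that unfolding admissible_def by simp
  ultimately have "0 < ?f j s" if "j \<le> k" for j using that by (meson less_le_trans)
  moreover obtain j where "j \<le> k" "?f j s \<le> 0" using s(1) by auto
  ultimately show False by (meson not_le)
qed

section \<open>Iterated directional derivatives\<close>

text \<open>The iterated derivatives in \<open>Ck_on\<close> are iterations of this operator.\<close>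

definition dderiv :: "('a::real_normed_vector \<Rightarrow> 'b::real_normed_vector) \<Rightarrow> 'a \<Rightarrow> 'a
  \<Rightarrow> 'b" where
  "dderiv h v x = frechet_derivative h (at x) v"

lemma Ck_on_Suc:
  "Ck_on (Suc m) S h \<longleftrightarrow> (\<forall>x\<in>S. h differentiable (at x)) \<and> (\<forall>v. Ck_on m S
    (dderiv h v))"
  by (simp add: dderiv_def[abs_def])

declare Ck_on.simps(2) [simp del]

lemma Ck_on_SucD: "Ck_on (Suc m) S h \<Longrightarrow> Ck_on m S h"
proof (induction m arbitrary: h)
  case 0
  then show ?case
    by (auto simp: Ck_on_Suc intro!: continuous_at_imp_continuous_on differentiable_imp_continuous_within)
next
  case (Suc m)
  show ?case
    unfolding Ck_on_Suc[of m S h]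
    using Suc.prems Suc.IH unfolding Ck_on_Suc[of "Suc m" S h] by blast
qed

lemma Ck_on_mono: "Ck_on m S h \<Longrightarrow> k \<le> m \<Longrightarrow> Ck_on k S h"
  by (induction m) (auto simp: le_Suc_eq dest: Ck_on_SucD)

lemma Ck_on_differentiable: "Ck_on (Suc m) S h \<Longrightarrow> x \<in> S \<Longrightarrow> h differentiable (at x)"
  by (simp add: Ck_on_Suc)

lemma Ck_on_dderiv: "Ck_on (Suc m) S h \<Longrightarrow> Ck_on m S (dderiv h v)"
  by (simp add: Ck_on_Suc)

lemma Ck_on_continuous: "Ck_on m S h \<Longrightarrow> continuous_on S h"
  using Ck_on_mono[of m S h 0] by simp

lemma has_derivative_dderiv: "h differentiable (at x) \<Longrightarrow> (h has_derivative (\<lambda>v. dderiv h v x)) (at x)"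
  by (simp add: dderiv_def frechet_derivative_works)

lemma dderiv_eq: "(h has_derivative h') (at x) \<Longrightarrow> dderiv h v x = h' v"
  using frechet_derivative_at[of h h' x] by (simp add: dderiv_def)

lemma linear_dderiv: "h differentiable (at x) \<Longrightarrow> linear (\<lambda>v. dderiv h v x)"
  using has_derivative_linear has_derivative_dderiv by blast

lemma dderiv_add: "h differentiable (at x) \<Longrightarrow> dderiv h (v + w) x = dderiv h v x + dderiv h w x"
  and dderiv_scaleR: "h differentiable (at x) \<Longrightarrow> dderiv h (r *\<^sub>R v) x = r *\<^sub>R dderiv h v x"
  using linear_dderiv linear_add linear_scale by blast+

lemma dderiv_cong:
  assumes "open S" "x \<in> S" "\<And>y. y \<in> S \<Longrightarrow> f y = g y"
  shows "dderiv f v x = dderiv g v x"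
proof -
  have "(f has_derivative D) (at x) \<longleftrightarrow> (g has_derivative D) (at x)" for D
    using has_derivative_transform_within_open[OF _ assms(1,2), of f D UNIV g]
      has_derivative_transform_within_open[OF _ assms(1,2), of g D UNIV f] assms(3) by auto
  then show ?thesis by (simp add: dderiv_def frechet_derivative_def)
qed

lemma differentiable_cong:
  assumes "open S" "x \<in> S" "\<And>y. y \<in> S \<Longrightarrow> f y = g y" "f differentiable (at x)"
  shows "g differentiable (at x)"
  using assms(4) has_derivative_transform_within_open[OF _ assms(1,2), of f _ UNIV g] assms(3)
  unfolding differentiable_def by auto

lemma Ck_on_cong:
  assumes "open S" "\<And>y. y \<in> S \<Longrightarrow> f y = g y" "Ck_on m S f"
  shows "Ck_on m S g"
  using assms(2,3)
proof (induction m arbitrary: f g)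
  case 0
  then show ?case using continuous_on_cong[of S S f g] by simp
next
  case (Suc m)
  show ?case unfolding Ck_on_Suc
  proof (intro conjI ballI allI)
    fix x assume x: "x \<in> S"
    show "g differentiable (at x)"
      by (rule differentiable_cong[OF assms(1) x Suc.prems(1) Ck_on_differentiable[OF Suc.prems(2) x]])
  next
    fix v
    show "Ck_on m S (dderiv g v)"
      by (rule Suc.IH[OF _ Ck_on_dderiv[OF Suc.prems(2)]]) (erule dderiv_cong[OF assms(1) _ Suc.prems(1)], assumption)
  qed
qed

lemma dderiv_bounded_linear:
  assumes "bounded_linear L" "h differentiable (at x)"
  shows "dderiv (\<lambda>y. L (h y)) v x = L (dderiv h v x)" "(\<lambda>y. L (h y)) differentiable (at x)"
proof -
  have *: "((\<lambda>y. L (h y)) has_derivative (\<lambda>v. L (dderiv h v x))) (at x)"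
    by (rule bounded_linear.has_derivative[OF assms(1) has_derivative_dderiv[OF assms(2)]])
  show "dderiv (\<lambda>y. L (h y)) v x = L (dderiv h v x)" by (rule dderiv_eq[OF *])
  show "(\<lambda>y. L (h y)) differentiable (at x)" using * by (rule differentiableI)
qed

lemma Ck_on_bounded_linear:
  assumes "open S" "bounded_linear L" "Ck_on m S h"
  shows "Ck_on m S (\<lambda>x. L (h x))"
  using assms(3)
proof (induction m arbitrary: h)
  case 0
  then show ?case using bounded_linear.continuous_on[OF assms(2)] by simp
next
  case (Suc m)
  show ?case unfolding Ck_on_Suc
  proof (intro conjI ballI allI)
    fix x assume "x \<in> S"
    then show "(\<lambda>x. L (h x)) differentiable (at x)"
      by (rule dderiv_bounded_linear(2)[OF assms(2) Ck_on_differentiable[OF Suc.prems]])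
  next
    fix v
    show "Ck_on m S (dderiv (\<lambda>x. L (h x)) v)"
      by (rule Ck_on_cong[OF assms(1) _ Suc.IH[OF Ck_on_dderiv[OF Suc.prems]]])
        (rule dderiv_bounded_linear(1)[OF assms(2) Ck_on_differentiable[OF Suc.prems], symmetric])
  qed
qed

lemma has_derivative_line:
  fixes h :: "'a::real_normed_vector \<Rightarrow> real"
  assumes "h differentiable (at (x + s *\<^sub>R v))"
  shows "((\<lambda>t. h (x + t *\<^sub>R v)) has_real_derivative dderiv h v (x + s *\<^sub>R v)) (at s)"
proof -
  have "((\<lambda>t. x + t *\<^sub>R v) has_derivative (\<lambda>t. t *\<^sub>R v)) (at s)"
    by (auto intro!: derivative_eq_intros)
  from has_derivative_compose[OF this has_derivative_dderiv[OF assms]]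
  have "((\<lambda>t. h (x + t *\<^sub>R v)) has_derivative (\<lambda>t. dderiv h (t *\<^sub>R v) (x + s *\<^sub>R v)))
    (at s)" .
  then show ?thesis
    unfolding has_field_derivative_def by (simp add: dderiv_scaleR[OF assms] mult_commute_abs)
qed

text \<open>The mean value theorem, applied once in each direction.\<close>

lemma second_difference:
  fixes h :: "'a::real_normed_vector \<Rightarrow> real"
  assumes C2: "Ck_on 2 S h" and s: "0 < s"
    and sub: "\<And>p q. 0 \<le> p \<Longrightarrow> p \<le> s \<Longrightarrow> 0 \<le> q \<Longrightarrow> q \<le> s
      \<Longrightarrow> x + p *\<^sub>R v + q *\<^sub>R w \<in> S"
  obtains p q where "0 \<le> p" "p \<le> s" "0 \<le> q" "q \<le> s"
    "h (x + s *\<^sub>R v + s *\<^sub>R w) - h (x + s *\<^sub>R v) - h (x + s *\<^sub>R w) + h x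
      = s\<^sup>2 * dderiv (dderiv h v) w (x + p *\<^sub>R v + q *\<^sub>R w)"
proof -
  have C2': "Ck_on (Suc (Suc 0)) S h" using C2 by (simp add: numeral_2_eq_2)
  have d1: "h differentiable (at y)" if "y \<in> S" for y using Ck_on_differentiable[OF C2' that] .
  have d2: "dderiv h v differentiable (at y)" if "y \<in> S" for y
    using Ck_on_differentiable[OF Ck_on_dderiv[OF C2'] that] .
  let ?f = "\<lambda>p. h ((x + s *\<^sub>R w) + p *\<^sub>R v) - h (x + p *\<^sub>R v)"
  let ?f' = "\<lambda>p. dderiv h v ((x + s *\<^sub>R w) + p *\<^sub>R v) - dderiv h v (x + p *\<^sub>R v)"
  have df: "DERIV ?f p :> ?f' p" if "0 \<le> p" "p \<le> s" for p
  proof -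
    have "(x + s *\<^sub>R w) + p *\<^sub>R v \<in> S" "x + p *\<^sub>R v \<in> S"
      using sub[of p s] sub[of p 0] that s by (simp_all add: ac_simps)
    then show ?thesis by (intro DERIV_diff has_derivative_line d1)
  qed
  obtain p where p: "0 < p" "p < s" "?f s - ?f 0 = (s - 0) * ?f' p"
    using MVT2[OF s, of ?f ?f', OF df] by blast
  let ?g = "\<lambda>q. dderiv h v ((x + p *\<^sub>R v) + q *\<^sub>R w)"
  have dg: "DERIV ?g q :> dderiv (dderiv h v) w ((x + p *\<^sub>R v) + q *\<^sub>R w)" if "0 \<le> q" "q \<le> s" for q
    using sub[of p q] that p by (intro has_derivative_line d2) auto
  obtain q where q: "0 < q" "q < s" "?g s - ?g 0 = (s - 0) * dderiv (dderiv h v) w ((x + p *\<^sub>R v) + q *\<^sub>R w)"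
    using MVT2[OF s, of ?g "\<lambda>q. dderiv (dderiv h v) w ((x + p *\<^sub>R v) + q *\<^sub>R w)", OF dg] by blast
  have "?f' p = ?g s - ?g 0" by (simp add: ac_simps)
  then have "?f s - ?f 0 = s\<^sup>2 * dderiv (dderiv h v) w (x + p *\<^sub>R v + q *\<^sub>R w)"
    using p(3) q(3) by (simp add: power2_eq_square)
  moreover have "?f s - ?f 0 = h (x + s *\<^sub>R v + s *\<^sub>R w) - h (x + s *\<^sub>R v) - h (x + s *\<^sub>R w) + h x"
    by (simp add: ac_simps)
  ultimately show ?thesis using that[of p q] p q by simp
qed

text \<open>The second difference is symmetric in the two directions, and \<open>second_difference\<close> evaluates it
  as either mixed
  derivative at nearby points.\<close>

lemma dderiv_commute:
  fixes h :: "'a::real_normed_vector \<Rightarrow> real"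
  assumes C2: "Ck_on 2 S h" and S: "open S" "x \<in> S"
  shows "dderiv (dderiv h v) w x = dderiv (dderiv h w) v x"
proof (rule ccontr)
  assume ne: "dderiv (dderiv h v) w x \<noteq> dderiv (dderiv h w) v x"
  define \<epsilon> where "\<epsilon> = \<bar>dderiv (dderiv h v) w x - dderiv (dderiv h w) v x\<bar> / 2"
  have \<epsilon>: "0 < \<epsilon>" using ne by (simp add: \<epsilon>_def)
  have "Ck_on (Suc (Suc 0)) S h" using C2 by (simp add: numeral_2_eq_2)
  then have "continuous_on S (dderiv (dderiv h v) w)" "continuous_on S (dderiv (dderiv h w) v)"
    using Ck_on_dderiv Ck_on_continuous by blast+
  then have "isCont (dderiv (dderiv h v) w) x" "isCont (dderiv (dderiv h w) v) x"
    using S by (simp_all add: continuous_on_eq_continuous_at)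
  then obtain r1 r2 where r: "0 < r1" "0 < r2"
    "\<And>y. dist y x < r1 \<Longrightarrow> dist (dderiv (dderiv h v) w y) (dderiv (dderiv h v) w x) < \<epsilon>"
    "\<And>y. dist y x < r2 \<Longrightarrow> dist (dderiv (dderiv h w) v y) (dderiv (dderiv h w) v x) < \<epsilon>"
    using \<epsilon> unfolding continuous_at_eps_delta by metis
  obtain r3 where r3: "0 < r3" "ball x r3 \<subseteq> S" using S openE by blast
  define r where "r = min r1 (min r2 r3)"
  define c where "c = norm v + norm w + 1"
  define s where "s = r / (2 * c)"
  have r0: "0 < r" using r r3 by (simp add: r_def)
  have nn: "0 < c" unfolding c_def by (intro add_nonneg_pos) auto
  have s: "0 < s" using r0 nn by (simp add: s_def)
  have near: "dist (x + p *\<^sub>R v + q *\<^sub>R w) x < r" if "0 \<le> p" "p \<le> s" "0 \<le> q" "q \<le> s" for p q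
  proof -
    have "norm (p *\<^sub>R v + q *\<^sub>R w) \<le> p * norm v + q * norm w"
      using norm_triangle_ineq[of "p *\<^sub>R v" "q *\<^sub>R w"] that by simp
    also have "\<dots> \<le> s * norm v + s * norm w" using that by (intro add_mono mult_right_mono) auto
    also have "\<dots> \<le> s * c" using s by (simp add: c_def algebra_simps)
    also have "\<dots> = r / 2" using nn by (simp add: s_def)
    finally show ?thesis using r0 by (simp add: dist_norm algebra_simps)
  qed
  have inS: "x + p *\<^sub>R v + q *\<^sub>R w \<in> S" if "0 \<le> p" "p \<le> s" "0 \<le> q" "q \<le> s" for p q
    using near[OF that] r3 by (auto simp: r_def dist_commute subset_eq)
  obtain p q where pq: "0 \<le> p" "p \<le> s" "0 \<le> q" "q \<le> s"
    "h (x + s *\<^sub>R v + s *\<^sub>R w) - h (x + s *\<^sub>R v) - h (x + s *\<^sub>R w) + h x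
      = s\<^sup>2 * dderiv (dderiv h v) w (x + p *\<^sub>R v + q *\<^sub>R w)"
    by (rule second_difference[OF C2 s inS])
  have inS': "x + p *\<^sub>R w + q *\<^sub>R v \<in> S" if "0 \<le> p" "p \<le> s" "0 \<le> q" "q \<le> s" for p q
    using inS[of q p] that by (simp add: ac_simps)
  obtain p' q' where pq': "0 \<le> p'" "p' \<le> s" "0 \<le> q'" "q' \<le> s"
    "h (x + s *\<^sub>R w + s *\<^sub>R v) - h (x + s *\<^sub>R w) - h (x + s *\<^sub>R v) + h x
      = s\<^sup>2 * dderiv (dderiv h w) v (x + p' *\<^sub>R w + q' *\<^sub>R v)"
    by (rule second_difference[OF C2 s inS'])
  have "s\<^sup>2 * dderiv (dderiv h v) w (x + p *\<^sub>R v + q *\<^sub>R w) = s\<^sup>2 * dderiv (dderiv h w) v (x +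
    p' *\<^sub>R w + q' *\<^sub>R v)"
  proof -
    have "h (x + s *\<^sub>R w + s *\<^sub>R v) = h (x + s *\<^sub>R v + s *\<^sub>R w)" by (simp add: ac_simps)
    then show ?thesis using pq(5) pq'(5) by linarith
  qed
  then have eq: "dderiv (dderiv h v) w (x + p *\<^sub>R v + q *\<^sub>R w) = dderiv (dderiv h w) v (x + p' *\<^sub>R w
    + q' *\<^sub>R v)"
    using s by simp
  have "dist (x + p' *\<^sub>R w + q' *\<^sub>R v) x < r" using near[of q' p'] pq' by (simp add: ac_simps)
  then have "dist (dderiv (dderiv h w) v (x + p' *\<^sub>R w + q' *\<^sub>R v)) (dderiv (dderiv h w) v x) < \<epsilon>"
    by (intro r(4)) (simp add: r_def)
  moreover have "dist (dderiv (dderiv h v) w (x + p *\<^sub>R v + q *\<^sub>R w)) (dderiv (dderiv h v) w x) < \<epsilon>"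
    using near[OF pq(1-4)] by (intro r(3)) (simp add: r_def)
  ultimately show False unfolding eq \<epsilon>_def dist_real_def by (simp add: abs_real_def split: if_splits)
qed

lemma vec_expand: "(v :: real^'n::finite) = (\<Sum>i\<in>UNIV. v $ i *\<^sub>R axis i 1)"
  using basis_expansion[of v] by (simp add: scalar_mult_eq_scaleR)

lemma dderiv_expand:
  fixes h :: "real^'n::finite \<Rightarrow> 'b::real_normed_vector"
  assumes "h differentiable (at x)"
  shows "dderiv h v x = (\<Sum>i\<in>UNIV. v $ i *\<^sub>R dderiv h (axis i 1) x)"
proof -
  have "dderiv h (\<Sum>i\<in>UNIV. v $ i *\<^sub>R axis i 1) x = (\<Sum>i\<in>UNIV. v $ i *\<^sub>R dderiv h (axis i 1) x)"
    by (subst linear_sum[OF linear_dderiv[OF assms]]) (simp add: dderiv_scaleR[OF assms])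
  then show ?thesis by (simp flip: vec_expand)
qed

lemma compact_bound:
  fixes h :: "'a::topological_space \<Rightarrow> 'b::real_normed_vector"
  assumes "continuous_on S h" "compact K" "K \<subseteq> S"
  shows "\<exists>C\<ge>0. \<forall>x\<in>K. norm (h x) \<le> C"
proof -
  have "compact (h ` K)" using assms continuous_on_subset compact_continuous_image by blast
  then obtain C where "\<And>x. x \<in> K \<Longrightarrow> norm (h x) \<le> C"
    using compact_imp_bounded bounded_iff by (metis image_eqI)
  then show ?thesis by (intro exI[of _ "\<bar>C\<bar>"]) force
qed

lemma dderiv_bound:
  fixes h :: "real^'n::finite \<Rightarrow> 'b::real_normed_vector"
  assumes h: "Ck_on (Suc m) S h" and K: "compact K" "K \<subseteq> S"
  shows "\<exists>C\<ge>0. \<forall>x\<in>K. \<forall>v. norm (dderiv h v x) \<le> C * norm v"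
proof -
  have "\<exists>C\<ge>0. \<forall>x\<in>K. norm (dderiv h (axis i 1) x) \<le> C" for i
    by (rule compact_bound[OF Ck_on_continuous[OF Ck_on_dderiv[OF h]] K])
  then obtain C where C: "\<And>i. 0 \<le> C i" "\<And>i x. x \<in> K \<Longrightarrow> norm (dderiv h (axis i 1) x)
    \<le> C i" by metis
  have "norm (dderiv h v x) \<le> (\<Sum>i\<in>UNIV. C i) * norm v" if "x \<in> K" for x v
  proof -
    have "norm (dderiv h v x) \<le> (\<Sum>i\<in>UNIV. norm (v $ i *\<^sub>R dderiv h (axis i 1) x))"
      using that K by (subst dderiv_expand[OF Ck_on_differentiable[OF h]]) (auto intro: norm_sum simp del: norm_scaleR)
    also have "\<dots> \<le> (\<Sum>i\<in>UNIV. C i * norm v)"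
      unfolding norm_scaleR
      by (intro sum_mono, subst mult.commute, intro mult_mono C component_le_norm_cart that) auto
    finally show ?thesis by (simp add: sum_distrib_right)
  qed
  then show ?thesis using C(1) by (intro exI[of _ "\<Sum>i\<in>UNIV. C i"]) (auto intro: sum_nonneg)
qed

lemma second_deriv_expand:
  fixes h :: "real^'n::finite \<Rightarrow> 'b::real_normed_vector"
  assumes h: "Ck_on (Suc (Suc m)) S h" and S: "open S" "x \<in> S"
  shows "dderiv (dderiv h v) w x = (\<Sum>i\<in>UNIV. v $ i *\<^sub>R dderiv (dderiv h (axis i 1)) w x)"
proof -
  have "dderiv (dderiv h v) w x = dderiv (\<lambda>y. \<Sum>i\<in>UNIV. v $ i *\<^sub>R dderiv h (axis i 1) y) w x"
    by (rule dderiv_cong[OF S]) (rule dderiv_expand[OF Ck_on_differentiable[OF h]])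
  also have "\<dots> = (\<Sum>i\<in>UNIV. v $ i *\<^sub>R dderiv (dderiv h (axis i 1)) w x)"
    by (rule dderiv_eq) (intro has_derivative_sum has_derivative_scaleR_right has_derivative_dderiv
        Ck_on_differentiable[OF Ck_on_dderiv[OF h]] S)
  finally show ?thesis .
qed

lemma second_deriv_bound:
  fixes h :: "real^'n::finite \<Rightarrow> 'b::real_normed_vector"
  assumes h: "Ck_on (Suc (Suc m)) S h" and S: "open S" and K: "compact K" "K \<subseteq> S"
  shows "\<exists>C\<ge>0. \<forall>x\<in>K. \<forall>v w. norm (dderiv (dderiv h v) w x) \<le> C * norm v * norm w"
proof -
  have "\<exists>C\<ge>0. \<forall>x\<in>K. \<forall>w. norm (dderiv (dderiv h (axis i 1)) w x) \<le> C * norm w" for i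
    by (rule dderiv_bound[OF Ck_on_dderiv[OF h] K])
  then obtain C where C: "\<And>i. 0 \<le> C i" "\<And>i x w. x \<in> K \<Longrightarrow> norm (dderiv (dderiv h (axis
    i 1)) w x) \<le> C i * norm w" by metis
  have "norm (dderiv (dderiv h v) w x) \<le> (\<Sum>i\<in>UNIV. C i) * norm v * norm w" if "x \<in> K" for x v w
  proof -
    have "norm (dderiv (dderiv h v) w x) \<le> (\<Sum>i\<in>UNIV. norm (v $ i *\<^sub>R dderiv (dderiv h (axis i 1)) w x))"
      using that K by (subst second_deriv_expand[OF h S]) (auto intro: norm_sum simp del: norm_scaleR)
    also have "\<dots> \<le> (\<Sum>i\<in>UNIV. norm v * (C i * norm w))"
      unfolding norm_scaleR
      by (intro sum_mono mult_mono C component_le_norm_cart that) auto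
    finally show ?thesis by (simp add: sum_distrib_right sum_distrib_left mult_ac)
  qed
  then show ?thesis using C(1) by (intro exI[of _ "\<Sum>i\<in>UNIV. C i"]) (auto intro: sum_nonneg)
qed

lemma bilin_bound: "\<bar>bilin M a b\<bar> \<le> (real CARD('n))\<^sup>2 * norm M * norm a * norm (b :: real^'n::finite)"
proof -
  have "\<bar>bilin M a b\<bar> \<le> (\<Sum>i\<in>UNIV. \<bar>\<Sum>j\<in>UNIV. a $ i * M $ i $ j * b $ j\<bar>)"
    unfolding bilin_sum by (rule sum_abs)
  also have "\<dots> \<le> (\<Sum>i\<in>(UNIV::'n set). \<Sum>j\<in>(UNIV::'n set). norm a * norm M * norm b)"
  proof (rule sum_mono, rule order_trans[OF sum_abs], rule sum_mono)
    fix i j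
    have "\<bar>M $ i $ j\<bar> \<le> norm M"
      using component_le_norm_cart[of "M $ i" j] Finite_Cartesian_Product.norm_nth_le[of M i] by simp
    then show "\<bar>a $ i * M $ i $ j * b $ j\<bar> \<le> norm a * norm M * norm b"
      unfolding abs_mult by (intro mult_mono component_le_norm_cart mult_nonneg_nonneg) auto
  qed
  finally show ?thesis by (simp add: power2_eq_square mult_ac)
qed

lemma bounded_linear_bilin: "bounded_linear (\<lambda>M. bilin M a (b :: real^'n::finite))"
  by (rule bounded_linear_intro[of _ "(real CARD('n))\<^sup>2 * norm a * norm b"])
    (use bilin_bound[of _ a b] in \<open>auto simp: bilin_add_matrix bilin_scaleR_matrix mult_ac\<close>)

lemma differentiable_det:
  fixes M :: "'a::real_normed_vector \<Rightarrow> real^'n^'n::finite"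
  assumes "\<And>i j. (\<lambda>x. M x $ i $ j) differentiable (at x)"
  shows "(\<lambda>x. det (M x)) differentiable (at x)"
proof -
  have "((\<lambda>x. \<Prod>i\<in>UNIV. M x $ i $ p i) has_derivative
      (\<lambda>y. \<Sum>i\<in>UNIV. dderiv (\<lambda>x. M x $ i $ p i) y x * (\<Prod>j\<in>UNIV - {i}. M x $ j $ p
        j))) (at x)" for p
    by (rule has_derivative_prod) (rule has_derivative_dderiv[OF assms])
  then have "(\<lambda>x. \<Prod>i\<in>UNIV. M x $ i $ p i) differentiable (at x)" for p
    by (rule differentiableI)
  then show ?thesis
    unfolding det_def by (intro differentiable_sum differentiable_mult differentiable_const) auto
qed

text \<open>Cramer's rule; it makes the inverse of a matrix differentiable in its entries.\<close>

lemma matrix_inv_entry: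
  fixes A :: "real^'n^'n::finite"
  assumes "det A \<noteq> 0"
  shows "matrix_inv A $ k $ j = det (\<chi> i l. if l = k then axis j 1 $ i else A $ i $ l) / det A"
proof -
  have "A *v (matrix_inv A *v axis j 1) = axis j 1"
    using matrix_inv_inverse(1)[of A] assms by (simp add: matrix_vector_mul_assoc invertible_det_nz)
  then have "matrix_inv A *v axis j 1 = (\<chi> k. det (\<chi> i l. if l = k then axis j 1 $ i else A $ i $ l) / det A)"
    using cramer[OF assms] by blast
  then show ?thesis by (simp add: matrix_vector_mult_basis column_def vec_eq_iff)
qed

lemma differentiable_matrix_inv:
  fixes G :: "'a::real_normed_vector \<Rightarrow> real^'n^'n::finite"
  assumes S: "open S" "x \<in> S" and pos: "\<And>y. y \<in> S \<Longrightarrow> det (G y) \<noteq> 0"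
    and d: "\<And>i j. (\<lambda>x. G x $ i $ j) differentiable (at x)"
  shows "(\<lambda>x. matrix_inv (G x) $ k $ j) differentiable (at x)"
proof (rule differentiable_cong[OF S])
  show "(\<lambda>y. det (\<chi> i l. if l = k then axis j 1 $ i else G y $ i $ l) / det (G y)) differentiable (at x)"
  proof (intro differentiable_divide differentiable_det)
    show "(\<lambda>x. (\<chi> i l. if l = k then axis j 1 $ i else G x $ i $ l) $ i $ ja) differentiable (at x)" for i ja
      using d[of i ja] by (cases "ja = k") auto
  qed (use d pos S in auto)
qed (use pos in \<open>auto simp: matrix_inv_entry\<close>)

lemma second_derivative_test:
  fixes f f' :: "real \<Rightarrow> real"
  assumes r: "0 < r" and d1: "\<And>s. \<bar>s\<bar> < r \<Longrightarrow> (f has_real_derivative f' s) (at s)"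
    and d2: "(f' has_real_derivative f2) (at 0)" and max: "\<And>s. \<bar>s\<bar> < r \<Longrightarrow> f s \<le> f 0"
  shows "f' 0 = 0" "f2 \<le> 0"
proof -
  show z: "f' 0 = 0"
    by (rule DERIV_local_max[OF d1 r]) (use r max in auto)
  show "f2 \<le> 0"
  proof (rule ccontr)
    assume "\<not> f2 \<le> 0"
    then obtain d where d: "0 < d" "\<And>h. 0 < h \<Longrightarrow> h < d \<Longrightarrow> f' 0 < f' (0 + h)"
      using DERIV_pos_inc_right[OF d2] by auto
    (* if \<open>f2 > 0\<close>, then \<open>f'\<close> is positive to the right of \<open>0\<close> and
      \<open>f\<close> increases there *)
    define t where "t = min d r / 2"
    have t: "0 < t" "t < d" "t < r" using d(1) r by (auto simp: t_def)
    have "f 0 < f t"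
    proof (rule DERIV_pos_imp_increasing_open[OF t(1)])
      fix x assume x: "0 < x" "x < t"
      then show "\<exists>y. DERIV f x :> y \<and> 0 < y"
        using d1[of x] d(2)[of x] z t by (intro exI[of _ "f' x"]) auto
    next
      show "continuous_on {0..t} f"
        by (rule DERIV_continuous_on[of _ _ f'], rule DERIV_subset[OF d1]) (use t in auto)
    qed
    then show False using max[of t] t by simp
  qed
qed

section \<open>The equation in a chart\<close>

definition coord_diff :: "(real^'n::finite \<Rightarrow> real) \<Rightarrow> real^'n \<Rightarrow> real^'n" where
  "coord_diff u x = (\<chi> i. dderiv u (axis i 1) x)"

definition grad :: "(real^'n::finite \<Rightarrow> real^'n^'n) \<Rightarrow> (real^'n \<Rightarrow> real) \<Rightarrow>
  real^'n \<Rightarrow> real^'n" where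
  "grad G u x = matrix_inv (G x) *v coord_diff u x"

definition half_sq_grad :: "(real^'n::finite \<Rightarrow> real^'n^'n) \<Rightarrow> (real^'n \<Rightarrow> real)
  \<Rightarrow> real^'n \<Rightarrow> real" where
  "half_sq_grad G u x = bilin (G x) (grad G u x) (grad G u x) / 2"

text \<open>The Christoffel symbol of the first kind as a trilinear form: \<open>koszul G x a b w\<close> is the inner
  product of
  \<open>\<Gamma>(a, b)\<close> with \<open>w\<close>. Using it in place of \<open>\<Gamma>\<close> keeps the inverse
    metric out of the formulas.\<close>

definition koszul :: "(real^'n::finite \<Rightarrow> real^'n^'n) \<Rightarrow> real^'n \<Rightarrow> real^'n
  \<Rightarrow> real^'n \<Rightarrow> real^'n \<Rightarrow> real" where
  "koszul G x a b w = (bilin (dderiv G a x) b w + bilin (dderiv G b x) a w - bilin (dderiv G w x) a b) / 2"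

text \<open>The tensor of the equation in a chart. The Christoffel term \<open>du(\<Gamma>(a, b))\<close> is written as
  the Koszul form
  evaluated at the gradient.\<close>

definition local_tensor :: "(real^'n::finite \<Rightarrow> real^'n^'n) \<Rightarrow> (real^'n \<Rightarrow> real^'n^'n)
  \<Rightarrow> (real^'n \<Rightarrow> real) \<Rightarrow> real^'n \<Rightarrow> real^'n^'n" where
  "local_tensor G S u x = (\<chi> i j. dderiv (dderiv u (axis j 1)) (axis i 1) x - koszul G x (axis i 1) (axis j 1) (grad G u x)
     - dderiv u (axis i 1) x * dderiv u (axis j 1) x + half_sq_grad G u x * G x $ i $ j + S x $ i $ j)"

lemma linear_expand:
  fixes f :: "real^'n::finite \<Rightarrow> real"
  assumes "linear f"
  shows "f a = (\<Sum>i\<in>UNIV. a $ i * f (axis i 1))"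
proof -
  have "f (\<Sum>i\<in>UNIV. a $ i *\<^sub>R axis i 1) = (\<Sum>i\<in>UNIV. a $ i * f (axis i 1))"
    by (simp add: linear_sum[OF assms] linear_scale[OF assms])
  then show ?thesis by (simp flip: vec_expand)
qed

lemma bilin_eq_bilinear:
  assumes "\<And>b. linear (\<lambda>a. Q a b)" "\<And>a. linear (Q a)" "\<And>i j. M $ i $ j = Q (axis i 1) (axis j 1)"
  shows "bilin M a b = Q a b"
proof -
  have "Q a b = (\<Sum>i\<in>UNIV. a $ i * (\<Sum>j\<in>UNIV. b $ j * Q (axis i 1) (axis j 1)))"
    using linear_expand[OF assms(1), of a b] linear_expand[OF assms(2), of _ b] by simp
  then show ?thesis by (simp add: bilin_sum assms(3) sum_distrib_left mult_ac)
qed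

lemma dderiv_bilin:
  fixes M :: "'a::real_normed_vector \<Rightarrow> real^'n^'n::finite"
  assumes "M differentiable (at x)"
  shows "dderiv (\<lambda>y. bilin (M y) a b) v x = bilin (dderiv M v x) a b" "(\<lambda>y. bilin (M y) a b)
    differentiable (at x)"
  using dderiv_bounded_linear[OF bounded_linear_bilin assms] by blast+

lemma entry_differentiable:
  fixes M :: "'a::real_normed_vector \<Rightarrow> real^'n^'n::finite"
  assumes "M differentiable (at x)"
  shows "(\<lambda>y. M y $ i $ j) differentiable (at x)" "dderiv (\<lambda>y. M y $ i $ j) v x = dderiv M v x $ i $ j"
  using dderiv_bilin[OF assms, of "axis i 1" "axis j 1"] by (simp_all add: bilin_axis)

lemma DERIV_bilin:
  fixes M :: "real \<Rightarrow> real^'n^'n::finite"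
  assumes M: "\<And>i j. ((\<lambda>t. M t $ i $ j) has_real_derivative M' $ i $ j) (at s)"
    and a: "\<And>i. ((\<lambda>t. a t $ i) has_real_derivative a' $ i) (at s)"
    and b: "\<And>i. ((\<lambda>t. b t $ i) has_real_derivative b' $ i) (at s)"
  shows "((\<lambda>t. bilin (M t) (a t) (b t)) has_real_derivative
           bilin M' (a s) (b s) + bilin (M s) a' (b s) + bilin (M s) (a s) b') (at s)"
proof -
  have "((\<lambda>t. a t $ i * M t $ i $ j * b t $ j) has_real_derivative
      a s $ i * M' $ i $ j * b s $ j + a' $ i * M s $ i $ j * b s $ j + a s $ i * M s $ i $ j * b' $ j) (at s)" for i j
    by (rule DERIV_cong[OF DERIV_mult[OF DERIV_mult[OF a M] b]]) (simp add: algebra_simps)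
  then have "((\<lambda>t. \<Sum>i\<in>UNIV. \<Sum>j\<in>UNIV. a t $ i * M t $ i $ j * b t $ j) has_real_derivative
      (\<Sum>i\<in>UNIV. \<Sum>j\<in>UNIV. a s $ i * M' $ i $ j * b s $ j + a' $ i * M s $ i $ j * b s $ j + a s $ i *
        M s $ i $ j * b' $ j)) (at s)"
    by (intro DERIV_sum)
  then show ?thesis unfolding bilin_sum by (simp only: sum.distrib)
qed

lemma linear_second_deriv:
  fixes h :: "real^'n::finite \<Rightarrow> 'b::real_normed_vector"
  assumes h: "Ck_on (Suc (Suc m)) S h" and S: "open S" "x \<in> S"
  shows "linear (\<lambda>v. dderiv (dderiv h v) w x)"
proof -
  define c where "c i = dderiv (dderiv h (axis i 1)) w x" for i
  have "(\<lambda>v. dderiv (dderiv h v) w x) = (\<lambda>v. \<Sum>i\<in>UNIV. v $ i *\<^sub>R c i)"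
    unfolding c_def by (rule ext) (rule second_deriv_expand[OF h S])
  then show ?thesis
    by (simp add: linear_iff scaleR_add_left sum.distrib scaleR_sum_right)
qed

lemma open_contains_line:
  fixes x a :: "'a::real_normed_vector"
  assumes "open \<Omega>" "x \<in> \<Omega>"
  obtains r where "0 < r" "\<And>s. \<bar>s\<bar> < r \<Longrightarrow> x + s *\<^sub>R a \<in> \<Omega>"
proof -
  obtain e where e: "0 < e" "ball x e \<subseteq> \<Omega>" using assms openE by blast
  show ?thesis
  proof (rule that[of "e / (norm a + 1)"])
    have n: "0 < norm a + 1" by (rule add_nonneg_pos) auto
    show "0 < e / (norm a + 1)" using e n by simp
    fix s assume "\<bar>s\<bar> < e / (norm a + 1)"
    then have "\<bar>s\<bar> * (norm a + 1) < e" using n by (simp add: field_simps)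
    moreover have "\<bar>s\<bar> * norm a \<le> \<bar>s\<bar> * (norm a + 1)" by (intro mult_left_mono) auto
    ultimately have "norm (s *\<^sub>R a) < e" by simp
    then have "x + s *\<^sub>R a \<in> ball x e" by (simp add: dist_norm)
    then show "x + s *\<^sub>R a \<in> \<Omega>" using e by blast
  qed
qed

text \<open>What the local argument uses of a chart: the metric \<open>G\<close>, the tensor \<open>S\<close> and the
  function \<open>u\<close> in coordinates, with the regularity that is differentiated below.\<close>

locale chart_data =
  fixes \<Omega> :: "(real^'n::finite) set" and u :: "real^'n \<Rightarrow> real" and G S :: "real^'n \<Rightarrow> real^'n^'n"
  assumes open_dom: "open \<Omega>" and u3: "Ck_on 3 \<Omega> u" and G2: "Ck_on 2 \<Omega> G" and S1: "Ck_on 1 \<Omega> S"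
    and posG: "\<And>x. x \<in> \<Omega> \<Longrightarrow> posdef (G x)" and symS: "\<And>x. x \<in> \<Omega>
      \<Longrightarrow> transpose (S x) = S x"
begin

abbreviation V where "V \<equiv> grad G u"
abbreviation h where "h \<equiv> half_sq_grad G u"
abbreviation K where "K \<equiv> koszul G"
abbreviation W where "W \<equiv> local_tensor G S u"

lemma u3': "Ck_on (Suc (Suc (Suc 0))) \<Omega> u"
  using u3 by (simp add: numeral_3_eq_3)

lemma u2: "Ck_on 2 \<Omega> u" and u2': "Ck_on (Suc (Suc 0)) \<Omega> u"
  using Ck_on_SucD[OF u3'] by (simp_all add: numeral_2_eq_2)

lemma ddu2: "Ck_on 2 \<Omega> (dderiv u v)"
  using Ck_on_dderiv[OF u3'] by (simp add: numeral_2_eq_2)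

lemma G2': "Ck_on (Suc (Suc 0)) \<Omega> G"
  using G2 by (simp add: numeral_2_eq_2)

lemma S1': "Ck_on (Suc 0) \<Omega> S"
  using S1 by simp

lemma diff [simp]:
  assumes "x \<in> \<Omega>"
  shows "u differentiable (at x)" "dderiv u a differentiable (at x)" "dderiv (dderiv u a) b differentiable (at x)"
    "G differentiable (at x)" "dderiv G a differentiable (at x)" "S differentiable (at x)"
  using Ck_on_differentiable[OF u3' assms] Ck_on_differentiable[OF Ck_on_dderiv[OF u3'] assms]
    Ck_on_differentiable[OF Ck_on_dderiv[OF Ck_on_dderiv[OF u3']] assms] Ck_on_differentiable[OF G2' assms]
    Ck_on_differentiable[OF Ck_on_dderiv[OF G2'] assms] Ck_on_differentiable[OF S1' assms] by blast+

lemma G_sym: "x \<in> \<Omega> \<Longrightarrow> transpose (G x) = G x"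
  using posG unfolding posdef_def by blast

lemma bilinG_commute: "x \<in> \<Omega> \<Longrightarrow> bilin (G x) a b = bilin (G x) b a"
  by (rule bilin_sym[OF G_sym])

lemma bilin_deriv_commute:
  assumes "x \<in> \<Omega>"
  shows "bilin (dderiv G v x) a b = bilin (dderiv G v x) b a"
proof -
  have "dderiv (\<lambda>y. bilin (G y) a b) v x = dderiv (\<lambda>y. bilin (G y) b a) v x"
    by (rule dderiv_cong[OF open_dom assms]) (rule bilinG_commute)
  then show ?thesis by (simp add: dderiv_bilin assms)
qed

lemma det_G: "x \<in> \<Omega> \<Longrightarrow> 0 < det (G x)"
  by (rule posdef_det_pos[OF posG])

lemma G_inv: "x \<in> \<Omega> \<Longrightarrow> G x ** matrix_inv (G x) = mat 1"
  using matrix_inv_inverse(1)[OF posdef_invertible[OF posG]] .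

lemma representer:
  assumes "x \<in> \<Omega>" "linear f"
  shows "bilin (G x) (matrix_inv (G x) *v (\<chi> i. f (axis i 1))) w = f w"
proof -
  have "bilin (G x) w (matrix_inv (G x) *v (\<chi> i. f (axis i 1))) = w \<bullet> (\<chi> i. f (axis i 1))"
    by (simp add: bilin_def matrix_vector_mul_assoc G_inv[OF assms(1)])
  also have "\<dots> = f w" by (simp add: linear_expand[OF assms(2), of w] inner_vec_def)
  finally show ?thesis by (simp add: bilinG_commute[OF assms(1)])
qed

lemma gradient_char:
  assumes "x \<in> \<Omega>"
  shows "bilin (G x) (V x) w = dderiv u w x" "bilin (G x) w (V x) = dderiv u w x"
proof -
  show "bilin (G x) (V x) w = dderiv u w x"
    unfolding grad_def coord_diff_def by (rule representer[OF assms linear_dderiv]) (simp add: assms)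
  then show "bilin (G x) w (V x) = dderiv u w x" by (simp add: bilinG_commute[OF assms])
qed

lemma h_eq: "x \<in> \<Omega> \<Longrightarrow> h x = dderiv u (V x) x / 2"
  by (simp add: half_sq_grad_def gradient_char)

text \<open>The function \<open>h\<close> is the maximum of \<open>du(v) - |v|\<^sup>2 / 2\<close> over all
  \<open>v\<close>; this is used to touch it from below.\<close>

lemma h_ge:
  assumes "x \<in> \<Omega>"
  shows "dderiv u v x - bilin (G x) v v / 2 \<le> h x"
proof -
  have "0 \<le> bilin (G x) (v - V x) (v - V x)"
  proof (cases "v - V x = 0")
    case False
    then show ?thesis using posG[OF assms] unfolding posdef_def by (blast intro: less_imp_le)
  qed (simp add: bilin_simps)
  also have "\<dots> = bilin (G x) v v - 2 * dderiv u v x + 2 * h x"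
    using gradient_char[OF assms] by (simp add: bilin_diff_left bilin_diff_right half_sq_grad_def)
  finally show ?thesis by simp
qed

lemma K_commute: "x \<in> \<Omega> \<Longrightarrow> K x a b w = K x b a w"
  unfolding koszul_def using bilin_deriv_commute[of x w a b] by (simp add: field_simps)

lemma K_metric: "x \<in> \<Omega> \<Longrightarrow> K x a b w + K x a w b = bilin (dderiv G a x) b w"
  unfolding koszul_def using bilin_deriv_commute[of x a b w] bilin_deriv_commute[of x b a w] bilin_deriv_commute[of x w
    a b] by (simp add: field_simps)

lemma K_diag: "x \<in> \<Omega> \<Longrightarrow> K x v a v = bilin (dderiv G a x) v v / 2"
  unfolding koszul_def using bilin_deriv_commute[of x v a v] by simp

lemma linear_bilin_dderiv: "x \<in> \<Omega> \<Longrightarrow> linear (\<lambda>w. bilin (dderiv G w x) a b)"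
  by (intro linearI) (simp_all add: dderiv_add dderiv_scaleR bilin_add_matrix bilin_scaleR_matrix)

lemma K_linear:
  assumes "x \<in> \<Omega>"
  shows "linear (\<lambda>a. K x a b w)" "linear (\<lambda>b. K x a b w)" "linear (\<lambda>w. K x a b w)"
  unfolding koszul_def
  by (intro linearI; simp add: assms dderiv_add dderiv_scaleR bilin_add_matrix bilin_scaleR_matrix bilin_simps
    add_divide_distrib
      diff_divide_distrib algebra_simps)+

lemma linear_hessian: "x \<in> \<Omega> \<Longrightarrow> linear (\<lambda>v. dderiv (dderiv u v) w x)"
  by (rule linear_second_deriv[OF u2' open_dom])

lemma dderiv_u_commute: "x \<in> \<Omega> \<Longrightarrow> dderiv (dderiv u a) b x = dderiv (dderiv u b) a x"
  by (rule dderiv_commute[OF u2 open_dom])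

text \<open>Both sides are bilinear, so it is enough to compare entries.\<close>

lemma bilin_W:
  assumes x: "x \<in> \<Omega>"
  shows "bilin (W x) a b = dderiv (dderiv u b) a x - K x a b (V x) - dderiv u a x * dderiv u b x + h x * bilin (G x) a
    b + bilin (S x) a b"
proof (rule bilin_eq_bilinear)
  show "linear (\<lambda>a. dderiv (dderiv u b) a x - K x a b (V x) - dderiv u a x * dderiv u b x + h x * bilin (G x) a
    b + bilin (S x) a b)" for b
    using linear_add[OF K_linear(1)[OF x]] linear_scale[OF K_linear(1)[OF x]]
    by (intro linearI) (simp_all add: dderiv_add dderiv_scaleR bilin_simps x algebra_simps)
  show "linear (\<lambda>b. dderiv (dderiv u b) a x - K x a b (V x) - dderiv u a x * dderiv u b x + h x * bilin (G x) a
    b + bilin (S x) a b)" for a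
    using linear_add[OF K_linear(2)[OF x]] linear_scale[OF K_linear(2)[OF x]]
      linear_add[OF linear_hessian[OF x]] linear_scale[OF linear_hessian[OF x]]
    by (intro linearI) (simp_all add: dderiv_add dderiv_scaleR bilin_simps x algebra_simps)
qed (simp add: local_tensor_def bilin_axis)

lemma W_sym: "x \<in> \<Omega> \<Longrightarrow> transpose (W x) = W x"
  using dderiv_u_commute[of x] K_commute[of x] G_sym[of x] symS[of x]
  by (simp add: transpose_def vec_eq_iff local_tensor_def mult.commute)

lemma bilinW_commute: "x \<in> \<Omega> \<Longrightarrow> bilin (W x) a b = bilin (W x) b a"
  by (rule bilin_sym[OF W_sym])

lemma V_differentiable:
  assumes x: "x \<in> \<Omega>"
  shows "(\<lambda>y. V y $ i) differentiable (at x)"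
proof -
  have "(\<lambda>y. \<Sum>j\<in>UNIV. matrix_inv (G y) $ i $ j * dderiv u (axis j 1) y) differentiable (at x)"
  proof (intro differentiable_sum ballI differentiable_mult finite)
    show "(\<lambda>y. matrix_inv (G y) $ i $ j) differentiable (at x)" for j
      by (rule differentiable_matrix_inv[OF open_dom x]) (use det_G x entry_differentiable(1)[OF diff(4)[OF x]] in
        \<open>auto simp: less_imp_neq[symmetric]\<close>)
  qed (simp add: x)
  then show ?thesis by (simp add: grad_def coord_diff_def matrix_vector_mult_def)
qed

lemma bilin_differentiable:
  fixes a b :: "real^'n \<Rightarrow> real^'n"
  assumes "M differentiable (at x)" "\<And>i. (\<lambda>y. a y $ i) differentiable (at x)" "\<And>i. (\<lambda>y. b y $
    i) differentiable (at x)"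
  shows "(\<lambda>y. bilin (M y) (a y) (b y)) differentiable (at x)"
  unfolding bilin_sum using assms entry_differentiable[OF assms(1)]
  by (intro differentiable_sum ballI differentiable_mult finite) auto

lemma h_differentiable: "x \<in> \<Omega> \<Longrightarrow> h differentiable (at x)"
  unfolding half_sq_grad_def[abs_def] by (intro differentiable_divide bilin_differentiable V_differentiable) simp_all

lemma K_V_expand:
  assumes "x \<in> \<Omega>"
  shows "K x a b (V x) = (bilin (dderiv G a x) b (V x) + bilin (dderiv G b x) a (V x)) / 2
      - (\<Sum>m\<in>UNIV. V x $ m * bilin (dderiv G (axis m 1) x) a b) / 2"
  unfolding koszul_def using linear_expand[OF linear_bilin_dderiv[OF assms], of "V x" a b] by (simp add: field_simps)

lemma W_differentiable:
  assumes x: "x \<in> \<Omega>"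
  shows "(\<lambda>y. W y $ i $ j) differentiable (at x)"
proof (rule differentiable_cong[OF open_dom x])
  show "(\<lambda>y. dderiv (dderiv u (axis j 1)) (axis i 1) y - ((bilin (dderiv G (axis i 1) y) (axis j 1) (V y) +
    bilin (dderiv G (axis j 1) y) (axis i 1) (V y)) / 2
      - (\<Sum>m\<in>UNIV. V y $ m * bilin (dderiv G (axis m 1) y) (axis i 1) (axis j 1)) / 2)
     - dderiv u (axis i 1) y * dderiv u (axis j 1) y + h y * G y $ i $ j + S y $ i $ j) differentiable (at x)"
    by (intro differentiable_sum ballI differentiable_mult finite differentiable_add differentiable_diff
        differentiable_divide bilin_differentiable V_differentiable h_differentiable entry_differentiable)
      (simp_all add: x)
qed (simp add: local_tensor_def K_V_expand)

lemmas line_in = open_contains_line[OF open_dom]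

text \<open>The linear part of the affine vector field through \<open>V x\<close> whose covariant derivative vanishes
  at \<open>x\<close>; it is the map
  \<open>a \<mapsto> - \<Gamma>(V x, a)\<close>.\<close>

definition frame_rate :: "real^'n \<Rightarrow> real^'n^'n" where
  "frame_rate x = matrix (\<lambda>a. matrix_inv (G x) *v (\<chi> i. - K x (V x) a (axis i 1)))"

lemma frame_rate:
  assumes x: "x \<in> \<Omega>"
  shows "bilin (G x) (frame_rate x *v a) w = - K x (V x) a w"
proof -
  have "linear (\<lambda>a. \<chi> i. - K x (V x) a (axis i 1))"
    using linear_add[OF K_linear(2)[OF x]] linear_scale[OF K_linear(2)[OF x]]
    by (intro linearI) (simp_all add: vec_eq_iff)
  then have "linear (\<lambda>a. matrix_inv (G x) *v (\<chi> i. - K x (V x) a (axis i 1)))"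
    using linear_compose[OF _ matrix_vector_mul_linear] unfolding o_def by blast
  then have "frame_rate x *v a = matrix_inv (G x) *v (\<chi> i. - K x (V x) a (axis i 1))"
    unfolding frame_rate_def by (simp add: matrix_works)
  moreover have "linear (\<lambda>w. - K x (V x) a w)"
    using linear_add[OF K_linear(3)[OF x]] linear_scale[OF K_linear(3)[OF x]]
    by (intro linearI) simp_all
  ultimately show ?thesis using representer[OF x, of "\<lambda>w. - K x (V x) a w" w] by simp
qed

text \<open>A frame that moves along \<open>V x\<close> with this rate stays orthonormal to first order.\<close>

lemma frame_metric:
  assumes x: "x \<in> \<Omega>"
  shows "bilin (dderiv G (V x) x) a b + bilin (G x) (frame_rate x *v a) b + bilin (G x) a (frame_rate x *v b) = 0"
  using frame_rate[OF x, of a b] frame_rate[OF x, of b a] K_metric[OF x, of "V x" a b] bilinG_commute[OF x, of a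
    "frame_rate x *v b"]
  by simp

lemma frame_V:
  assumes x: "x \<in> \<Omega>"
  shows "bilin (dderiv G a x) (V x) (V x) + 2 * bilin (G x) (V x) (frame_rate x *v a) = 0"
  using frame_rate[OF x, of a "V x"] K_diag[OF x, of "V x" a] bilinG_commute[OF x, of "V x" "frame_rate x *v a"] by simp

end

section \<open>First and second order conditions at a maximum\<close>

context chart_data
begin

text \<open>The function \<open>du(X) - |X|\<^sup>2 / 2 + \<kappa> e\<^sup>u\<close>, with \<open>X\<close> the affine
  extension of \<open>V x\<close>, lies below \<open>h + \<kappa> e\<^sup>u\<close> and
  agrees with it at \<open>x\<close>. So it has a maximum at \<open>x\<close> as well, and the two claims are its first
    and second derivative
  tests along the line in direction \<open>a\<close>. Unlike \<open>h\<close>, it involves \<open>u\<close> only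
    through directional derivatives with
  explicit coefficients.\<close>

lemma touching:
  assumes x: "x \<in> \<Omega>" and max: "\<And>y. y \<in> \<Omega> \<Longrightarrow> h y + \<kappa> * exp (u y) \<le>
    h x + \<kappa> * exp (u x)"
  defines "B \<equiv> frame_rate x" and "q \<equiv> \<kappa> * exp (u x)"
  shows "dderiv (dderiv u (V x)) a x + dderiv u (B *v a) x = - q * dderiv u a x"
    and "dderiv (dderiv (dderiv u (V x)) a) a x + 2 * dderiv (dderiv u (B *v a)) a x
        - (bilin (dderiv (dderiv G a) a x) (V x) (V x) + 4 * bilin (dderiv G a x) (V x) (B *v a) + 2 * bilin (G x) (B
          *v a) (B *v a)) / 2
        + q * (dderiv (dderiv u a) a x + (dderiv u a x)\<^sup>2) \<le> 0"
proof -
  obtain r where r: "0 < r" "\<And>s. \<bar>s\<bar> < r \<Longrightarrow> x + s *\<^sub>R a \<in> \<Omega>" by (rule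
    line_in[OF x, where a = a]) blast
  let ?v = "V x" and ?b = "B *v a"
  let ?A = "\<lambda>s. dderiv u ?v (x + s *\<^sub>R a)" and ?A1 = "\<lambda>s. dderiv (dderiv u ?v) a (x + s *\<^sub>R a)"
  let ?C = "\<lambda>s. dderiv u ?b (x + s *\<^sub>R a)" and ?C1 = "\<lambda>s. dderiv (dderiv u ?b) a (x + s *\<^sub>R a)"
  let ?g0 = "\<lambda>s. bilin (G (x + s *\<^sub>R a)) ?v ?v" and ?g0' = "\<lambda>s. bilin (dderiv G a (x + s
    *\<^sub>R a)) ?v ?v"
  let ?g1 = "\<lambda>s. bilin (G (x + s *\<^sub>R a)) ?v ?b" and ?g1' = "\<lambda>s. bilin (dderiv G a (x + s
    *\<^sub>R a)) ?v ?b"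
  let ?g2 = "\<lambda>s. bilin (G (x + s *\<^sub>R a)) ?b ?b" and ?g2' = "\<lambda>s. bilin (dderiv G a (x + s
    *\<^sub>R a)) ?b ?b"
  let ?u = "\<lambda>s. u (x + s *\<^sub>R a)" and ?u1 = "\<lambda>s. dderiv u a (x + s *\<^sub>R a)"
  (* \<open>du(X) - |X|\<^sup>2 / 2 + \<kappa> e\<^sup>u\<close> along the line, with \<open>X = ?v + s ?b\<close> at
    parameter \<open>s\<close>, expanded in \<open>s\<close> *)
  let ?f = "\<lambda>s. ?A s + s * ?C s - (?g0 s + 2 * (s * ?g1 s) + s * (s * ?g2 s)) / 2 + \<kappa> * exp (?u s)"
  let ?f' = "\<lambda>s. ?A1 s + (?C s + s * ?C1 s)
     - (?g0' s + 2 * (?g1 s + s * ?g1' s) + (s * ?g2 s + s * (?g2 s + s * ?g2' s))) / 2 + \<kappa> * (exp (?u s) * ?u1 s)"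
  have lin: "((\<lambda>t. F (x + t *\<^sub>R a)) has_real_derivative dderiv F a (x + s *\<^sub>R a)) (at s)"
    if "F differentiable (at (x + s *\<^sub>R a))" for F s
    by (rule has_derivative_line[OF that])
  have dbf: "((\<lambda>t. bilin (F (x + t *\<^sub>R a)) c d) has_real_derivative bilin (dderiv F a (x + s *\<^sub>R
    a)) c d) (at s)"
    if "F differentiable (at (x + s *\<^sub>R a))" for F :: "real^'n \<Rightarrow> real^'n^'n" and c d s
    using lin[OF dderiv_bilin(2)[OF that, of c d]] dderiv_bilin(1)[OF that, of c d] by simp
  have d1: "(?f has_real_derivative ?f' s) (at s)" if "\<bar>s\<bar> < r" for s
  proof -
    note y = r(2)[OF that]
    note D = lin[OF diff(1)[OF y]] lin[OF diff(2)[OF y, of ?v]] lin[OF diff(2)[OF y, of ?b]]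
      dbf[OF diff(4)[OF y], of ?v ?v] dbf[OF diff(4)[OF y], of ?v ?b] dbf[OF diff(4)[OF y], of ?b ?b]
    show ?thesis
      by (rule derivative_eq_intros D refl | simp)+
  qed
  have d2: "(?f' has_real_derivative dderiv (dderiv (dderiv u ?v) a) a x + 2 * dderiv (dderiv u ?b) a x
        - (bilin (dderiv (dderiv G a) a x) ?v ?v + 4 * bilin (dderiv G a x) ?v ?b + 2 * bilin (G x) ?b ?b) / 2
        + q * (dderiv (dderiv u a) a x + (dderiv u a x)\<^sup>2)) (at 0)"
  proof -
    have y: "x + 0 *\<^sub>R a \<in> \<Omega>" using x by simp
    note D = lin[OF diff(1)[OF y]] lin[OF diff(2)[OF y, of a]] lin[OF diff(2)[OF y, of ?b]]
      lin[OF diff(3)[OF y, of ?v a]] lin[OF diff(3)[OF y, of ?b a]]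
      dbf[OF diff(4)[OF y], of ?v ?b] dbf[OF diff(4)[OF y], of ?b ?b]
      dbf[OF diff(5)[OF y], of a ?v ?v] dbf[OF diff(5)[OF y], of a ?v ?b] dbf[OF diff(5)[OF y], of a ?b ?b]
    show ?thesis
      by (rule derivative_eq_intros D refl | simp)+ (simp add: q_def power2_eq_square algebra_simps)
  qed
  have f0: "?f 0 = h x + \<kappa> * exp (u x)"
    using gradient_char[OF x, of ?v] by (simp add: half_sq_grad_def)
  have le: "?f s \<le> ?f 0" if "\<bar>s\<bar> < r" for s
  proof -
    let ?y = "x + s *\<^sub>R a"
    note y = r(2)[OF that]
    have 1: "dderiv u (?v + s *\<^sub>R ?b) ?y - bilin (G ?y) (?v + s *\<^sub>R ?b) (?v + s *\<^sub>R ?b) / 2 \<le> h ?y"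
      by (rule h_ge[OF y])
    have 2: "dderiv u (?v + s *\<^sub>R ?b) ?y = ?A s + s * ?C s"
      by (simp add: dderiv_add dderiv_scaleR y)
    have 3: "bilin (G ?y) (?v + s *\<^sub>R ?b) (?v + s *\<^sub>R ?b) = ?g0 s + 2 * (s * ?g1 s) + s * (s * ?g2 s)"
      using bilinG_commute[OF y, of ?b ?v] by (simp add: bilin_simps algebra_simps)
    have "?f s \<le> h ?y + \<kappa> * exp (u ?y)" using 1 unfolding 2 3 by simp
    also have "\<dots> \<le> h x + \<kappa> * exp (u x)" by (rule max[OF y])
    finally show ?thesis unfolding f0 .
  qed
  note test = second_derivative_test[OF r(1) d1 d2 le]
  show "dderiv (dderiv u (V x)) a x + dderiv u (B *v a) x = - q * dderiv u a x"
    using test(1) frame_V[OF x, of a] by (simp add: B_def q_def)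
  show "dderiv (dderiv (dderiv u (V x)) a) a x + 2 * dderiv (dderiv u (B *v a)) a x
        - (bilin (dderiv (dderiv G a) a x) (V x) (V x) + 4 * bilin (dderiv G a x) (V x) (B *v a) + 2 * bilin (G x) (B
          *v a) (B *v a)) / 2
        + q * (dderiv (dderiv u a) a x + (dderiv u a x)\<^sup>2) \<le> 0"
    using test(2) by simp
qed

lemma dh_at_max:
  assumes x: "x \<in> \<Omega>" and max: "\<And>y. y \<in> \<Omega> \<Longrightarrow> h y + \<kappa> * exp (u y) \<le>
    h x + \<kappa> * exp (u x)"
  shows "dderiv h a x = - (\<kappa> * exp (u x)) * dderiv u a x"
proof -
  obtain r where r: "0 < r" "\<And>s. \<bar>s\<bar> < r \<Longrightarrow> x + s *\<^sub>R a \<in> \<Omega>" by (rule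
    line_in[OF x, where a = a]) blast
  have y: "x + 0 *\<^sub>R a \<in> \<Omega>" using x by simp
  note D = has_derivative_line[OF h_differentiable[OF y]] has_derivative_line[OF diff(1)[OF y]]
  have "((\<lambda>s. h (x + s *\<^sub>R a) + \<kappa> * exp (u (x + s *\<^sub>R a))) has_real_derivative
      dderiv h a (x + 0 *\<^sub>R a) + \<kappa> * (exp (u (x + 0 *\<^sub>R a)) * dderiv u a (x + 0 *\<^sub>R a))) (at 0)"
    by (rule derivative_eq_intros D refl | simp)+
  then have "dderiv h a (x + 0 *\<^sub>R a) + \<kappa> * (exp (u (x + 0 *\<^sub>R a)) * dderiv u a (x + 0 *\<^sub>R a)) = 0"
    by (rule DERIV_local_max[OF _ r(1)]) (use max r(2) in auto)
  then show ?thesis by simp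
qed

definition grad_rate where "grad_rate x = (\<chi> i. dderiv (\<lambda>y. V y $ i) (V x) x)"

lemma DERIV_V:
  assumes x: "x \<in> \<Omega>"
  shows "((\<lambda>t. V (x + t *\<^sub>R V x) $ i) has_real_derivative grad_rate x $ i) (at 0)"
  using has_derivative_line[of "\<lambda>y. V y $ i" x 0 "V x"] V_differentiable[OF x, of i] by (simp add: grad_rate_def)

lemma DERIV_bilin_line:
  assumes "M differentiable (at x)"
    and "\<And>i. ((\<lambda>t. a t $ i) has_real_derivative a' $ i) (at 0)" "\<And>i. ((\<lambda>t. b t $ i)
      has_real_derivative b' $ i) (at 0)"
  shows "((\<lambda>t. bilin (M (x + t *\<^sub>R v)) (a t) (b t)) has_real_derivative
     bilin (dderiv M v x) (a 0) (b 0) + bilin (M x) a' (b 0) + bilin (M x) (a 0) b') (at 0)"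
proof -
  have "((\<lambda>t. M (x + t *\<^sub>R v) $ i $ j) has_real_derivative dderiv M v x $ i $ j) (at 0)" for i j
    using has_derivative_line[of "\<lambda>y. M y $ i $ j" x 0 v] entry_differentiable[OF assms(1), of i j] by simp
  from DERIV_bilin[OF this assms(2,3)] show ?thesis by simp
qed

lemma DERIV_cong_line:
  assumes x: "x \<in> \<Omega>" and "\<And>y. y \<in> \<Omega> \<Longrightarrow> f y = g y"
    and "((\<lambda>t. f (x + t *\<^sub>R v)) has_real_derivative D) (at 0)"
  shows "((\<lambda>t. g (x + t *\<^sub>R v)) has_real_derivative D) (at 0)"
proof -
  obtain r where r: "0 < r" "\<And>s. \<bar>s\<bar> < r \<Longrightarrow> x + s *\<^sub>R v \<in> \<Omega>" by (rule
    line_in[OF x, where a = v]) blast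
  show ?thesis
    by (rule has_field_derivative_transform_within[OF assms(3) r(1)]) (use assms(2) r(2) in auto)
qed

lemma DERIV_K_V:
  assumes x: "x \<in> \<Omega>"
  shows "((\<lambda>t. K (x + t *\<^sub>R V x) e e (V (x + t *\<^sub>R V x))) has_real_derivative
     bilin (dderiv (dderiv G e) (V x) x) e (V x) - bilin (dderiv (dderiv G (V x)) (V x) x) e e / 2 + K x e e (grad_rate
       x)) (at 0)"
proof (rule DERIV_cong_line[OF x, where f = "\<lambda>y. bilin (dderiv G e y) e (V y) - (\<Sum>m\<in>UNIV. V y $ m *
  bilin (dderiv G (axis m 1) y) e e) / 2"])
  let ?v = "V x"
  have 1: "((\<lambda>t. bilin (dderiv G e (x + t *\<^sub>R ?v)) e (V (x + t *\<^sub>R ?v))) has_real_derivative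
      bilin (dderiv (dderiv G e) ?v x) e ?v + bilin (dderiv G e x) e (grad_rate x)) (at 0)"
    using DERIV_bilin_line[OF diff(5)[OF x], where a = "\<lambda>t. e" and a' = 0 and b = "\<lambda>t. V (x + t
      *\<^sub>R ?v)" and b' = "grad_rate x" and v = ?v]
      DERIV_V[OF x] by (simp add: bilin_simps)
  have 2: "((\<lambda>t. bilin (dderiv G c (x + t *\<^sub>R ?v)) e e) has_real_derivative bilin (dderiv (dderiv G c) ?v
    x) e e) (at 0)" for c
    using DERIV_bilin_line[OF diff(5)[OF x], where a = "\<lambda>t. e" and a' = 0 and b = "\<lambda>t. e" and b' = 0 and v = ?v]
    by (simp add: bilin_simps)
  have 3: "((\<lambda>t. \<Sum>m\<in>UNIV. V (x + t *\<^sub>R ?v) $ m * bilin (dderiv G (axis m 1) (x + t *\<^sub>R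
    ?v)) e e) has_real_derivative
      (\<Sum>m\<in>UNIV. grad_rate x $ m * bilin (dderiv G (axis m 1) x) e e + bilin (dderiv (dderiv G (axis m 1)) ?v
        x) e e * ?v $ m)) (at 0)"
  proof (rule DERIV_sum)
    fix m
    show "((\<lambda>t. V (x + t *\<^sub>R ?v) $ m * bilin (dderiv G (axis m 1) (x + t *\<^sub>R ?v)) e e) has_real_derivative
      grad_rate x $ m * bilin (dderiv G (axis m 1) x) e e + bilin (dderiv (dderiv G (axis m 1)) ?v x) e e * ?v $ m) (at 0)"
      using DERIV_mult[OF DERIV_V[OF x, of m] 2[of "axis m 1"]] by simp
  qed
  have 4: "(\<Sum>m\<in>UNIV. grad_rate x $ m * bilin (dderiv G (axis m 1) x) e e + bilin (dderiv (dderiv G (axis m 1))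
    ?v x) e e * ?v $ m)
      = bilin (dderiv G (grad_rate x) x) e e + bilin (dderiv (dderiv G ?v) ?v x) e e"
  proof -
    have "linear (\<lambda>w. bilin (dderiv (dderiv G w) ?v x) e e)"
      using linear_second_deriv[OF G2' open_dom x, of ?v]
      by (simp add: linear_iff bilin_add_matrix bilin_scaleR_matrix)
    then show ?thesis
      using linear_expand[OF linear_bilin_dderiv[OF x], of "grad_rate x" e e] linear_expand[of "\<lambda>w. bilin
        (dderiv (dderiv G w) ?v x) e e" ?v]
      by (simp add: sum.distrib mult.commute)
  qed
  show "((\<lambda>t. bilin (dderiv G e (x + t *\<^sub>R ?v)) e (V (x + t *\<^sub>R ?v)) - (\<Sum>m\<in>UNIV. V (x + t
    *\<^sub>R ?v) $ m * bilin (dderiv G (axis m 1) (x + t *\<^sub>R ?v)) e e) / 2)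
     has_real_derivative bilin (dderiv (dderiv G e) ?v x) e ?v - bilin (dderiv (dderiv G ?v) ?v x) e e / 2 + K x e e
       (grad_rate x)) (at 0)"
    by (rule DERIV_cong[OF DERIV_diff[OF 1 DERIV_cdivide[OF 3]]]) (simp only: 4, simp add: koszul_def field_simps)
qed (simp add: K_V_expand)

text \<open>The derivative of \<open>G (V y) = du\<close> in direction \<open>V x\<close>; it eliminates the derivative
  of the gradient.\<close>

lemma grad_rate_char:
  assumes x: "x \<in> \<Omega>"
  shows "bilin (dderiv G (V x) x) z (V x) + bilin (G x) z (grad_rate x) = dderiv (dderiv u z) (V x) x"
proof -
  have "((\<lambda>t. bilin (G (x + t *\<^sub>R V x)) z (V (x + t *\<^sub>R V x))) has_real_derivative
      bilin (dderiv G (V x) x) z (V x) + bilin (G x) z (grad_rate x)) (at 0)"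
    using DERIV_bilin_line[OF diff(4)[OF x], where a = "\<lambda>t. z" and a' = 0 and b = "\<lambda>t. V (x + t
      *\<^sub>R V x)" and b' = "grad_rate x" and v = "V x"]
      DERIV_V[OF x] by (simp add: bilin_simps)
  then have "((\<lambda>t. dderiv u z (x + t *\<^sub>R V x)) has_real_derivative
      bilin (dderiv G (V x) x) z (V x) + bilin (G x) z (grad_rate x)) (at 0)"
    by (rule DERIV_cong_line[OF x, rotated]) (rule gradient_char(2))
  moreover have "((\<lambda>t. dderiv u z (x + t *\<^sub>R V x)) has_real_derivative dderiv (dderiv u z) (V x) x) (at 0)"
    using has_derivative_line[of "dderiv u z" x 0 "V x"] x by simp
  ultimately show ?thesis by (rule DERIV_unique)
qed

definition christoffel_vec :: "real^'n \<Rightarrow> real^'n \<Rightarrow> real^'n" where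
  "christoffel_vec x e = matrix_inv (G x) *v (\<chi> i. K x e e (axis i 1))"

lemma christoffel_vec: "x \<in> \<Omega> \<Longrightarrow> bilin (G x) (christoffel_vec x e) w = K x e e w"
  unfolding christoffel_vec_def by (rule representer[OF _ K_linear(3)])

text \<open>What lemma \<open>W_rate_le\<close> leaves over beside the terms with the factor \<open>q\<close>:
  curvature terms quadratic in \<open>V x\<close> and two terms in \<open>S\<close> that are linear in \<open>V
    x\<close>. No second derivative of \<open>u\<close> occurs.\<close>

definition remainder :: "real^'n \<Rightarrow> real^'n \<Rightarrow> real" where
  "remainder x e = (let v = V x; b = frame_rate x *v e; z = christoffel_vec x e in
     (bilin (dderiv (dderiv G e) e x) v v + 4 * bilin (dderiv G e x) v b + 2 * bilin (G x) b b) / 2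
     - bilin (dderiv (dderiv G e) v x) e v + bilin (dderiv (dderiv G v) v x) e e / 2 - 2 * K x e b v
     + bilin (G x) v (frame_rate x *v z) + bilin (dderiv G v x) z v + bilin (dderiv S v x) e e + 2 * bilin (S x) e b)"

text \<open>The left side is the rate of \<open>W(e, e)\<close> along \<open>V x\<close> when \<open>e\<close> moves
  with the frame. Its third derivative of
  \<open>u\<close> is bounded by the second derivative test in direction \<open>e\<close>; its second derivatives in
    direction \<open>V x\<close> are
  removed by the first derivative test. The terms in \<open>du(e)\<^sup>2\<close> and \<open>\<Gamma>(e, e)\<close>
    cancel.\<close>

lemma W_rate_le:
  assumes x: "x \<in> \<Omega>" and max: "\<And>y. y \<in> \<Omega> \<Longrightarrow> h y + \<kappa> * exp (u y) \<le>
    h x + \<kappa> * exp (u x)"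
    and e: "bilin (G x) e e = 1"
    and D: "((\<lambda>t. bilin (W (x + t *\<^sub>R V x)) e e) has_real_derivative D) (at 0)"
  defines "q \<equiv> \<kappa> * exp (u x)"
  shows "D + 2 * bilin (W x) e (frame_rate x *v e)
    \<le> - q * bilin (W x) e e - q * h x + q * bilin (S x) e e + remainder x e"
proof -
  let ?v = "V x" and ?B = "frame_rate x" and ?z = "christoffel_vec x e"
  let ?b = "?B *v e"
  note T = touching[OF x max, folded q_def]
  let ?KD = "bilin (dderiv (dderiv G e) ?v x) e ?v - bilin (dderiv (dderiv G ?v) ?v x) e e / 2 + K x e e (grad_rate x)"
  have "((\<lambda>t. dderiv (dderiv u e) e (x + t *\<^sub>R ?v) - K (x + t *\<^sub>R ?v) e e (V (x + t *\<^sub>R ?v))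
      - dderiv u e (x + t *\<^sub>R ?v) * dderiv u e (x + t *\<^sub>R ?v) + h (x + t *\<^sub>R ?v) * bilin (G (x + t
        *\<^sub>R ?v)) e e
      + bilin (S (x + t *\<^sub>R ?v)) e e) has_real_derivative
      dderiv (dderiv (dderiv u e) e) ?v x - ?KD - (dderiv (dderiv u e) ?v x * dderiv u e x + dderiv (dderiv u e) ?v x *
        dderiv u e x)
      + (dderiv h ?v x * bilin (G x) e e + bilin (dderiv G ?v x) e e * h x) + bilin (dderiv S ?v x) e e) (at 0)"
  proof -
    have l: "((\<lambda>t. F (x + t *\<^sub>R ?v)) has_real_derivative dderiv F ?v x) (at 0)" if "F differentiable (at x)" for F
      using has_derivative_line[of F x 0 ?v] that by simp
    have b: "((\<lambda>t. bilin (F (x + t *\<^sub>R ?v)) e e) has_real_derivative bilin (dderiv F ?v x) e e) (at 0)"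
      if "F differentiable (at x)" for F :: "real^'n \<Rightarrow> real^'n^'n"
      using l[OF dderiv_bilin(2)[OF that, of e e]] dderiv_bilin(1)[OF that, of e e] by simp
    have m: "((\<lambda>t. F (x + t *\<^sub>R ?v) * F' (x + t *\<^sub>R ?v)) has_real_derivative d1 * F' x + d2 * F x) (at 0)"
      if "((\<lambda>t. F (x + t *\<^sub>R ?v)) has_real_derivative d1) (at 0)" "((\<lambda>t. F' (x + t *\<^sub>R ?v))
        has_real_derivative d2) (at 0)"
      for F F' :: "real^'n \<Rightarrow> real" and d1 d2
      using DERIV_mult[OF that] by simp
    show ?thesis
      by (intro DERIV_add DERIV_diff m l b DERIV_K_V[OF x] h_differentiable) (simp_all add: x)
  qed
  then have "((\<lambda>t. bilin (W (x + t *\<^sub>R ?v)) e e) has_real_derivative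
      dderiv (dderiv (dderiv u e) e) ?v x - ?KD - (dderiv (dderiv u e) ?v x * dderiv u e x + dderiv (dderiv u e) ?v x *
        dderiv u e x)
      + (dderiv h ?v x * bilin (G x) e e + bilin (dderiv G ?v x) e e * h x) + bilin (dderiv S ?v x) e e) (at 0)"
    by (rule DERIV_cong_line[OF x, rotated]) (simp add: bilin_W)
  from DERIV_unique[OF D this]
  have D_eq: "D = dderiv (dderiv (dderiv u e) e) ?v x - ?KD - 2 * dderiv u e x * dderiv (dderiv u e) ?v x
      + dderiv h ?v x + bilin (dderiv G ?v x) e e * h x + bilin (dderiv S ?v x) e e" by (simp add: e)
  have third: "dderiv (dderiv (dderiv u e) e) ?v x = dderiv (dderiv (dderiv u ?v) e) e x"
  proof -
    have "dderiv (dderiv (dderiv u e) e) ?v x = dderiv (dderiv (dderiv u e) ?v) e x" by (rule dderiv_commute[OF ddu2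
      open_dom x])
    also have "\<dots> = dderiv (dderiv (dderiv u ?v) e) e x" by (rule dderiv_cong[OF open_dom x]) (rule dderiv_u_commute)
    finally show ?thesis .
  qed
  have mixed2: "dderiv (dderiv u a) ?v x = - q * dderiv u a x - dderiv u (?B *v a) x" for a
    using T(1)[of a] dderiv_u_commute[OF x, of a ?v] by simp
  have hv: "dderiv h ?v x = - q * (2 * h x)"
    using dh_at_max[OF x max, of ?v] h_eq[OF x] by (simp add: q_def)
  have KV': "K x e e (grad_rate x) = - q * K x e e ?v - bilin (G x) ?v (?B *v ?z) - bilin (dderiv G ?v x) ?z ?v"
    using grad_rate_char[OF x, of ?z] christoffel_vec[OF x, of e "grad_rate x"] christoffel_vec[OF x, of e ?v] mixed2[of ?z]
      gradient_char[OF x, of ?z] gradient_char[OF x, of "?B *v ?z"] by simp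
  have Wb: "bilin (W x) e ?b = dderiv (dderiv u ?b) e x - K x e ?b ?v - dderiv u e x * dderiv u ?b x + h x * bilin (G
    x) e ?b + bilin (S x) e ?b"
    by (rule bilin_W[OF x])
  have We: "dderiv (dderiv u e) e x = bilin (W x) e e + K x e e ?v + (dderiv u e x)\<^sup>2 - h x - bilin (S x) e e"
    using bilin_W[OF x, of e e] e by (simp add: power2_eq_square)
  have Gb: "bilin (dderiv G ?v x) e e = - 2 * bilin (G x) e ?b"
    using frame_metric[OF x, of e e] bilinG_commute[OF x, of ?b e] by simp
  have qWe: "q * (dderiv (dderiv u e) e x + (dderiv u e x)\<^sup>2) =
      q * bilin (W x) e e + q * K x e e ?v + 2 * (q * (dderiv u e x)\<^sup>2) - q * h x - q * bilin (S x) e e"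
    unfolding We by (simp add: algebra_simps)
  have "D + 2 * bilin (W x) e ?b = dderiv (dderiv (dderiv u ?v) e) e x + 2 * dderiv (dderiv u ?b) e x
     + 2 * (q * (dderiv u e x)\<^sup>2) - 2 * (q * h x) + q * K x e e ?v
     + (- bilin (dderiv (dderiv G e) ?v x) e ?v + bilin (dderiv (dderiv G ?v) ?v x) e e / 2 + bilin (G x) ?v (?B *v ?z)
     + bilin (dderiv G ?v x) ?z ?v + bilin (dderiv S ?v x) e e - 2 * K x e ?b ?v + 2 * bilin (S x) e ?b)"
    unfolding D_eq third mixed2 hv KV' Wb Gb by (simp add: power2_eq_square algebra_simps)
  then show ?thesis
    using T(2)[of e] qWe unfolding remainder_def Let_def by linarith
qed

end

section \<open>The gradient bound at a maximum\<close>

lemma quadratic_le_linear: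
  fixes t :: real
  assumes "0 < c" "0 \<le> t" "0 \<le> m" "c * t\<^sup>2 \<le> m * t"
  shows "t \<le> m / c"
proof (cases "t = 0")
  case False
  then have "c * t \<le> m" using assms by (simp add: power2_eq_square mult.assoc[symmetric])
  then show ?thesis using assms(1) by (simp add: field_simps)
qed (use assms in simp)

text \<open>Where the metric satisfies the bounds \<open>c\<close> and \<open>M\<close>, the operator norm of
  \<open>frame_rate x\<close> is at most this constant times the norm of \<open>V x\<close>.\<close>

definition rate_const :: "real \<Rightarrow> real \<Rightarrow> real" where
  "rate_const c M = (3 / 2) * M / c"

definition remainder_const :: "real \<Rightarrow> real \<Rightarrow> real" where
  "remainder_const c M = (let b = rate_const c M in
     M * (2 + 6 * b + 2 * b\<^sup>2) * (2 / c * (1 / c)) + M * (1 + 2 * b) * ((1 + 2 / c) * (1 / c)))"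

lemma remainder_const_nonneg: "0 < c \<Longrightarrow> 0 \<le> M \<Longrightarrow> 0 \<le> remainder_const c M"
  unfolding remainder_const_def Let_def rate_const_def
  by (intro add_nonneg_nonneg mult_nonneg_nonneg) auto

text \<open>The constants on which the estimate in a chart depends. Nothing here involves \<open>u\<close>, which makes the
  final bound uniform in the solution.\<close>

definition metric_bounds :: "(real^'n::finite \<Rightarrow> real^'n^'n) \<Rightarrow> (real^'n \<Rightarrow>
  real^'n^'n) \<Rightarrow> real \<Rightarrow> real \<Rightarrow> real^'n \<Rightarrow> bool" where
  "metric_bounds G S c M x \<longleftrightarrow> 0 < c \<and> 0 \<le> M \<and>
     (\<forall>v. c * (norm v)\<^sup>2 \<le> bilin (G x) v v) \<and> (\<forall>a b. \<bar>bilin (G x) a b\<bar> \<le> M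
       * norm a * norm b) \<and>
     (\<forall>a b c. \<bar>bilin (dderiv G a x) b c\<bar> \<le> M * norm a * norm b * norm c) \<and>
     (\<forall>a b c d. \<bar>bilin (dderiv (dderiv G a) b x) c d\<bar> \<le> M * norm a * norm b * norm c * norm d) \<and>
     (\<forall>a b. \<bar>bilin (S x) a b\<bar> \<le> M * norm a * norm b) \<and>
     (\<forall>a b c. \<bar>bilin (dderiv S a x) b c\<bar> \<le> M * norm a * norm b * norm c)"

context chart_data
begin

abbreviation bounds where "bounds \<equiv> metric_bounds G S"

lemma boundsD:
  assumes "bounds c M x"
  shows "0 < c" "0 \<le> M" "c * (norm v)\<^sup>2 \<le> bilin (G x) v v" "\<bar>bilin (G x) a b\<bar> \<le> M * norm a * norm b"
    "\<bar>bilin (dderiv G a x) b d\<bar> \<le> M * norm a * norm b * norm d"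
    "\<bar>bilin (dderiv (dderiv G a) b x) d e\<bar> \<le> M * norm a * norm b * norm d * norm e"
    "\<bar>bilin (S x) a b\<bar> \<le> M * norm a * norm b" "\<bar>bilin (dderiv S a x) b d\<bar> \<le> M * norm a *
      norm b * norm d"
  using assms unfolding metric_bounds_def by blast+

lemma K_bound:
  assumes "bounds c M x"
  shows "\<bar>K x a b w\<bar> \<le> (3 / 2) * M * norm a * norm b * norm w"
  using boundsD(5)[OF assms, of a b w] boundsD(5)[OF assms, of b a w] boundsD(5)[OF assms, of w a b]
  unfolding koszul_def by (simp add: abs_le_iff field_simps)

lemma frame_rate_bound:
  assumes x: "x \<in> \<Omega>" and b: "bounds c M x"
  shows "norm (frame_rate x *v a) \<le> rate_const c M * norm (V x) * norm a"
proof -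
  let ?r = "norm (frame_rate x *v a)"
  have "c * ?r\<^sup>2 \<le> - K x (V x) a (frame_rate x *v a)"
    using boundsD(3)[OF b] frame_rate[OF x] by metis
  also have "\<dots> \<le> ((3 / 2) * M * norm (V x) * norm a) * ?r"
    using K_bound[OF b, of "V x" a "frame_rate x *v a"] by simp
  finally have "?r \<le> ((3 / 2) * M * norm (V x) * norm a) / c"
    using boundsD(1,2)[OF b] by (intro quadratic_le_linear) auto
  then show ?thesis by (simp add: rate_const_def)
qed

lemma christoffel_vec_bound:
  assumes x: "x \<in> \<Omega>" and b: "bounds c M x"
  shows "norm (christoffel_vec x e) \<le> rate_const c M * (norm e)\<^sup>2"
proof -
  let ?r = "norm (christoffel_vec x e)"
  have "c * ?r\<^sup>2 \<le> K x e e (christoffel_vec x e)"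
    using boundsD(3)[OF b] christoffel_vec[OF x] by metis
  also have "\<dots> \<le> ((3 / 2) * M * norm e * norm e) * ?r"
    using K_bound[OF b, of e e "christoffel_vec x e"] by simp
  finally have "?r \<le> ((3 / 2) * M * norm e * norm e) / c"
    using boundsD(1,2)[OF b] by (intro quadratic_le_linear) auto
  then show ?thesis by (simp add: rate_const_def power2_eq_square)
qed

lemma V_bound:
  assumes b: "bounds c M x"
  shows "(norm (V x))\<^sup>2 \<le> 2 * h x / c"
  using boundsD(1)[OF b] boundsD(3)[OF b, of "V x"] by (simp add: half_sq_grad_def field_simps)

text \<open>The condition \<open>1 \<le> h x\<close> serves to absorb the terms that are linear in the gradient.\<close>

lemma remainder_le:
  assumes x: "x \<in> \<Omega>" and b: "bounds c M x" and e: "bilin (G x) e e = 1" and h1: "1 \<le> h x"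
  shows "remainder x e \<le> remainder_const c M * h x"
proof -
  let ?v = "norm (V x)" and ?n = "norm e" and ?b = "frame_rate x *v e" and ?z = "christoffel_vec x e"
  define r where "r = rate_const c M"
  define P where "P = ?v\<^sup>2 * ?n\<^sup>2"
  define Q where "Q = ?v * ?n\<^sup>2"
  note c = boundsD(1,2)[OF b]
  have r0: "0 \<le> r" using c by (simp add: r_def rate_const_def)
  have nb: "norm ?b \<le> r * ?v * ?n" unfolding r_def by (rule frame_rate_bound[OF x b])
  have nz: "norm ?z \<le> r * ?n\<^sup>2" unfolding r_def by (rule christoffel_vec_bound[OF x b])
  have nbz: "norm (frame_rate x *v ?z) \<le> r * ?v * (r * ?n\<^sup>2)"
    using frame_rate_bound[OF x b, of ?z] mult_left_mono[OF nz, of "r * ?v"] r0 by (simp add: r_def)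
  have t1: "\<bar>bilin (dderiv (dderiv G e) e x) (V x) (V x)\<bar> \<le> M * P"
    using boundsD(6)[OF b, of e e "V x" "V x"] by (simp add: P_def power2_eq_square mult_ac)
  have t2: "\<bar>bilin (dderiv G e x) (V x) ?b\<bar> \<le> M * r * P"
    using boundsD(5)[OF b, of e "V x" ?b] mult_left_mono[OF nb, of "M * ?n * ?v"] c
    by (simp add: P_def power2_eq_square mult_ac)
  have t3: "\<bar>bilin (G x) ?b ?b\<bar> \<le> M * r\<^sup>2 * P"
  proof -
    have "norm ?b * norm ?b \<le> (r * ?v * ?n) * (r * ?v * ?n)"
      using nb r0 by (intro mult_mono) auto
    then show ?thesis
      using boundsD(4)[OF b, of ?b ?b] mult_left_mono[of "norm ?b * norm ?b" "(r * ?v * ?n) * (r * ?v * ?n)" M] c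
      by (simp add: P_def power2_eq_square mult_ac)
  qed
  have t4: "\<bar>bilin (dderiv (dderiv G e) (V x) x) e (V x)\<bar> \<le> M * P"
    using boundsD(6)[OF b, of e "V x" e "V x"] by (simp add: P_def power2_eq_square mult_ac)
  have t5: "\<bar>bilin (dderiv (dderiv G (V x)) (V x) x) e e\<bar> \<le> M * P"
    using boundsD(6)[OF b, of "V x" "V x" e e] by (simp add: P_def power2_eq_square mult_ac)
  have t6: "\<bar>K x e ?b (V x)\<bar> \<le> (3 / 2) * M * r * P"
    using K_bound[OF b, of e ?b "V x"] mult_left_mono[OF nb, of "(3 / 2) * M * ?n * ?v"] c
    by (simp add: P_def power2_eq_square mult_ac)
  have t7: "\<bar>bilin (G x) (V x) (frame_rate x *v ?z)\<bar> \<le> M * r\<^sup>2 * P"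
    using boundsD(4)[OF b, of "V x" "frame_rate x *v ?z"] mult_left_mono[OF nbz, of "M * ?v"] c
    by (simp add: P_def power2_eq_square mult_ac)
  have t8: "\<bar>bilin (dderiv G (V x) x) ?z (V x)\<bar> \<le> M * r * P"
    using boundsD(5)[OF b, of "V x" ?z "V x"] mult_left_mono[OF nz, of "M * ?v * ?v"] c
    by (simp add: P_def power2_eq_square mult_ac)
  have t9: "\<bar>bilin (dderiv S (V x) x) e e\<bar> \<le> M * Q"
    using boundsD(8)[OF b, of "V x" e e] by (simp add: Q_def power2_eq_square mult_ac)
  have t10: "\<bar>bilin (S x) e ?b\<bar> \<le> M * r * Q"
    using boundsD(7)[OF b, of e ?b] mult_left_mono[OF nb, of "M * ?n"] c
    by (simp add: Q_def power2_eq_square mult_ac)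
  have 1: "remainder x e \<le> M * (2 + 6 * r + 2 * r\<^sup>2) * P + M * (1 + 2 * r) * Q"
  proof -
    have "M * (2 + 6 * r + 2 * r\<^sup>2) * P + M * (1 + 2 * r) * Q
        = 2 * (M * P) + 6 * (M * r * P) + 2 * (M * r\<^sup>2 * P) + M * Q + 2 * (M * r * Q)"
      by (simp add: algebra_simps)
    then show ?thesis
      unfolding remainder_def Let_def
      using abs_le_D1[OF t1] abs_le_D1[OF t2] abs_le_D1[OF t3] abs_le_D2[OF t4] abs_le_D1[OF t5] abs_le_D2[OF t6]
        abs_le_D1[OF t7] abs_le_D1[OF t8] abs_le_D1[OF t9] abs_le_D1[OF t10] by argo
  qed
  have n2: "?n\<^sup>2 \<le> 1 / c" using boundsD(3)[OF b, of e] e c by (simp add: field_simps)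
  have v2: "?v\<^sup>2 \<le> 2 / c * h x" using V_bound[OF b] by simp
  have "0 \<le> (?v - 1)\<^sup>2" by simp
  then have "?v \<le> 1 + ?v\<^sup>2" by (simp add: power2_eq_square algebra_simps) (metis add_increasing norm_ge_zero
    zero_le_square order_trans linear mult_left_mono mult_1_right add_increasing2 zero_le_one)
  also have "\<dots> \<le> (1 + 2 / c) * h x" using v2 h1 by (simp add: algebra_simps)
  finally have v1: "?v \<le> (1 + 2 / c) * h x" .
  have "P \<le> (2 / c * h x) * (1 / c)"
    unfolding P_def using v2 n2 c h1 by (intro mult_mono) auto
  then have "M * (2 + 6 * r + 2 * r\<^sup>2) * P \<le> M * (2 + 6 * r + 2 * r\<^sup>2) * ((2 / c * h x) * (1 / c))"
    using c r0 by (intro mult_left_mono) auto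
  moreover have "Q \<le> ((1 + 2 / c) * h x) * (1 / c)"
    unfolding Q_def using v1 n2 c h1 by (intro mult_mono) auto
  then have "M * (1 + 2 * r) * Q \<le> M * (1 + 2 * r) * (((1 + 2 / c) * h x) * (1 / c))"
    using c r0 by (intro mult_left_mono) auto
  moreover have "remainder_const c M * h x = M * (2 + 6 * r + 2 * r\<^sup>2) * ((2 / c * h x) * (1 / c))
      + M * (1 + 2 * r) * (((1 + 2 / c) * h x) * (1 / c))"
  proof -
    define i where "i = 1 / c"
    have i: "2 / c = 2 * i" "1 / c = i" by (simp_all add: i_def)
    show ?thesis
      unfolding remainder_const_def Let_def r_def[symmetric] i by (simp add: algebra_simps)
  qed
  ultimately show ?thesis using 1 by linarith
qed

text \<open>The equation is differentiated along \<open>V x\<close> in the moving frame, where it reads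
  \<open>mixed k A B = det A \<cdot> \<psi>\<^sup>k\<close> with \<open>A\<close> constant to first order. The rates of
    the diagonal entries of \<open>B\<close> are
  bounded by lemma \<open>W_rate_le\<close>; the nonnegative weights \<open>\<partial>\<sigma>\<^sub>k /
    \<partial>\<lambda>\<^sub>i\<close> preserve the inequalities, and
  the Euler relation sums up the eigenvalue terms.\<close>

lemma gradient_inequality:
  fixes f :: "real^'n \<Rightarrow> real"
  assumes x: "x \<in> \<Omega>" and max: "\<And>y. y \<in> \<Omega> \<Longrightarrow> h y + \<kappa> * exp (u y) \<le>
    h x + \<kappa> * exp (u x)"
    and k: "Suc m \<le> CARD('n)" and f: "f differentiable (at x)"
    and eqn: "\<And>y. y \<in> \<Omega> \<Longrightarrow> mixed (Suc m) (G y) (W y) = det (G y) * (f y * exp (u y)) ^ Suc m"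
    and adm: "admissible (Suc m) (G x) (W x)"
  defines "q \<equiv> \<kappa> * exp (u x)"
  assumes rem: "\<And>e. bilin (G x) e e = 1 \<Longrightarrow> remainder x e + q * bilin (S x) e e \<le> q * h x"
  shows "(f x * exp (u x)) ^ m * (dderiv f (V x) x * exp (u x) + f x * exp (u x) * (2 * h x) + q * (f x * exp (u x))) \<le> 0"
proof -
  let ?v = "V x" and ?B = "frame_rate x" and ?\<psi> = "\<lambda>y. f y * exp (u y)"
  obtain E :: "real^'n^'n" and l where E: "transpose E ** G x ** E = mat 1"
    "\<And>i j. (transpose E ** W x ** E) $ i $ j = (if i = j then l i else 0)"
    by (rule simultaneous_diagonalization[OF posG[OF x] W_sym[OF x]]) blast
  define e where "e i = column i E" for i
  have Ge: "bilin (G x) (e i) (e j) = (if i = j then 1 else 0)" for i j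
    using congruence_entry[of E "G x" i j] E(1) by (simp add: e_def mat_def)
  have We: "bilin (W x) (e i) (e j) = (if i = j then l i else 0)" for i j
    using congruence_entry[of E "W x" i j] E(2)[of i j] by (simp add: e_def)
  (* the moving frame; its columns are \<open>e i + t (frame_rate x) (e i)\<close> *)
  define Et where "Et t = E + t *\<^sub>R (?B ** E)" for t
  have col: "column i (Et t) = e i + t *\<^sub>R (?B *v e i)" for i t
    by (simp add: Et_def e_def column_def vec_eq_iff matrix_matrix_mult_def matrix_vector_mult_def)
  define At where "At t = transpose (Et t) ** G (x + t *\<^sub>R ?v) ** Et t" for t
  define Bt where "Bt t = transpose (Et t) ** W (x + t *\<^sub>R ?v) ** Et t" for t
  define Wp :: "real^'n^'n" where "Wp = (\<chi> i j. dderiv (\<lambda>y. W y $ i $ j) ?v x)"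
  define B' :: "real^'n^'n" where
    "B' = (\<chi> i j. bilin Wp (e i) (e j) + bilin (W x) (?B *v e i) (e j) + bilin (W x) (e i) (?B *v e j))"
  have ld: "((\<lambda>t. F (x + t *\<^sub>R ?v)) has_real_derivative dderiv F ?v x) (at 0)" if "F differentiable (at x)" for F
    using has_derivative_line[of F x 0 ?v] that by simp
  have Wder: "((\<lambda>t. W (x + t *\<^sub>R ?v) $ i $ j) has_real_derivative Wp $ i $ j) (at 0)" for i j
    using ld[OF W_differentiable[OF x, of i j]] by (simp add: Wp_def)
  have colder: "((\<lambda>t. (e i + t *\<^sub>R (?B *v e i)) $ j) has_real_derivative (?B *v e i) $ j) (at 0)" for i j
    by (auto intro!: derivative_eq_intros)
  have Ader: "((\<lambda>t. At t $ i $ j) has_real_derivative 0) (at 0)" for i j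
  proof -
    have "((\<lambda>t. At t $ i $ j) has_real_derivative bilin (dderiv G ?v x) (e i + 0 *\<^sub>R (?B *v e i)) (e j +
      0 *\<^sub>R (?B *v e j))
        + bilin (G x) (?B *v e i) (e j + 0 *\<^sub>R (?B *v e j)) + bilin (G x) (e i + 0 *\<^sub>R (?B *v e i)) (?B *v
          e j)) (at 0)"
      unfolding At_def congruence_entry col by (rule DERIV_bilin_line[OF diff(4)[OF x] colder colder])
    then show ?thesis using frame_metric[OF x, of "e i" "e j"] by simp
  qed
  have A0: "At 0 = mat 1" by (simp add: At_def Et_def E(1))
  have Bder: "((\<lambda>t. Bt t $ i $ j) has_real_derivative B' $ i $ j) (at 0)" for i j
    using DERIV_bilin[OF Wder colder colder, of i j]
    by (simp add: Bt_def congruence_entry col B'_def)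
  have B0: "Bt 0 $ i $ j = (if i = j then l i else 0)" for i j by (simp add: Bt_def Et_def E(2))
  let ?w = "\<lambda>i. esym m (UNIV - {i}) l"
  have lhs: "((\<lambda>t. mixed (Suc m) (At t) (Bt t)) has_real_derivative (\<Sum>i\<in>UNIV. B' $ i $ i * ?w i)) (at 0)"
    by (rule has_derivative_mixed_at_diagonal[OF Ader A0 Bder B0])
  obtain r where r: "0 < r" "\<And>s. \<bar>s\<bar> < r \<Longrightarrow> x + s *\<^sub>R ?v \<in> \<Omega>" by (rule
    line_in[OF x, where a = ?v]) blast
  have "mixed (Suc m) (At t) (Bt t) = det (At t) * (?\<psi> (x + t *\<^sub>R ?v)) ^ Suc m" if "\<bar>t\<bar> < r" for t
    unfolding At_def Bt_def mixed_congruence[OF k] eqn[OF r(2)[OF that]]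
    by (simp add: det_mul power2_eq_square mult_ac)
  then have lhs': "((\<lambda>t. det (At t) * (?\<psi> (x + t *\<^sub>R ?v)) ^ Suc m) has_real_derivative
    (\<Sum>i\<in>UNIV. B' $ i $ i * ?w i)) (at 0)"
    by (intro has_field_derivative_transform_within[OF lhs r(1)]) auto
  have detA: "((\<lambda>t. det (At t)) has_real_derivative 0) (at 0)"
  proof -
    have "((\<lambda>t. det (At t)) has_real_derivative (\<Sum>i\<in>UNIV. (0 :: real^'n^'n) $ i $ i *
      (\<Prod>j\<in>UNIV - {i}. 1))) (at 0)"
      by (rule has_derivative_det_at_diagonal) (use Ader A0 in \<open>auto simp: mat_def\<close>)
    then show ?thesis by simp
  qed
  let ?\<psi>' = "dderiv f ?v x * exp (u x) + f x * exp (u x) * (2 * h x)"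
  have psi: "((\<lambda>t. ?\<psi> (x + t *\<^sub>R ?v)) has_real_derivative ?\<psi>') (at 0)"
    using DERIV_mult[OF ld[OF f] DERIV_fun_exp[OF ld[OF diff(1)[OF x]]]] h_eq[OF x] by (simp add: mult_ac)
  have rhs: "((\<lambda>t. det (At t) * (?\<psi> (x + t *\<^sub>R ?v)) ^ Suc m) has_real_derivative
      real (Suc m) * (?\<psi> x ^ m * ?\<psi>')) (at 0)"
    using DERIV_mult[OF detA DERIV_power[OF psi, of "Suc m"]] by (simp add: A0 mult_ac)
  have main: "(\<Sum>i\<in>UNIV. B' $ i $ i * ?w i) = real (Suc m) * (?\<psi> x ^ m * ?\<psi>')"
    by (rule DERIV_unique[OF lhs' rhs])
  have mixed_l: "mixed j (G x) (W x) = det (G x) * esym j UNIV l" if "j \<le> Suc m" for j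
    using mixed_frame[OF E, of j] that k by simp
  have pos: "0 < esym j UNIV l" if "j \<le> Suc m" for j
    using adm that mixed_l[OF that] det_G[OF x] unfolding admissible_def by (auto simp: zero_less_mult_iff)
  have w: "0 \<le> ?w i" for i
    using esym_remove_pos[of UNIV i m l] pos by (simp add: less_imp_le)
  have top: "esym (Suc m) UNIV l = ?\<psi> x ^ Suc m"
    using mixed_l[of "Suc m"] eqn[OF x] det_G[OF x] by simp
  have "B' $ i $ i \<le> - q * l i" for i
  proof -
    have D: "((\<lambda>t. bilin (W (x + t *\<^sub>R ?v)) (e i) (e i)) has_real_derivative bilin Wp (e i) (e i)) (at 0)"
      using DERIV_bilin[OF Wder, where a = "\<lambda>t. e i" and b = "\<lambda>t. e i" and a' = 0 and b' = 0] by (simp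
        add: bilin_simps)
    have G1: "bilin (G x) (e i) (e i) = 1" by (simp add: Ge)
    have "B' $ i $ i = bilin Wp (e i) (e i) + 2 * bilin (W x) (e i) (?B *v e i)"
      using bilinW_commute[OF x, of "?B *v e i" "e i"] by (simp add: B'_def)
    also have "\<dots> \<le> - q * bilin (W x) (e i) (e i) - q * h x + q * bilin (S x) (e i) (e i) + remainder x (e i)"
      unfolding q_def by (rule W_rate_le[OF x max G1 D])
    also have "\<dots> \<le> - q * l i" using rem[OF G1] by (simp add: We)
    finally show ?thesis .
  qed
  then have "(\<Sum>i\<in>UNIV. B' $ i $ i * ?w i) \<le> (\<Sum>i\<in>UNIV. - q * l i * ?w i)"
    by (intro sum_mono mult_right_mono w) auto
  also have "\<dots> = - q * (\<Sum>i\<in>UNIV. l i * ?w i)" by (simp add: sum_distrib_left mult.assoc)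
  also have "\<dots> = - q * (real (Suc m) * ?\<psi> x ^ Suc m)"
    using esym_Suc[of "UNIV :: 'n set" m l] top by simp
  finally have "real (Suc m) * (?\<psi> x ^ m * (?\<psi>' + q * ?\<psi> x)) \<le> 0"
    unfolding main by (simp add: algebra_simps)
  then show ?thesis by (simp add: mult_le_0_iff)
qed

text \<open>If \<open>h x\<close> exceeded the bound, the remainder would be dominated by \<open>q h x\<close> and
  lemma \<open>gradient_inequality\<close>
  would apply; but its left side would be positive, since \<open>2 f h\<close> outweighs the derivative of
    \<open>f\<close> along the gradient.\<close>

lemma local_gradient_bound:
  fixes f :: "real^'n \<Rightarrow> real"
  assumes x: "x \<in> \<Omega>" and max: "\<And>y. y \<in> \<Omega> \<Longrightarrow> h y + \<kappa> * exp (u y) \<le>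
    h x + \<kappa> * exp (u x)"
    and k: "Suc m \<le> CARD('n)" and f: "f differentiable (at x)"
    and eqn: "\<And>y. y \<in> \<Omega> \<Longrightarrow> mixed (Suc m) (G y) (W y) = det (G y) * (f y * exp (u y)) ^ Suc m"
    and adm: "admissible (Suc m) (G x) (W x)"
    and b: "bounds c M x" and df: "\<And>v. \<bar>dderiv f v x\<bar> \<le> M * norm v" and fm: "0 < fm" "fm \<le> f x"
    and \<phi>: "0 < \<phi>" "\<phi> * h x \<le> \<kappa> * exp (u x)"
  shows "h x \<le> 1 + M / c + remainder_const c M / \<phi> + M\<^sup>2 / (c * fm\<^sup>2)"
proof (rule ccontr)
  assume "\<not> h x \<le> 1 + M / c + remainder_const c M / \<phi> + M\<^sup>2 / (c * fm\<^sup>2)"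
  then have big: "1 + M / c + remainder_const c M / \<phi> + M\<^sup>2 / (c * fm\<^sup>2) < h x" by simp
  note c = boundsD(1,2)[OF b]
  define q where "q = \<kappa> * exp (u x)"
  define D where "D = remainder_const c M"
  have D0: "0 \<le> D" unfolding D_def by (rule remainder_const_nonneg[OF c])
  have nn: "0 \<le> M / c" "0 \<le> D / \<phi>" "0 \<le> M\<^sup>2 / (c * fm\<^sup>2)" using c D0 \<phi> by auto
  have h1: "1 \<le> h x" using big nn unfolding D_def by linarith
  have q0: "0 < q" using \<phi> h1 unfolding q_def by (smt (verit) mult_pos_pos)
  have rem: "remainder x e + q * bilin (S x) e e \<le> q * h x" if e: "bilin (G x) e e = 1" for e
  proof -
    have "c * (norm e)\<^sup>2 \<le> 1" using boundsD(3)[OF b, of e] e by simp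
    then have "M * (norm e)\<^sup>2 \<le> M * (1 / c)" using c by (intro mult_left_mono) (simp_all add: field_simps)
    then have "bilin (S x) e e \<le> M / c"
      using boundsD(7)[OF b, of e e] by (simp add: power2_eq_square mult.assoc)
    then have "q * bilin (S x) e e \<le> q * (M / c)" using q0 by (intro mult_left_mono) auto
    moreover have "remainder x e \<le> q * (D / \<phi>)"
    proof -
      have "remainder x e \<le> D * h x" unfolding D_def by (rule remainder_le[OF x b e h1])
      also have "\<dots> = (D / \<phi>) * (\<phi> * h x)" using \<phi> by simp
      also have "\<dots> \<le> (D / \<phi>) * q" unfolding q_def by (rule mult_left_mono[OF \<phi>(2) nn(2)])
      finally show ?thesis by (simp add: mult.commute)
    qed
    moreover have "q * (M / c) + q * (D / \<phi>) \<le> q * h x"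
      unfolding distrib_left[symmetric] using big nn q0 unfolding D_def by (intro mult_left_mono) auto
    ultimately show ?thesis by linarith
  qed
  have "(M * norm (V x))\<^sup>2 \<le> M\<^sup>2 * (2 * h x / c)"
    unfolding power_mult_distrib by (intro mult_left_mono V_bound[OF b]) auto
  also have "\<dots> = (2 * h x * fm\<^sup>2) * (M\<^sup>2 / (c * fm\<^sup>2))" using fm c by (simp add: field_simps)
  also have "\<dots> < (2 * h x * fm\<^sup>2) * h x"
    using big nn h1 fm unfolding D_def by (intro mult_strict_left_mono) auto
  also have "\<dots> \<le> (2 * h x * fm)\<^sup>2"
    using mult_nonneg_nonneg[OF zero_le_power2[of fm] zero_le_power2[of "h x"]] by (simp add: power2_eq_square mult_ac)
  finally have "M * norm (V x) < 2 * h x * fm"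
    by (rule power2_less_imp_less) (use h1 fm in auto)
  moreover have "2 * h x * fm \<le> 2 * h x * f x" using h1 fm by (intro mult_left_mono) auto
  ultimately have pos: "0 < dderiv f (V x) x + 2 * h x * f x" using df[of "V x"] by linarith
  have f0: "0 < f x" using fm by simp
  have "0 < (f x * exp (u x)) ^ m * (dderiv f (V x) x * exp (u x) + f x * exp (u x) * (2 * h x) + q * (f x * exp (u x)))"
  proof (intro mult_pos_pos zero_less_power)
    have "dderiv f (V x) x * exp (u x) + f x * exp (u x) * (2 * h x) = (dderiv f (V x) x + 2 * h x * f x) * exp (u x)"
      by (simp add: algebra_simps)
    then show "0 < dderiv f (V x) x * exp (u x) + f x * exp (u x) * (2 * h x) + q * (f x * exp (u x))"
      using pos q0 f0 by (simp add: add_pos_pos)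
  qed (use f0 in auto)
  moreover have "(f x * exp (u x)) ^ m * (dderiv f (V x) x * exp (u x) + f x * exp (u x) * (2 * h x) + q * (f x * exp
    (u x))) \<le> 0"
    unfolding q_def by (rule gradient_inequality[OF x max k f eqn adm]) (use rem in \<open>auto simp: q_def\<close>)
  ultimately show False by simp
qed

lemma continuous_on_W: "continuous_on \<Omega> W"
proof -
  have "continuous_on \<Omega> (\<lambda>y. \<chi> i j. W y $ i $ j)"
    by (intro continuous_on_vec_lambda continuous_at_imp_continuous_on ballI)
      (use W_differentiable in \<open>auto intro: differentiable_imp_continuous_within\<close>)
  then show ?thesis by simp
qed

lemma continuous_on_h: "continuous_on \<Omega> h"
  by (intro continuous_at_imp_continuous_on ballI) (auto intro: differentiable_imp_continuous_within h_differentiable)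

text \<open>At a minimum of \<open>u\<close> the gradient vanishes, so \<open>W\<close> is \<open>S\<close> plus the
  second derivative of \<open>u\<close>.\<close>

lemma admissible_at_minimum:
  assumes x: "x \<in> \<Omega>" and r: "0 < r" and min: "\<And>y. y \<in> \<Omega> \<Longrightarrow> dist y x < r
    \<Longrightarrow> u x \<le> u y"
    and k: "k \<le> CARD('n)" and adm: "admissible k (G x) (S x)"
  shows "admissible k (G x) (W x)"
proof -
  have crit: "dderiv u a x = 0" and conv: "0 \<le> dderiv (dderiv u a) a x" for a
  proof -
    have "open (\<Omega> \<inter> ball x r)" "x \<in> \<Omega> \<inter> ball x r" using open_dom x r by auto
    then obtain r' where r': "0 < r'" "\<And>s. \<bar>s\<bar> < r' \<Longrightarrow> x + s *\<^sub>R a \<in> \<Omega>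
      \<inter> ball x r"
      by (rule open_contains_line[where a = a]) blast
    have d1: "((\<lambda>s. - u (x + s *\<^sub>R a)) has_real_derivative - dderiv u a (x + s *\<^sub>R a)) (at s)" if
      "\<bar>s\<bar> < r'" for s
      using r'(2)[OF that] by (intro DERIV_minus has_derivative_line diff) auto
    have y: "x + 0 *\<^sub>R a \<in> \<Omega>" using x by simp
    have d2: "((\<lambda>s. - dderiv u a (x + s *\<^sub>R a)) has_real_derivative - dderiv (dderiv u a) a (x + 0
      *\<^sub>R a)) (at 0)"
      by (intro DERIV_minus has_derivative_line diff y)
    have "- u (x + s *\<^sub>R a) \<le> - u (x + 0 *\<^sub>R a)" if "\<bar>s\<bar> < r'" for s
      using min[of "x + s *\<^sub>R a"] r'(2)[OF that] by (auto simp: dist_commute)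
    note test = second_derivative_test[OF r'(1) d1 d2 this]
    show "dderiv u a x = 0" "0 \<le> dderiv (dderiv u a) a x" using test by simp_all
  qed
  have V0: "V x = 0" by (simp add: grad_def coord_diff_def crit vec_eq_iff matrix_vector_mult_def)
  have h0: "h x = 0" by (simp add: half_sq_grad_def V0 bilin_simps)
  have "0 \<le> bilin (W x - S x) a a" for a
  proof -
    have "bilin (W x) a a = bilin (W x - S x) a a + bilin (S x) a a" using bilin_add_matrix[of "W x - S x" "S x" a a] by simp
    moreover have "bilin (W x) a a = dderiv (dderiv u a) a x + bilin (S x) a a"
      using bilin_W[OF x, of a a] linear_0[OF K_linear(3)[OF x, of a a]] by (simp add: V0 h0 crit)
    ultimately show ?thesis using conv[of a] by simp
  qed
  moreover have "transpose (W x - S x) = W x - S x"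
    using W_sym[OF x] symS[OF x] by (simp add: transpose_def vec_eq_iff)
  ultimately have "admissible k (G x) (S x + (W x - S x))"
    by (intro admissible_add_psd posG symS x k adm)
  then show ?thesis by simp
qed

end

section \<open>Change of charts\<close>

lemma Ck_on_subset: "Ck_on m S h \<Longrightarrow> T \<subseteq> S \<Longrightarrow> Ck_on m T h"
  by (induction m arbitrary: h) (auto simp: Ck_on_Suc intro: continuous_on_subset)

lemma bilin_polarize:
  assumes "transpose M = M" "transpose N = N" "\<And>a. bilin M a a = bilin N a a"
  shows "bilin M a b = bilin N a b"
  using assms(3)[of "a + b"] assms(3)[of a] assms(3)[of b] bilin_sym[OF assms(1), of a b] bilin_sym[OF assms(2), of a b]
  by (simp add: bilin_simps)

lemma matrix_eq_of_bilin: "(\<And>a b. bilin M a b = bilin N a b) \<Longrightarrow> M = N"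
  by (metis bilin_axis vec_eq_iff)

lemma dderiv_commute_vec:
  fixes F :: "'a::real_normed_vector \<Rightarrow> real^'m::finite"
  assumes F: "Ck_on 2 U F" and U: "open U" "x \<in> U"
  shows "dderiv (dderiv F a) b x = dderiv (dderiv F b) a x"
proof -
  have F': "Ck_on (Suc (Suc 0)) U F" using F by (simp add: numeral_2_eq_2)
  have bl: "bounded_linear (\<lambda>v :: real^'m. v $ i)" for i by (rule bounded_linear_vec_nth)
  have comp: "dderiv (dderiv (\<lambda>y. F y $ i) a) b x = dderiv (dderiv F a) b x $ i" for a b i
  proof -
    have "dderiv (dderiv (\<lambda>y. F y $ i) a) b x = dderiv (\<lambda>y. dderiv F a y $ i) b x"
      by (rule dderiv_cong[OF U]) (rule dderiv_bounded_linear(1)[OF bl Ck_on_differentiable[OF F']])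
    also have "\<dots> = dderiv (dderiv F a) b x $ i"
      by (rule dderiv_bounded_linear(1)[OF bl Ck_on_differentiable[OF Ck_on_dderiv[OF F'] U(2)]])
    finally show ?thesis .
  qed
  have "Ck_on 2 U (\<lambda>y. F y $ i)" for i by (rule Ck_on_bounded_linear[OF U(1) bl F])
  then have "dderiv (dderiv (\<lambda>y. F y $ i) a) b x = dderiv (dderiv (\<lambda>y. F y $ i) b) a x" for i
    by (rule dderiv_commute[OF _ U])
  then show ?thesis by (simp add: vec_eq_iff comp)
qed

lemma dderiv_chain:
  fixes F :: "'b::real_normed_vector \<Rightarrow> 'c::real_normed_vector" and \<phi> :: "'a::real_normed_vector
    \<Rightarrow> 'b"
  assumes "\<phi> differentiable (at y)" "F differentiable (at (\<phi> y))"
  shows "dderiv (\<lambda>y. F (\<phi> y)) b y = dderiv F (dderiv \<phi> b y) (\<phi> y)" "(\<lambda>y. F (\<phi> y))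
    differentiable (at y)"
proof -
  have *: "((\<lambda>y. F (\<phi> y)) has_derivative (\<lambda>b. dderiv F (dderiv \<phi> b y) (\<phi> y))) (at y)"
    by (rule has_derivative_compose[OF has_derivative_dderiv[OF assms(1)] has_derivative_dderiv[OF assms(2)]])
  show "dderiv (\<lambda>y. F (\<phi> y)) b y = dderiv F (dderiv \<phi> b y) (\<phi> y)" by (rule dderiv_eq[OF *])
  show "(\<lambda>y. F (\<phi> y)) differentiable (at y)" using * by (rule differentiableI)
qed

lemma DERIV_line_0:
  fixes h :: "'a::real_normed_vector \<Rightarrow> real"
  assumes "h differentiable (at x)"
  shows "((\<lambda>t. h (x + t *\<^sub>R v)) has_real_derivative dderiv h v x) (at 0)"
  using has_derivative_line[of h x 0 v] assms by simp

lemma comp_differentiable: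
  fixes w :: "'a::real_normed_vector \<Rightarrow> real^'m::finite"
  assumes "w differentiable (at y)"
  shows "(\<lambda>y. w y $ i) differentiable (at y)" "dderiv (\<lambda>y. w y $ i) b y = dderiv w b y $ i"
  using dderiv_bounded_linear[OF bounded_linear_vec_nth assms] by blast+

lemma DERIV_bilin_pullback:
  fixes M :: "'b::real_normed_vector \<Rightarrow> real^'n^'n::finite" and \<phi> :: "'a::real_normed_vector \<Rightarrow> 'b"
  assumes \<phi>: "\<phi> differentiable (at y)" and M: "M differentiable (at (\<phi> y))"
    and w: "w differentiable (at y)" and z: "z differentiable (at y)"
  shows "((\<lambda>t. bilin (M (\<phi> (y + t *\<^sub>R b))) (w (y + t *\<^sub>R b)) (z (y + t *\<^sub>R b)))
    has_real_derivative
     bilin (dderiv M (dderiv \<phi> b y) (\<phi> y)) (w y) (z y) + bilin (M (\<phi> y)) (dderiv w b y) (z y) + bilin (M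
       (\<phi> y)) (w y) (dderiv z b y)) (at 0)"
proof -
  have "((\<lambda>t. M (\<phi> (y + t *\<^sub>R b)) $ i $ j) has_real_derivative dderiv M (dderiv \<phi> b y) (\<phi>
    y) $ i $ j) (at 0)" for i j
    using DERIV_line_0[OF dderiv_chain(2)[OF \<phi> entry_differentiable(1)[OF M, of i j]], of b]
      dderiv_chain(1)[OF \<phi> entry_differentiable(1)[OF M, of i j], of b] entry_differentiable(2)[OF M, of i j] by simp
  moreover have "((\<lambda>t. w (y + t *\<^sub>R b) $ i) has_real_derivative dderiv w b y $ i) (at 0)" for i
    using DERIV_line_0[OF comp_differentiable(1)[OF w, of i], of b] comp_differentiable(2)[OF w, of i b] by simp
  moreover have "((\<lambda>t. z (y + t *\<^sub>R b) $ i) has_real_derivative dderiv z b y $ i) (at 0)" for i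
    using DERIV_line_0[OF comp_differentiable(1)[OF z, of i], of b] comp_differentiable(2)[OF z, of i b] by simp
  ultimately have "((\<lambda>t. bilin (M (\<phi> (y + t *\<^sub>R b))) (w (y + t *\<^sub>R b)) (z (y + t *\<^sub>R
    b))) has_real_derivative
     bilin (dderiv M (dderiv \<phi> b y) (\<phi> y)) (w (y + 0 *\<^sub>R b)) (z (y + 0 *\<^sub>R b)) + bilin (M (\<phi>
       (y + 0 *\<^sub>R b))) (dderiv w b y) (z (y + 0 *\<^sub>R b))
     + bilin (M (\<phi> (y + 0 *\<^sub>R b))) (w (y + 0 *\<^sub>R b)) (dderiv z b y)) (at 0)"
    by (rule DERIV_bilin)
  then show ?thesis by simp
qed

text \<open>Two charts related by the transition map \<open>\<phi>\<close>. Second derivatives of \<open>\<phi>\<close>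
  appear both in the second derivatives
  of \<open>u\<close> and in the Koszul form, and cancel in \<open>W\<close>.\<close>

locale chart_change = c: chart_data \<Omega> u G S + d: chart_data \<Omega>' u' G' S'
  for \<Omega> \<Omega>' :: "(real^'n::finite) set" and u u' G G' S S' +
  fixes \<phi> :: "real^'n \<Rightarrow> real^'n"
  assumes \<phi>2: "Ck_on 2 \<Omega> \<phi>" and \<phi>_in: "\<And>y. y \<in> \<Omega> \<Longrightarrow> \<phi> y \<in>
    \<Omega>'"
    and u_eq: "\<And>y. y \<in> \<Omega> \<Longrightarrow> u y = u' (\<phi> y)"
    and G_eq: "\<And>y a b. y \<in> \<Omega> \<Longrightarrow> bilin (G y) a b = bilin (G' (\<phi> y)) (dderiv \<phi> a
      y) (dderiv \<phi> b y)"
    and S_eq: "\<And>y a b. y \<in> \<Omega> \<Longrightarrow> bilin (S y) a b = bilin (S' (\<phi> y)) (dderiv \<phi> a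
      y) (dderiv \<phi> b y)"
begin

lemma \<phi>2': "Ck_on (Suc (Suc 0)) \<Omega> \<phi>"
  using \<phi>2 by (simp add: numeral_2_eq_2)

lemma \<phi>_diff: "y \<in> \<Omega> \<Longrightarrow> \<phi> differentiable (at y)" "y \<in> \<Omega>
  \<Longrightarrow> dderiv \<phi> a differentiable (at y)"
  using Ck_on_differentiable[OF \<phi>2'] Ck_on_differentiable[OF Ck_on_dderiv[OF \<phi>2']] by blast+

lemma coord_diff_change: "y \<in> \<Omega> \<Longrightarrow> dderiv u a y = dderiv u' (dderiv \<phi> a y) (\<phi> y)"
proof -
  assume y: "y \<in> \<Omega>"
  have "dderiv u a y = dderiv (\<lambda>y. u' (\<phi> y)) a y" by (rule dderiv_cong[OF c.open_dom y u_eq])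
  then show ?thesis using dderiv_chain(1)[OF \<phi>_diff(1)[OF y] d.diff(1)[OF \<phi>_in[OF y]]] by simp
qed

lemma J_linear: "y \<in> \<Omega> \<Longrightarrow> linear (\<lambda>a. dderiv \<phi> a y)"
  by (rule linear_dderiv[OF \<phi>_diff(1)])

lemma J_surj:
  assumes y: "y \<in> \<Omega>"
  shows "surj (\<lambda>a. dderiv \<phi> a y)"
proof (rule linear_injective_imp_surjective[OF J_linear[OF y]])
  show "inj (\<lambda>a. dderiv \<phi> a y)"
  proof (subst linear_injective_0[OF J_linear[OF y]], intro allI impI)
    fix a assume "dderiv \<phi> a y = 0"
    then have "bilin (G y) a a = 0" by (simp add: G_eq[OF y] bilin_simps)
    then show "a = 0" using c.posG[OF y] unfolding posdef_def by fastforce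
  qed
qed simp

lemma V_change:
  assumes y: "y \<in> \<Omega>"
  shows "d.V (\<phi> y) = dderiv \<phi> (c.V y) y"
proof -
  note y' = \<phi>_in[OF y]
  let ?D = "dderiv \<phi> (c.V y) y - d.V (\<phi> y)"
  have "bilin (G' (\<phi> y)) ?D (dderiv \<phi> b y) = 0" for b
    using c.gradient_char(1)[OF y, of b] d.gradient_char(1)[OF y', of "dderiv \<phi> b y"] coord_diff_change[OF y, of
      b] G_eq[OF y, of "c.V y" b]
    by (simp add: bilin_simps)
  moreover obtain b where "dderiv \<phi> b y = ?D" using J_surj[OF y] by (metis surjD)
  ultimately have "bilin (G' (\<phi> y)) ?D ?D = 0" by metis
  then have "?D = 0" using d.posG[OF y'] unfolding posdef_def by fastforce
  then show ?thesis by simp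
qed

lemma h_change: "y \<in> \<Omega> \<Longrightarrow> d.h (\<phi> y) = c.h y"
  by (simp add: c.h_eq d.h_eq \<phi>_in V_change coord_diff_change)

lemma second_derivative_change:
  assumes y: "y \<in> \<Omega>"
  shows "dderiv (dderiv u a) b y = dderiv u' (dderiv (dderiv \<phi> a) b y) (\<phi> y) + dderiv (dderiv u' (dderiv
    \<phi> a y)) (dderiv \<phi> b y) (\<phi> y)"
proof -
  note y' = \<phi>_in[OF y]
  let ?w = "dderiv \<phi> a" and ?J = "dderiv \<phi> b y"
  have exp: "dderiv u' v (\<phi> z) = (\<Sum>i\<in>UNIV. v $ i * dderiv u' (axis i 1) (\<phi> z))" if "z \<in> \<Omega>" for v z
    using dderiv_expand[OF d.diff(1)[OF \<phi>_in[OF that]], of v] by simp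
  have "((\<lambda>t. \<Sum>i\<in>UNIV. ?w (y + t *\<^sub>R b) $ i * dderiv u' (axis i 1) (\<phi> (y + t *\<^sub>R b)))
    has_real_derivative
      (\<Sum>i\<in>UNIV. dderiv ?w b y $ i * dderiv u' (axis i 1) (\<phi> y) + dderiv (dderiv u' (axis i 1)) ?J (\<phi>
        y) * ?w y $ i)) (at 0)"
  proof (rule DERIV_sum)
    fix i
    have 1: "((\<lambda>t. ?w (y + t *\<^sub>R b) $ i) has_real_derivative dderiv ?w b y $ i) (at 0)"
      using DERIV_line_0[OF comp_differentiable(1)[OF \<phi>_diff(2)[OF y, of a], of i], of b]
        comp_differentiable(2)[OF \<phi>_diff(2)[OF y, of a], of i b] by simp
    have 2: "((\<lambda>t. dderiv u' (axis i 1) (\<phi> (y + t *\<^sub>R b))) has_real_derivative dderiv (dderiv u'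
      (axis i 1)) ?J (\<phi> y)) (at 0)"
      using DERIV_line_0[OF dderiv_chain(2)[OF \<phi>_diff(1)[OF y] d.diff(2)[OF y', of "axis i 1"]], of b]
        dderiv_chain(1)[OF \<phi>_diff(1)[OF y] d.diff(2)[OF y', of "axis i 1"], of b] by simp
    show "((\<lambda>t. ?w (y + t *\<^sub>R b) $ i * dderiv u' (axis i 1) (\<phi> (y + t *\<^sub>R b))) has_real_derivative
      dderiv ?w b y $ i * dderiv u' (axis i 1) (\<phi> y) + dderiv (dderiv u' (axis i 1)) ?J (\<phi> y) * ?w y $ i) (at 0)"
      using DERIV_mult[OF 1 2] by simp
  qed
  then have "((\<lambda>t. dderiv u a (y + t *\<^sub>R b)) has_real_derivative
      (\<Sum>i\<in>UNIV. dderiv ?w b y $ i * dderiv u' (axis i 1) (\<phi> y) + dderiv (dderiv u' (axis i 1)) ?J (\<phi>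
        y) * ?w y $ i)) (at 0)"
    by (rule c.DERIV_cong_line[OF y, where f = "\<lambda>z. \<Sum>i\<in>UNIV. ?w z $ i * dderiv u' (axis i 1) (\<phi>
      z)", rotated])
      (rule trans[OF exp[symmetric] coord_diff_change[symmetric]])
  then have "dderiv (dderiv u a) b y = (\<Sum>i\<in>UNIV. dderiv ?w b y $ i * dderiv u' (axis i 1) (\<phi> y) + dderiv
    (dderiv u' (axis i 1)) ?J (\<phi> y) * ?w y $ i)"
    by (rule DERIV_unique[OF DERIV_line_0[OF c.diff(2)[OF y]]])
  also have "\<dots> = (\<Sum>i\<in>UNIV. dderiv ?w b y $ i * dderiv u' (axis i 1) (\<phi> y)) + (\<Sum>i\<in>UNIV. ?w
    y $ i * dderiv (dderiv u' (axis i 1)) ?J (\<phi> y))"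
    by (simp add: sum.distrib mult.commute)
  also have "\<dots> = dderiv u' (dderiv ?w b y) (\<phi> y) + dderiv (dderiv u' (?w y)) ?J (\<phi> y)"
    by (simp only: exp[OF y, of "dderiv ?w b y", symmetric] linear_expand[OF d.linear_hessian[OF y'], of "?w y" ?J, symmetric])
  finally show ?thesis .
qed

lemma dG_change:
  assumes y: "y \<in> \<Omega>"
  shows "bilin (dderiv G b y) a e = bilin (dderiv G' (dderiv \<phi> b y) (\<phi> y)) (dderiv \<phi> a y) (dderiv \<phi> e y)
     + bilin (G' (\<phi> y)) (dderiv (dderiv \<phi> a) b y) (dderiv \<phi> e y) + bilin (G' (\<phi> y)) (dderiv \<phi>
       a y) (dderiv (dderiv \<phi> e) b y)"
proof -
  note D = DERIV_bilin_pullback[OF \<phi>_diff(1)[OF y] d.diff(4)[OF \<phi>_in[OF y]] \<phi>_diff(2)[OF y, of a]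
    \<phi>_diff(2)[OF y, of e], of b]
  have "((\<lambda>t. bilin (G (y + t *\<^sub>R b)) a e) has_real_derivative bilin (dderiv G' (dderiv \<phi> b y)
    (\<phi> y)) (dderiv \<phi> a y) (dderiv \<phi> e y)
     + bilin (G' (\<phi> y)) (dderiv (dderiv \<phi> a) b y) (dderiv \<phi> e y) + bilin (G' (\<phi> y)) (dderiv \<phi>
       a y) (dderiv (dderiv \<phi> e) b y)) (at 0)"
    by (rule c.DERIV_cong_line[OF y, where f = "\<lambda>z. bilin (G' (\<phi> z)) (dderiv \<phi> a z) (dderiv \<phi> e
      z)"]) (use G_eq D in auto)
  moreover have "((\<lambda>t. bilin (G (y + t *\<^sub>R b)) a e) has_real_derivative bilin (dderiv G b y) a e) (at 0)"
    using DERIV_line_0[OF dderiv_bilin(2)[OF c.diff(4)[OF y], of a e], of b] dderiv_bilin(1)[OF c.diff(4)[OF y], of a e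
      b] by simp
  ultimately show ?thesis by (rule DERIV_unique[rotated])
qed

lemma K_change:
  assumes y: "y \<in> \<Omega>"
  shows "c.K y a a w = d.K (\<phi> y) (dderiv \<phi> a y) (dderiv \<phi> a y) (dderiv \<phi> w y) + bilin (G' (\<phi>
    y)) (dderiv (dderiv \<phi> a) a y) (dderiv \<phi> w y)"
  using dG_change[OF y, of a a w] dG_change[OF y, of w a a] dderiv_commute_vec[OF \<phi>2 c.open_dom y, of a w]
    d.bilinG_commute[OF \<phi>_in[OF y], of "dderiv (dderiv \<phi> a) w y" "dderiv \<phi> a y"]
  unfolding koszul_def by (simp add: field_simps)

lemma W_change:
  assumes y: "y \<in> \<Omega>"
  shows "bilin (c.W y) a a = bilin (d.W (\<phi> y)) (dderiv \<phi> a y) (dderiv \<phi> a y)"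
  unfolding c.bilin_W[OF y] d.bilin_W[OF \<phi>_in[OF y]] second_derivative_change[OF y] K_change[OF y] V_change[OF y,
    symmetric]
    h_change[OF y] d.gradient_char(2)[OF \<phi>_in[OF y]]
  by (simp add: coord_diff_change[OF y] G_eq[OF y] S_eq[OF y])

lemma admissible_change:
  assumes y: "y \<in> \<Omega>" and k: "k \<le> CARD('n)"
  shows "admissible k (G y) (c.W y) \<longleftrightarrow> admissible k (G' (\<phi> y)) (d.W (\<phi> y))"
proof -
  note y' = \<phi>_in[OF y]
  define J where "J = matrix (\<lambda>a. dderiv \<phi> a y)"
  have J: "J *v a = dderiv \<phi> a y" for a unfolding J_def by (simp add: matrix_works J_linear[OF y])
  have sym: "transpose (transpose J ** M ** J) = transpose J ** M ** J" if "transpose M = M" for M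
    by (simp add: matrix_transpose_mul that matrix_mul_assoc)
  have 1: "G y = transpose J ** G' (\<phi> y) ** J"
    by (rule matrix_eq_of_bilin) (simp add: bilin_congruence J G_eq[OF y])
  have 2: "c.W y = transpose J ** d.W (\<phi> y) ** J"
    by (rule matrix_eq_of_bilin, rule bilin_polarize)
      (simp_all add: c.W_sym[OF y] sym[OF d.W_sym[OF y']] bilin_congruence J W_change[OF y])
  have "det J \<noteq> 0" using c.det_G[OF y] unfolding 1 by (auto simp: det_mul)
  then show ?thesis unfolding 1 2 by (rule admissible_congruence[OF _ k])
qed

end

section \<open>Compactness and the global estimate\<close>

lemma bilin_norm_bound:
  assumes "norm T \<le> C * t" "(real CARD('n))\<^sup>2 * C \<le> M" "0 \<le> t"
  shows "\<bar>bilin T a (b :: real^'n::finite)\<bar> \<le> M * t * norm a * norm b"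
proof -
  have "(real CARD('n))\<^sup>2 * norm T \<le> (real CARD('n))\<^sup>2 * (C * t)"
    using assms(1) by (intro mult_left_mono) auto
  also have "\<dots> = ((real CARD('n))\<^sup>2 * C) * t" by simp
  also have "\<dots> \<le> M * t" by (rule mult_right_mono[OF assms(2,3)])
  finally have "(real CARD('n))\<^sup>2 * norm T * norm a * norm b \<le> M * t * norm a * norm b"
    by (intro mult_right_mono) auto
  then show ?thesis using bilin_bound[of T a b] by linarith
qed

text \<open>The lower bound for the metric is its minimum over \<open>K\<close> times the unit sphere.\<close>

lemma metric_bounds_on_compact:
  fixes G S :: "real^'n::finite \<Rightarrow> real^'n^'n"
  assumes op: "open \<Omega>" and K: "compact K" "K \<subseteq> \<Omega>" and G2: "Ck_on 2 \<Omega> G" and S1: "Ck_on 1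
    \<Omega> S"
    and pos: "\<And>x. x \<in> \<Omega> \<Longrightarrow> posdef (G x)"
  obtains c M0 where "\<forall>M\<ge>M0. \<forall>x\<in>K. metric_bounds G S c M x"
proof -
  have G2': "Ck_on (Suc (Suc 0)) \<Omega> G" using G2 by (simp add: numeral_2_eq_2)
  have S1': "Ck_on (Suc 0) \<Omega> S" using S1 by simp
  obtain c where c: "0 < c" "\<And>x v. x \<in> K \<Longrightarrow> c * (norm v)\<^sup>2 \<le> bilin (G x) v v"
  proof (cases "K = {}")
    case True
    then show ?thesis using that[of 1] by simp
  next
    case False
    let ?C = "K \<times> sphere (0::real^'n) 1"
    have ne: "?C \<noteq> {}" using False by simp
    have comp: "compact ?C" by (intro compact_Times K compact_sphere)
    have cont: "continuous_on ?C (\<lambda>z. bilin (G (fst z)) (snd z) (snd z))"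
      by (intro continuous_on_bilin continuous_intros continuous_on_compose2[OF Ck_on_continuous[OF G2]])
        (use K in auto)
    obtain z where z: "z \<in> ?C" "\<And>y. y \<in> ?C \<Longrightarrow> bilin (G (fst z)) (snd z) (snd z) \<le> bilin
      (G (fst y)) (snd y) (snd y)"
      using continuous_attains_inf[OF comp ne cont] by blast
    let ?c = "bilin (G (fst z)) (snd z) (snd z)"
    have "posdef (G (fst z))" "snd z \<noteq> 0" using z(1) K pos by auto
    then have c0: "0 < ?c" unfolding posdef_def by blast
    have "?c * (norm v)\<^sup>2 \<le> bilin (G x) v v" if "x \<in> K" for x v
    proof (cases "v = 0")
      case False
      then have "(x, v /\<^sub>R norm v) \<in> ?C" using that by simp
      from z(2)[OF this] False show ?thesis by (simp add: bilin_simps field_simps power2_eq_square)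
    qed (simp add: bilin_simps)
    then show ?thesis using that c0 by blast
  qed
  obtain C1 where C1: "0 \<le> C1" "\<And>x. x \<in> K \<Longrightarrow> norm (G x) \<le> C1"
    using compact_bound[OF Ck_on_continuous[OF G2] K] by blast
  obtain C2 where C2: "0 \<le> C2" "\<And>x v. x \<in> K \<Longrightarrow> norm (dderiv G v x) \<le> C2 * norm v"
    using dderiv_bound[OF G2' K] by blast
  obtain C3 where C3: "0 \<le> C3" "\<And>x v w. x \<in> K \<Longrightarrow> norm (dderiv (dderiv G v) w x) \<le> C3 *
    norm v * norm w"
    using second_deriv_bound[OF G2' op K] by blast
  obtain C4 where C4: "0 \<le> C4" "\<And>x. x \<in> K \<Longrightarrow> norm (S x) \<le> C4"
    using compact_bound[OF Ck_on_continuous[OF S1] K] by blast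
  obtain C5 where C5: "0 \<le> C5" "\<And>x v. x \<in> K \<Longrightarrow> norm (dderiv S v x) \<le> C5 * norm v"
    using dderiv_bound[OF S1' K] by blast
  let ?N = "(real CARD('n))\<^sup>2"
  let ?M = "?N * (C1 + C2 + C3 + C4 + C5)"
  have M: "?N * C1 \<le> ?M" "?N * C2 \<le> ?M" "?N * C3 \<le> ?M" "?N * C4 \<le> ?M" "?N * C5 \<le> ?M" "0 \<le> ?M"
    using C1(1) C2(1) C3(1) C4(1) C5(1) by (auto intro!: mult_left_mono)
  show ?thesis
  proof (rule that[of ?M c], intro allI impI ballI)
    fix M x assume le: "?M \<le> M" and x: "x \<in> K"
    note le' = M(1-5)[THEN order_trans[OF _ le]]
    show "metric_bounds G S c M x"
      unfolding metric_bounds_def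
    proof (intro conjI allI)
      show "0 < c" by (rule c)
      show "0 \<le> M" using M(6) le by linarith
      show "c * (norm v)\<^sup>2 \<le> bilin (G x) v v" for v by (rule c(2)[OF x])
      show "\<bar>bilin (G x) a b\<bar> \<le> M * norm a * norm b" for a b
        using bilin_norm_bound[of "G x" C1 1 M a b] C1(2)[OF x] le'(1) by simp
      show "\<bar>bilin (dderiv G a x) b d\<bar> \<le> M * norm a * norm b * norm d" for a b d
        by (rule bilin_norm_bound[OF C2(2)[OF x] le'(2)]) simp
      show "\<bar>bilin (dderiv (dderiv G a) b x) d e\<bar> \<le> M * norm a * norm b * norm d * norm e" for a b d e
        using bilin_norm_bound[of "dderiv (dderiv G a) b x" C3 "norm a * norm b" M d e] C3(2)[OF x, of a b] le'(3)
        by (simp add: mult.assoc)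
      show "\<bar>bilin (S x) a b\<bar> \<le> M * norm a * norm b" for a b
        using bilin_norm_bound[of "S x" C4 1 M a b] C4(2)[OF x] le'(4) by simp
      show "\<bar>bilin (dderiv S a x) b d\<bar> \<le> M * norm a * norm b * norm d" for a b d
        by (rule bilin_norm_bound[OF C5(2)[OF x] le'(5)]) simp
    qed
  qed
qed

lemma partial_eq_dderiv: "partial i h = dderiv h (axis i 1)"
  by (rule ext) (simp add: partial_def dderiv_def)

context
  fixes X :: "'a topology" and c :: "('a, 'n::finite) chart"
  assumes chart: "is_chart X c"
begin

lemma chart_open: "open (chart_image c)" "openin X (fst c)"
  using chart by (simp_all add: is_chart_def)

lemma chart_topspace: "topspace (subtopology X (fst c)) = fst c"
  using openin_subset[OF chart_open(2)] by auto

lemma chart_homeo: "homeomorphic_map (subtopology X (fst c)) (top_of_set (chart_image c)) (snd c)"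
  using chart by (simp add: is_chart_def)

lemma chart_inj: "inj_on (snd c) (fst c)"
  using homeomorphic_imp_injective_map[OF chart_homeo] unfolding chart_topspace .

lemma chart_in_image: "p \<in> fst c \<Longrightarrow> snd c p \<in> chart_image c"
  by (simp add: chart_image_def)

lemma chart_inv_chart: "p \<in> fst c \<Longrightarrow> chart_inv c (snd c p) = p"
  unfolding chart_inv_def by (rule inv_into_f_f[OF chart_inj])

lemma chart_inv_in: "x \<in> chart_image c \<Longrightarrow> chart_inv c x \<in> fst c"
  unfolding chart_inv_def chart_image_def by (rule inv_into_into)

lemma chart_chart_inv: "x \<in> chart_image c \<Longrightarrow> snd c (chart_inv c x) = x"
  unfolding chart_inv_def chart_image_def by (rule f_inv_into_f)

lemma chart_preimage_open:
  assumes "open U"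
  shows "openin X {p \<in> fst c. snd c p \<in> U}"
proof -
  have "continuous_map (subtopology X (fst c)) (top_of_set (chart_image c)) (snd c)"
    by (rule homeomorphic_imp_continuous_map[OF chart_homeo])
  then have "continuous_map (subtopology X (fst c)) euclidean (snd c)"
    by (simp add: continuous_map_in_subtopology)
  then have "openin (subtopology X (fst c)) {p \<in> topspace (subtopology X (fst c)). snd c p \<in> U}"
    using assms by (intro openin_continuous_map_preimage) auto
  then have "openin (subtopology X (fst c)) {p \<in> fst c. snd c p \<in> U}" by (simp only: chart_topspace)
  then show ?thesis by (rule openin_trans_full[OF _ chart_open(2)])
qed

lemma chart_image_open:
  assumes "openin X U"
  shows "open (snd c ` (fst c \<inter> U))"
proof -
  have "openin (subtopology X (fst c)) (fst c \<inter> U)"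
    using assms by (metis openin_subtopology_Int inf_commute)
  then have "openin (top_of_set (chart_image c)) (snd c ` (fst c \<inter> U))"
    using homeomorphic_imp_open_map[OF chart_homeo] by (simp add: open_map_def)
  then show ?thesis using chart_open(1) openin_open_trans by blast
qed

end

lemma manifold_charts:
  assumes "smooth_manifold X \<A>"
  shows "c \<in> \<A> \<Longrightarrow> is_chart X c" "p \<in> topspace X \<Longrightarrow> \<exists>c\<in>\<A>. p
    \<in> fst c" "c \<in> \<A> \<Longrightarrow> p \<in> fst c \<Longrightarrow> p \<in> topspace X"
  using assms unfolding smooth_manifold_def by blast+

text \<open>All later compactness arguments take place inside these pieces, so that only functions on
  \<open>\<real>\<^sup>n\<close> are ever maximized.\<close>

lemma finite_chart_cover:
  fixes X :: "'a topology" and \<A> :: "('a, 'n::finite) chart set"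
  assumes mf: "smooth_manifold X \<A>" and cpt: "compact_space X"
  obtains F where "finite F" "\<And>c K. (c, K) \<in> F \<Longrightarrow> c \<in> \<A> \<and> compact K \<and> K
    \<subseteq> chart_image c"
    "\<And>p. p \<in> topspace X \<Longrightarrow> \<exists>(c, K)\<in>F. p \<in> fst c \<and> snd c p \<in> K"
proof -
  note ch = manifold_charts[OF mf]
  have "\<exists>c r. c \<in> \<A> \<and> p \<in> fst c \<and> 0 < r \<and> cball (snd c p) r \<subseteq> chart_image
    c" if pX: "p \<in> topspace X" for p
  proof -
    obtain c where c: "c \<in> \<A>" "p \<in> fst c" using ch(2)[OF pX] by blast
    then have "open (chart_image c)" "snd c p \<in> chart_image c"
      using chart_open(1)[OF ch(1)] chart_in_image[OF ch(1)] by auto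
    then obtain r where "0 < r" "cball (snd c p) r \<subseteq> chart_image c" using open_contains_cball by blast
    then show ?thesis using c by blast
  qed
  then obtain c r where cr: "\<And>p. p \<in> topspace X \<Longrightarrow> c p \<in> \<A> \<and> p \<in> fst (c p)
    \<and> 0 < r p \<and> cball (snd (c p) p) (r p) \<subseteq> chart_image (c p)"
    by metis
  define U where "U p = {q \<in> fst (c p). snd (c p) q \<in> ball (snd (c p) p) (r p)}" for p
  have "\<forall>V\<in>U ` topspace X. openin X V"
  proof
    fix V assume "V \<in> U ` topspace X"
    then obtain p where p: "p \<in> topspace X" "V = U p" by blast
    show "openin X V" unfolding p(2) U_def
      by (rule chart_preimage_open[OF ch(1)]) (use cr[OF p(1)] in auto)
  qed
  moreover have "topspace X \<subseteq> \<Union> (U ` topspace X)"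
    using cr unfolding U_def by fastforce
  ultimately obtain \<F> where \<F>: "finite \<F>" "\<F> \<subseteq> U ` topspace X" "topspace X \<subseteq> \<Union> \<F>"
    using cpt unfolding compact_space_alt by meson
  obtain P where P: "finite P" "P \<subseteq> topspace X" "\<F> = U ` P"
    using finite_subset_image[OF \<F>(1,2)] by blast
  show ?thesis
  proof (rule that[of "(\<lambda>p. (c p, cball (snd (c p) p) (r p))) ` P"])
    show "finite ((\<lambda>p. (c p, cball (snd (c p) p) (r p))) ` P)" using P(1) by blast
    show "d \<in> \<A> \<and> compact K \<and> K \<subseteq> chart_image d" if "(d, K) \<in> (\<lambda>p. (c p, cball
      (snd (c p) p) (r p))) ` P" for d K
      using that cr P(2) by auto
    show "\<exists>(d, K)\<in>(\<lambda>p. (c p, cball (snd (c p) p) (r p))) ` P. q \<in> fst d \<and> snd d q \<in> K"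
      if qX: "q \<in> topspace X" for q
    proof -
      obtain p where "p \<in> P" "q \<in> U p" using qX \<F>(3) P(3) by blast
      then show ?thesis unfolding U_def by (intro bexI[of _ "(c p, cball (snd (c p) p) (r p))"]) auto
    qed
  qed
qed

lemma manifold_attains_sup:
  fixes X :: "'a topology" and \<A> :: "('a, 'n::finite) chart set" and \<Phi> :: "'a \<Rightarrow> real"
  assumes mf: "smooth_manifold X \<A>" and cpt: "compact_space X" and Y: "Y \<subseteq> topspace X" "Y \<noteq> {}"
    and cont: "\<And>c. c \<in> \<A> \<Longrightarrow> continuous_on (chart_image c) (\<lambda>x. \<Phi> (chart_inv c x))"
    and cl: "\<And>c. c \<in> \<A> \<Longrightarrow> closedin (top_of_set (chart_image c)) {x \<in> chart_image c.
      chart_inv c x \<in> Y}"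
  obtains q where "q \<in> Y" "\<And>p. p \<in> Y \<Longrightarrow> \<Phi> p \<le> \<Phi> q"
proof -
  obtain F where F: "finite F" "\<And>c K. (c, K) \<in> F \<Longrightarrow> c \<in> \<A> \<and> compact K \<and> K
    \<subseteq> chart_image c"
    "\<And>p. p \<in> topspace X \<Longrightarrow> \<exists>(c, K)\<in>F. p \<in> fst c \<and> snd c p \<in> K"
    by (rule finite_chart_cover[OF mf cpt]) blast
  define I :: "('a, 'n) chart \<times> (real^'n) set \<Rightarrow> real set" where "I z = (\<lambda>x. \<Phi>
    (chart_inv (fst z) x)) ` (snd z \<inter> {x \<in> chart_image (fst z). chart_inv (fst z) x \<in> Y})" for z
  have "compact (I z)" if zF: "z \<in> F" for z
  proof -
    obtain c K where z: "z = (c, K)" by (cases z)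
    have cK: "c \<in> \<A>" "compact K" "K \<subseteq> chart_image c" using F(2)[of c K] zF unfolding z by auto
    obtain T where T: "closed T" "{x \<in> chart_image c. chart_inv c x \<in> Y} = chart_image c \<inter> T"
      using cl[OF cK(1)] unfolding closedin_closed by blast
    have "K \<inter> {x \<in> chart_image c. chart_inv c x \<in> Y} = K \<inter> T" using T(2) cK(3) by blast
    moreover have "compact (K \<inter> T)" by (intro compact_Int_closed cK T(1))
    moreover have "continuous_on (K \<inter> T) (\<lambda>x. \<Phi> (chart_inv c x))"
      by (rule continuous_on_subset[OF cont[OF cK(1)]]) (use cK(3) in blast)
    ultimately show ?thesis unfolding I_def z by (simp add: compact_continuous_image)
  qed
  then have comp: "compact (\<Union>z\<in>F. I z)" by (intro compact_UN F(1)) auto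
  have sub: "\<Phi> p \<in> (\<Union>z\<in>F. I z)" if pY: "p \<in> Y" for p
  proof -
    obtain c K where cK: "(c, K) \<in> F" "p \<in> fst c" "snd c p \<in> K" using F(3)[of p] pY Y by blast
    have ch: "is_chart X c" using F(2)[OF cK(1)] manifold_charts(1)[OF mf] by blast
    have "\<Phi> p \<in> I (c, K)"
      unfolding I_def using cK chart_inv_chart[OF ch cK(2)] chart_in_image[OF ch cK(2)] pY
      by (intro image_eqI[of _ _ "snd c p"]) auto
    then show ?thesis using cK(1) by blast
  qed
  have "(\<Union>z\<in>F. I z) \<noteq> {}" using sub Y(2) by blast
  then obtain m where m: "m \<in> (\<Union>z\<in>F. I z)" "\<And>t. t \<in> (\<Union>z\<in>F. I z) \<Longrightarrow> t \<le> m"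
    using compact_attains_sup[OF comp] by blast
  then obtain q where "q \<in> Y" "m = \<Phi> q" unfolding I_def by blast
  then show ?thesis using that m(2) sub by blast
qed

locale compact_data =
  fixes X :: "'a topology" and \<A> :: "('a, 'n::finite) chart set"
    and g S :: "('a, 'n) tensor_field" and f :: "'a \<Rightarrow> real" and k :: nat
  assumes mf: "smooth_manifold X \<A>" and cpt: "compact_space X" and metric: "riemannian_metric \<A> g"
    and k1: "1 \<le> k" and kn: "k \<le> CARD('n)" and S_sym: "symmetric_tensor \<A> S" and S1: "Ck_tensor 1 \<A> S"
    and S_Gamma: "in_Gamma k \<A> g S" and f_smooth: "smooth_function \<A> f" and f_pos: "\<forall>p\<in>topspace X. 0 < f p"
begin

abbreviation "Gl c \<equiv> (\<lambda>x. g c (chart_inv c x))"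
abbreviation "Sl c \<equiv> (\<lambda>x. S c (chart_inv c x))"
abbreviation "fl c \<equiv> (\<lambda>x. f (chart_inv c x))"

lemmas charts = manifold_charts[OF mf]

lemma G_smooth: "c \<in> \<A> \<Longrightarrow> Ck_on m (chart_image c) (Gl c)"
  using metric unfolding riemannian_metric_def Ck_tensor_def o_def by blast

lemma S_C1: "c \<in> \<A> \<Longrightarrow> Ck_on 1 (chart_image c) (Sl c)"
  using S1 unfolding Ck_tensor_def o_def by blast

lemma f_C1: "c \<in> \<A> \<Longrightarrow> Ck_on m (chart_image c) (fl c)"
  using f_smooth unfolding smooth_function_def Ck_function_def o_def by blast

lemma g_posdef: "c \<in> \<A> \<Longrightarrow> p \<in> fst c \<Longrightarrow> posdef (g c p)"
  using metric unfolding riemannian_metric_def symmetric_tensor_def posdef_def bilin_def by blast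

lemma S_transpose: "c \<in> \<A> \<Longrightarrow> p \<in> fst c \<Longrightarrow> transpose (S c p) = S c p"
  using S_sym unfolding symmetric_tensor_def by blast

lemma S_admissible: "c \<in> \<A> \<Longrightarrow> p \<in> fst c \<Longrightarrow> admissible k (g c p) (S c p)"
  using S_Gamma unfolding in_Gamma_def by (intro in_Gamma_admissible g_posdef S_transpose kn) auto

end

locale solution = compact_data +
  fixes u :: "'a \<Rightarrow> real"
  assumes u3: "Ck_function 3 \<A> u" and sol: "solves_equation k \<A> g S f u"
begin

abbreviation "ul c \<equiv> (\<lambda>x. u (chart_inv c x))"
abbreviation "Wl c \<equiv> local_tensor (Gl c) (Sl c) (ul c)"
abbreviation "hl c \<equiv> half_sq_grad (Gl c) (ul c)"

lemma u_C3: "c \<in> \<A> \<Longrightarrow> Ck_on 3 (chart_image c) (ul c)"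
  using u3 unfolding Ck_function_def o_def by blast

lemma chart_data:
  assumes c: "c \<in> \<A>" and U: "open U" "U \<subseteq> chart_image c"
  shows "chart_data U (ul c) (Gl c) (Sl c)"
proof
  fix x assume "x \<in> U"
  then have "chart_inv c x \<in> fst c" using chart_inv_in[OF charts(1)[OF c]] U by blast
  then show "posdef (Gl c x)" "transpose (Sl c x) = Sl c x" using g_posdef S_transpose c by blast+
qed (use U u_C3 G_smooth S_C1 c Ck_on_subset in blast)+

lemma chart_data': "c \<in> \<A> \<Longrightarrow> chart_data (chart_image c) (ul c) (Gl c) (Sl c)"
  using chart_data chart_open(1)[OF charts(1)] by blast

lemma gradient_local:
  assumes "c \<in> \<A>" "p \<in> fst c"
  shows "gradient g u c p = grad (Gl c) (ul c) (snd c p)" "differential u c p = coord_diff (ul c) (snd c p)"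
  unfolding gradient_def grad_def differential_def coord_diff_def partial_eq_dderiv o_def
  using chart_inv_chart[OF charts(1)[OF assms(1)] assms(2)] by simp_all

lemma gradient_norm_local:
  assumes "c \<in> \<A>" "p \<in> fst c"
  shows "metric_norm g c p (gradient g u c p) = sqrt (2 * hl c (snd c p))"
  unfolding metric_norm_def gradient_local[OF assms] half_sq_grad_def bilin_def
  using chart_inv_chart[OF charts(1)[OF assms(1)] assms(2)] by simp

lemma christoffel_local:
  assumes c: "c \<in> \<A>" "p \<in> fst c"
  shows "(\<Sum>l\<in>UNIV. christoffel g c p l i j * differential u c p $ l)
    = koszul (Gl c) (snd c p) (axis i 1) (axis j 1) (grad (Gl c) (ul c) (snd c p))"
proof -
  interpret cd: chart_data "chart_image c" "ul c" "Gl c" "Sl c" by (rule chart_data'[OF c(1)])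
  let ?x = "snd c p"
  have x: "?x \<in> chart_image c" by (rule chart_in_image[OF charts(1)[OF c(1)] c(2)])
  have p: "chart_inv c ?x = p" by (rule chart_inv_chart[OF charts(1)[OF c(1)] c(2)])
  let ?N = "matrix_inv (g c p)" and ?d = "coord_diff (ul c) ?x"
  let ?T = "\<lambda>m. koszul (Gl c) ?x (axis i 1) (axis j 1) (axis m 1)"
  have N: "?N $ l $ m = ?N $ m $ l" for l m
  proof -
    note inv = matrix_inv_inverse[OF posdef_invertible[OF g_posdef[OF c]]]
    have gt: "transpose (g c p) = g c p" using g_posdef[OF c] by (simp add: posdef_def)
    have "transpose ?N ** g c p = transpose (g c p ** ?N)" by (simp only: matrix_transpose_mul gt)
    then have left: "transpose ?N ** g c p = mat 1" by (simp only: inv(1) transpose_mat)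
    have "transpose ?N = transpose ?N ** (g c p ** ?N)" by (simp only: inv(1) matrix_mul_rid)
    also have "\<dots> = ?N" by (simp only: matrix_mul_assoc left matrix_mul_lid)
    finally have "transpose ?N $ m $ l = ?N $ m $ l" by (rule arg_cong)
    then show ?thesis by (simp add: transpose_def)
  qed
  have dg: "partial a (\<lambda>x. g c (chart_inv c x) $ b $ m) ?x = bilin (dderiv (Gl c) (axis a 1) ?x) (axis b 1)
    (axis m 1)" for a b m
    unfolding partial_eq_dderiv bilin_axis by (rule entry_differentiable(2)[OF cd.diff(4)[OF x]])
  have "christoffel g c p l i j = (\<Sum>m\<in>UNIV. ?N $ l $ m * ?T m)" for l
    unfolding christoffel_def Let_def dg koszul_def by (simp add: sum_distrib_left sum_divide_distrib)
  then have "(\<Sum>l\<in>UNIV. christoffel g c p l i j * differential u c p $ l)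
      = (\<Sum>l\<in>UNIV. \<Sum>m\<in>UNIV. ?N $ l $ m * ?T m * ?d $ l)"
    by (simp add: gradient_local[OF c] sum_distrib_right)
  also have "\<dots> = (\<Sum>m\<in>UNIV. \<Sum>l\<in>UNIV. ?N $ l $ m * ?T m * ?d $ l)" by (rule sum.swap)
  also have "\<dots> = (\<Sum>m\<in>UNIV. (\<Sum>l\<in>UNIV. ?N $ m $ l * ?d $ l) * ?T m)"
    unfolding sum_distrib_right by (intro sum.cong refl) (simp only: N mult_ac)
  also have "\<dots> = (\<Sum>m\<in>UNIV. grad (Gl c) (ul c) ?x $ m * ?T m)"
    by (simp add: grad_def p matrix_vector_mult_def)
  also have "\<dots> = koszul (Gl c) ?x (axis i 1) (axis j 1) (grad (Gl c) (ul c) ?x)"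
    by (rule linear_expand[OF cd.K_linear(3)[OF x], symmetric])
  finally show ?thesis .
qed

lemma equation_tensor_local:
  assumes c: "c \<in> \<A>" "p \<in> fst c"
  shows "equation_tensor g S u c p = Wl c (snd c p)"
proof -
  interpret cd: chart_data "chart_image c" "ul c" "Gl c" "Sl c" by (rule chart_data'[OF c(1)])
  have x: "snd c p \<in> chart_image c" by (rule chart_in_image[OF charts(1)[OF c(1)] c(2)])
  have p: "chart_inv c (snd c p) = p" by (rule chart_inv_chart[OF charts(1)[OF c(1)] c(2)])
  have "0 \<le> hl c (snd c p)" using cd.h_ge[OF x, of 0] cd.diff(1)[OF x] by (simp add: bilin_simps linear_0[OF linear_dderiv])
  then have norm: "(metric_norm g c p (gradient g u c p))\<^sup>2 / 2 = hl c (snd c p)"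
    by (simp add: gradient_norm_local[OF c])
  have "equation_tensor g S u c p $ i $ j = Wl c (snd c p) $ i $ j" for i j
    unfolding equation_tensor_def norm hessian_def christoffel_local[OF c] partial_eq_dderiv local_tensor_def
      covector_tensor_def
    by (simp add: o_def p gradient_local[OF c] coord_diff_def)
  then show ?thesis by (simp add: vec_eq_iff)
qed

text \<open>The \<open>k\<close>-th root is positive by the equation, hence so is \<open>\<sigma>\<^sub>k\<close> and
  the root can be undone.\<close>

lemma equation_local:
  assumes c: "c \<in> \<A>" and x: "x \<in> chart_image c"
  shows "mixed k (Gl c x) (Wl c x) = det (Gl c x) * (fl c x * exp (ul c x)) ^ k"
proof -
  interpret cd: chart_data "chart_image c" "ul c" "Gl c" "Sl c" by (rule chart_data'[OF c(1)])
  let ?p = "chart_inv c x" and ?s = "sigma k (eigenvalues (Gl c x) (Wl c x))"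
  have p: "?p \<in> fst c" by (rule chart_inv_in[OF charts(1)[OF c] x])
  have "equation_tensor g S u c ?p = Wl c x"
    using equation_tensor_local[OF c p] chart_chart_inv[OF charts(1)[OF c] x] by simp
  then have eq: "root k ?s = f ?p * exp (u ?p)"
    using sol c p unfolding solves_equation_def sigma_tensor_def by force
  have "0 < f ?p * exp (u ?p)" using f_pos charts(3)[OF c p] by simp
  then have "0 < ?s" using eq k1 real_root_gt_0_iff[of k ?s] by simp
  then have "?s = (f ?p * exp (u ?p)) ^ k"
    using k1 eq real_root_pow_pos[of k ?s] by simp
  then show ?thesis using mixed_eq_sigma[OF cd.posG[OF x] cd.W_sym[OF x] kn] by simp
qed

lemma equation_pos: "c \<in> \<A> \<Longrightarrow> x \<in> chart_image c \<Longrightarrow> 0 < mixed k (Gl c x) (Wl c x)"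
  using equation_local f_pos charts(3) chart_inv_in[OF charts(1)] chart_data.det_G[OF chart_data'] by simp

lemma chart_independence:
  assumes c: "c \<in> \<A>" and d: "d \<in> \<A>" and p: "p \<in> fst c" "p \<in> fst d"
  shows "hl c (snd c p) = hl d (snd d p)"
    "admissible k (Gl c (snd c p)) (Wl c (snd c p)) \<longleftrightarrow> admissible k (Gl d (snd d p)) (Wl d (snd d p))"
proof -
  let ?O = "snd c ` (fst c \<inter> fst d)" and ?\<phi> = "transition c d"
  note cc = charts(1)[OF c] and cd = charts(1)[OF d]
  have O: "open ?O" "?O \<subseteq> chart_image c"
    by (rule chart_image_open[OF cc chart_open(2)[OF cd]]) (auto simp: chart_image_def)
  have \<phi>: "?\<phi> (snd c q) = snd d q" if "q \<in> fst c" for q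
    by (simp add: transition_def chart_inv_chart[OF cc that])
  have sm: "Ck_on m ?O ?\<phi>" for m
    using mf c d unfolding smooth_manifold_def smooth_on_def by blast
  have lin: "linear (\<lambda>a. dderiv ?\<phi> a y)" if "y \<in> ?O" for y
    using linear_dderiv[OF Ck_on_differentiable[OF sm[of 1, unfolded One_nat_def] that]] .
  have tens: "bilin (T c q) a b = bilin (T d q) (dderiv ?\<phi> a (snd c q)) (dderiv ?\<phi> b (snd c q))"
    if T: "tensor_field \<A> T" and q: "q \<in> fst c" "q \<in> fst d" for T q a b
  proof -
    let ?J = "jacobian ?\<phi> (at (snd c q))"
    have "T c q = transpose ?J ** T d q ** ?J"
      using T c d q unfolding tensor_field_def Let_def by blast
    moreover have "?J *v v = dderiv ?\<phi> v (snd c q)" for v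
      unfolding jacobian_def using lin[of "snd c q"] q unfolding dderiv_def by (simp add: matrix_works)
    ultimately show ?thesis by (simp add: bilin_congruence)
  qed
  have tg: "tensor_field \<A> g" "tensor_field \<A> S"
    using metric S_sym unfolding riemannian_metric_def symmetric_tensor_def by blast+
  interpret ch: chart_change ?O "chart_image d" "ul c" "ul d" "Gl c" "Gl d" "Sl c" "Sl d" ?\<phi>
  proof (intro chart_change.intro chart_change_axioms.intro)
    show "chart_data ?O (ul c) (Gl c) (Sl c)" by (rule chart_data[OF c O])
    show "chart_data (chart_image d) (ul d) (Gl d) (Sl d)" by (rule chart_data'[OF d])
    show "Ck_on 2 ?O ?\<phi>" by (rule sm)
  next
    fix y assume "y \<in> ?O"
    then obtain q where q: "q \<in> fst c" "q \<in> fst d" "y = snd c q" by blast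
    note inv = chart_inv_chart[OF cc q(1)] chart_inv_chart[OF cd q(2)] \<phi>[OF q(1)]
    show "?\<phi> y \<in> chart_image d" using chart_in_image[OF cd q(2)] by (simp add: q(3) inv)
    show "ul c y = ul d (?\<phi> y)" by (simp add: q(3) inv)
    show "bilin (Gl c y) a b = bilin (Gl d (?\<phi> y)) (dderiv ?\<phi> a y) (dderiv ?\<phi> b y)" for a b
      using tens[OF tg(1) q(1,2)] by (simp add: q(3) inv)
    show "bilin (Sl c y) a b = bilin (Sl d (?\<phi> y)) (dderiv ?\<phi> a y) (dderiv ?\<phi> b y)" for a b
      using tens[OF tg(2) q(1,2)] by (simp add: q(3) inv)
  qed
  have y: "snd c p \<in> ?O" using p by blast
  show "hl c (snd c p) = hl d (snd d p)" using ch.h_change[OF y] \<phi>[OF p(1)] by simp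
  show "admissible k (Gl c (snd c p)) (Wl c (snd c p)) \<longleftrightarrow> admissible k (Gl d (snd d p)) (Wl d (snd d p))"
    using ch.admissible_change[OF y kn] \<phi>[OF p(1)] by simp
qed

text \<open>The equation makes \<open>\<sigma>\<^sub>k\<close> positive, so failure of admissibility is both a closed
  condition and, by lemma
  \<open>admissible_of_nonneg\<close>, an open one.\<close>

lemma not_admissible_iff:
  assumes c: "c \<in> \<A>" and x: "x \<in> chart_image c"
  shows "\<not> admissible k (Gl c x) (Wl c x) \<longleftrightarrow> (\<exists>j\<le>k. mixed j (Gl c x) (Wl c x) \<le> 0)"
    "\<not> admissible k (Gl c x) (Wl c x) \<longleftrightarrow> (\<exists>j\<le>k. mixed j (Gl c x) (Wl c x) < 0)"
proof -
  interpret cd: chart_data "chart_image c" "ul c" "Gl c" "Sl c" by (rule chart_data'[OF c(1)])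
  show *: "\<not> admissible k (Gl c x) (Wl c x) \<longleftrightarrow> (\<exists>j\<le>k. mixed j (Gl c x) (Wl c x) \<le> 0)"
    unfolding admissible_def by (auto simp: not_less)
  show "\<not> admissible k (Gl c x) (Wl c x) \<longleftrightarrow> (\<exists>j\<le>k. mixed j (Gl c x) (Wl c x) < 0)"
    using admissible_of_nonneg[OF cd.posG[OF x] cd.W_sym[OF x] kn equation_pos[OF c x]] *
    by (meson less_imp_le not_less)
qed

lemma continuous_on_mixed_local:
  assumes c: "c \<in> \<A>"
  shows "continuous_on (chart_image c) (\<lambda>x. mixed j (Gl c x) (Wl c x))"
proof -
  interpret cd: chart_data "chart_image c" "ul c" "Gl c" "Sl c" by (rule chart_data'[OF c(1)])
  show ?thesis by (intro continuous_on_mixed Ck_on_continuous[OF G_smooth[OF c]] cd.continuous_on_W)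
qed

text \<open>The set \<open>Y\<close> of points where admissibility fails is open and compact. A minimum of
  \<open>u\<close> over \<open>Y\<close>
  would be a local minimum of \<open>u\<close>, where \<open>W\<close> is admissible.\<close>

lemma everywhere_admissible:
  assumes c: "c \<in> \<A>" and x: "x \<in> chart_image c"
  shows "admissible k (Gl c x) (Wl c x)"
proof (rule ccontr)
  assume neg: "\<not> admissible k (Gl c x) (Wl c x)"
  define Y where "Y = {p \<in> topspace X. \<exists>c\<in>\<A>. p \<in> fst c \<and> \<not> admissible k (Gl c (snd c
    p)) (Wl c (snd c p))}"
  have Y_iff: "chart_inv c x \<in> Y \<longleftrightarrow> \<not> admissible k (Gl c x) (Wl c x)" if "c \<in> \<A>" "x
    \<in> chart_image c" for c x
  proof -
    note ch = charts(1)[OF that(1)]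
    have p: "chart_inv c x \<in> fst c" "snd c (chart_inv c x) = x"
      using chart_inv_in[OF ch that(2)] chart_chart_inv[OF ch that(2)] by auto
    show ?thesis
    proof
      assume "chart_inv c x \<in> Y"
      then obtain d where d: "d \<in> \<A>" "chart_inv c x \<in> fst d"
        "\<not> admissible k (Gl d (snd d (chart_inv c x))) (Wl d (snd d (chart_inv c x)))"
        unfolding Y_def by blast
      show "\<not> admissible k (Gl c x) (Wl c x)"
        using chart_independence(2)[OF that(1) d(1) p(1) d(2)] d(3) unfolding p(2) by blast
    next
      assume "\<not> admissible k (Gl c x) (Wl c x)"
      then have "\<not> admissible k (Gl c (snd c (chart_inv c x))) (Wl c (snd c (chart_inv c x)))" unfolding p(2) .
      then show "chart_inv c x \<in> Y" unfolding Y_def using that(1) p(1) charts(3)[OF that(1) p(1)] by blast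
    qed
  qed
  have cl: "closedin (top_of_set (chart_image c)) {x \<in> chart_image c. chart_inv c x \<in> Y}" if "c \<in> \<A>" for c
  proof -
    have "{x \<in> chart_image c. chart_inv c x \<in> Y} = (\<Union>j\<in>{..k}. {x \<in> chart_image c. mixed j (Gl c
      x) (Wl c x) \<le> 0})"
      using Y_iff[OF that] not_admissible_iff(1)[OF that] by auto
    moreover have "closedin (top_of_set (chart_image c)) {x \<in> chart_image c. mixed j (Gl c x) (Wl c x) \<le> 0}" for j
      using continuous_closedin_preimage[OF continuous_on_mixed_local[OF that, of j] closed_atMost[of 0]]
      by (simp add: vimage_def Int_def conj_commute)
    ultimately show ?thesis by (auto intro!: closedin_Union)
  qed
  have "Y \<noteq> {}" using Y_iff[OF c x] neg by blast
  moreover have "Y \<subseteq> topspace X" unfolding Y_def by blast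
  moreover have "continuous_on (chart_image c) (\<lambda>x. - u (chart_inv c x))" if "c \<in> \<A>" for c
    by (intro continuous_on_minus Ck_on_continuous[OF u_C3[OF that]])
  ultimately obtain q where q: "q \<in> Y" "\<And>p. p \<in> Y \<Longrightarrow> - u p \<le> - u q"
    using manifold_attains_sup[OF mf cpt _ _ _ cl, of "\<lambda>p. - u p"] by blast
  obtain d where d: "d \<in> \<A>" "q \<in> fst d" using q(1) charts(2) unfolding Y_def by blast
  interpret cd: chart_data "chart_image d" "ul d" "Gl d" "Sl d" by (rule chart_data'[OF d(1)])
  let ?y = "snd d q"
  have y: "?y \<in> chart_image d" "chart_inv d ?y = q"
    using chart_in_image[OF charts(1)[OF d(1)] d(2)] chart_inv_chart[OF charts(1)[OF d(1)] d(2)] by auto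
  have bad: "\<not> admissible k (Gl d ?y) (Wl d ?y)" using Y_iff[OF d(1) y(1)] y(2) q(1) by simp
  then obtain j where j: "j \<le> k" "mixed j (Gl d ?y) (Wl d ?y) < 0" using not_admissible_iff(2)[OF d(1) y(1)] by blast
  have "isCont (\<lambda>x. mixed j (Gl d x) (Wl d x)) ?y"
    using continuous_on_mixed_local[OF d(1), of j] y(1) cd.open_dom by (simp add: continuous_on_eq_continuous_at)
  then obtain r where r: "0 < r" "\<And>z. dist z ?y < r \<Longrightarrow> dist (mixed j (Gl d z) (Wl d z)) (mixed j
    (Gl d ?y) (Wl d ?y)) < - mixed j (Gl d ?y) (Wl d ?y)"
    using j(2) unfolding continuous_at_eps_delta by (metis neg_0_less_iff_less)
  have "ul d ?y \<le> ul d z" if z: "z \<in> chart_image d" "dist z ?y < r" for z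
  proof -
    have "mixed j (Gl d z) (Wl d z) < 0" using r(2)[OF z(2)] by (auto simp: dist_real_def abs_real_def split: if_splits)
    then have "chart_inv d z \<in> Y" using Y_iff[OF d(1) z(1)] not_admissible_iff(2)[OF d(1) z(1)] j(1) by blast
    then show ?thesis using q(2) y(2) by fastforce
  qed
  then have "admissible k (Gl d ?y) (Wl d ?y)"
    using S_admissible[OF d] y(2) by (intro cd.admissible_at_minimum[OF y(1) r(1) _ kn]) simp_all
  then show False using bad by blast
qed

lemma hl_nonneg:
  assumes c: "c \<in> \<A>" and x: "x \<in> chart_image c"
  shows "0 \<le> hl c x"
proof -
  interpret cd: chart_data "chart_image c" "ul c" "Gl c" "Sl c" by (rule chart_data'[OF c(1)])
  show ?thesis using cd.h_ge[OF x, of 0] cd.diff(1)[OF x] by (simp add: bilin_simps linear_0[OF linear_dderiv])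
qed

end

text \<open>The constant is chosen before the solution; the assumptions on \<open>u\<close> say that \<open>h +
  \<kappa> e\<^sup>u\<close> has its maximum over
  the chart at \<open>x\<close>.\<close>

lemma (in compact_data) piece_bound:
  assumes c: "c \<in> \<A>" and K: "compact K" "K \<subseteq> chart_image c" and \<phi>: "0 < \<phi>"
  obtains C where "0 \<le> C" "\<And>u x \<kappa>. \<lbrakk>solution X \<A> g S f k u; x \<in> K;
     \<And>y. y \<in> chart_image c \<Longrightarrow> half_sq_grad (Gl c) (\<lambda>x. u (chart_inv c x)) y + \<kappa>
       * exp (u (chart_inv c y))
        \<le> half_sq_grad (Gl c) (\<lambda>x. u (chart_inv c x)) x + \<kappa> * exp (u (chart_inv c x));
     \<phi> * half_sq_grad (Gl c) (\<lambda>x. u (chart_inv c x)) x \<le> \<kappa> * exp (u (chart_inv c x))\<rbrakk>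
     \<Longrightarrow> half_sq_grad (Gl c) (\<lambda>x. u (chart_inv c x)) x \<le> C"
proof -
  note ch = charts(1)[OF c]
  have posG: "posdef (Gl c x)" if "x \<in> chart_image c" for x
    using g_posdef[OF c] chart_inv_in[OF ch that] by blast
  obtain c0 M0 where "\<forall>M\<ge>M0. \<forall>x\<in>K. metric_bounds (Gl c) (Sl c) c0 M x"
    by (rule metric_bounds_on_compact[OF chart_open(1)[OF ch] K G_smooth[OF c] S_C1[OF c] posG])
  then have b: "metric_bounds (Gl c) (Sl c) c0 M x" if "M0 \<le> M" "x \<in> K" for M x using that by blast
  have f1: "Ck_on (Suc 0) (chart_image c) (fl c)" by (rule f_C1[OF c])
  obtain Cf where Cf: "\<And>x v. x \<in> K \<Longrightarrow> norm (dderiv (fl c) v x) \<le> Cf * norm v"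
    using dderiv_bound[OF f1 K] by blast
  obtain fm where fm: "0 < fm" "\<And>x. x \<in> K \<Longrightarrow> fm \<le> fl c x"
  proof (cases "K = {}")
    case True
    then show ?thesis using that[of 1] by simp
  next
    case False
    have cont: "continuous_on K (fl c)" using Ck_on_continuous[OF f1] K(2) continuous_on_subset by blast
    obtain z where "z \<in> K" "\<And>y. y \<in> K \<Longrightarrow> fl c z \<le> fl c y"
      using continuous_attains_inf[OF K(1) False cont] by blast
    moreover from this have "0 < fl c z" using f_pos K(2) charts(3)[OF c chart_inv_in[OF ch]] by blast
    ultimately show ?thesis using that by blast
  qed
  define M where "M = max M0 Cf"
  let ?C = "1 + M / c0 + remainder_const c0 M / \<phi> + M\<^sup>2 / (c0 * fm\<^sup>2)"
  obtain m where m: "k = Suc m" using k1 by (cases k) auto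
  show ?thesis
  proof (rule that[of "\<bar>?C\<bar>"])
    fix u x \<kappa>
    assume sol: "solution X \<A> g S f k u" and x: "x \<in> K"
      and max: "\<And>y. y \<in> chart_image c \<Longrightarrow> half_sq_grad (Gl c) (\<lambda>x. u (chart_inv c x)) y
        + \<kappa> * exp (u (chart_inv c y))
        \<le> half_sq_grad (Gl c) (\<lambda>x. u (chart_inv c x)) x + \<kappa> * exp (u (chart_inv c x))"
      and \<kappa>: "\<phi> * half_sq_grad (Gl c) (\<lambda>x. u (chart_inv c x)) x \<le> \<kappa> * exp (u (chart_inv c x))"
    interpret s: solution X \<A> g S f k u by (rule sol)
    interpret cd: chart_data "chart_image c" "s.ul c" "Gl c" "Sl c" by (rule s.chart_data'[OF c])
    have x': "x \<in> chart_image c" using x K by blast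
    have df: "\<bar>dderiv (fl c) v x\<bar> \<le> M * norm v" for v
      using Cf[OF x, of v] mult_right_mono[of Cf M "norm v"] unfolding M_def by simp
    have "cd.h x \<le> ?C"
      by (rule cd.local_gradient_bound[OF x' max kn[unfolded m] Ck_on_differentiable[OF f1 x']
            s.equation_local[OF c, unfolded m] s.everywhere_admissible[OF c x', unfolded m]
            b[OF _ x] df fm(1) fm(2)[OF x] \<phi> \<kappa>]) (simp_all add: M_def)
    then show "half_sq_grad (Gl c) (s.ul c) x \<le> \<bar>?C\<bar>" by linarith
  qed simp
qed

theorem proposition12:
  fixes X :: "'a topology" and \<A> :: "('a, 'n::finite) chart set"
    and g S :: "('a, 'n) tensor_field" and f :: "'a \<Rightarrow> real"
    and \<delta>\<^sub>1 \<delta>\<^sub>2 :: real and k :: nat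
  assumes "smooth_manifold X \<A>" and "compact_space X"
    and "riemannian_metric \<A> g"
    and "1 \<le> k" and "k \<le> CARD('n)"
    and "symmetric_tensor \<A> S" and "Ck_tensor 1 \<A> S" and "in_Gamma k \<A> g S"
    and "smooth_function \<A> f" and "\<forall>p\<in>topspace X. 0 < f p"
    and "\<delta>\<^sub>1 < 0" and "0 < \<delta>\<^sub>2"
  shows "\<exists>C\<^sub>1. \<forall>u. Ck_function 3 \<A> u \<longrightarrow> solves_equation k \<A> g S f u \<longrightarrow>
           (\<forall>p\<in>topspace X. \<delta>\<^sub>1 \<le> u p \<and> u p \<le> \<delta>\<^sub>2) \<longrightarrow>
           gradient_C0_norm \<A> g u \<le> C\<^sub>1"
proof -
  interpret compact_data X \<A> g S f k
    by (rule compact_data.intro) (use assms in blast)+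
  obtain F where F: "finite F" "\<And>c K. (c, K) \<in> F \<Longrightarrow> c \<in> \<A> \<and> compact K \<and> K
    \<subseteq> chart_image c"
    "\<And>p. p \<in> topspace X \<Longrightarrow> \<exists>(c, K)\<in>F. p \<in> fst c \<and> snd c p \<in> K"
    by (rule finite_chart_cover[OF mf cpt]) blast
  define a where "a = exp (- \<delta>\<^sub>2) / 2"
  define \<phi> where "\<phi> = a * exp \<delta>\<^sub>1"
  have a: "0 < a" and \<phi>: "0 < \<phi>" by (simp_all add: a_def \<phi>_def)
  define Q where "Q z C \<longleftrightarrow> 0 \<le> C \<and> (\<forall>u x \<kappa>. solution X \<A> g S f k u
    \<longrightarrow> x \<in> snd z \<longrightarrow>
     (\<forall>y\<in>chart_image (fst z). half_sq_grad (Gl (fst z)) (\<lambda>x. u (chart_inv (fst z) x)) y + \<kappa>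
       * exp (u (chart_inv (fst z) y))
        \<le> half_sq_grad (Gl (fst z)) (\<lambda>x. u (chart_inv (fst z) x)) x + \<kappa> * exp (u (chart_inv (fst z)
          x))) \<longrightarrow>
     \<phi> * half_sq_grad (Gl (fst z)) (\<lambda>x. u (chart_inv (fst z) x)) x \<le> \<kappa> * exp (u (chart_inv (fst
       z) x)) \<longrightarrow>
     half_sq_grad (Gl (fst z)) (\<lambda>x. u (chart_inv (fst z) x)) x \<le> C)" for z :: "('a, 'n) chart \<times>
       (real^'n) set" and C :: real
  have "\<exists>C. Q z C" if z: "z \<in> F" for z
  proof -
    have *: "fst z \<in> \<A>" "compact (snd z)" "snd z \<subseteq> chart_image (fst z)" using F(2)[of "fst z" "snd z"]
      z by auto
    show ?thesis by (rule piece_bound[OF * \<phi>]) (unfold Q_def, blast)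
  qed
  then obtain C where C: "\<And>z. z \<in> F \<Longrightarrow> Q z (C z)" by metis
  define B where "B = (\<Sum>z\<in>F. C z)"
  have B: "C z \<le> B" if "z \<in> F" for z
    unfolding B_def using F(1) that C by (intro member_le_sum) (auto simp: Q_def)
  (* the value \<open>Sup {}\<close> covers the empty manifold, where the supremum is a default value *)
  have "gradient_C0_norm \<A> g u \<le> max (sqrt (4 * B)) (Sup {})"
    if u3: "Ck_function 3 \<A> u" and sol: "solves_equation k \<A> g S f u"
      and range: "\<forall>p\<in>topspace X. \<delta>\<^sub>1 \<le> u p \<and> u p \<le> \<delta>\<^sub>2" for u
  proof (cases "topspace X = {}")
    case True
    then have "(SIGMA c:\<A>. fst c) = {}" using charts(3) by fastforce
    then show ?thesis unfolding gradient_C0_norm_def by simp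
  next
    case False
    interpret s: solution X \<A> g S f k u
      by (rule solution.intro[OF compact_data_axioms]) (rule solution_axioms.intro[OF u3 sol])
    (* \<open>H\<close> needs some chart at each point; lemma \<open>chart_independence\<close> makes the choice irrelevant *)
    define ch where "ch p = (SOME c. c \<in> \<A> \<and> p \<in> fst c)" for p
    define H where "H p = s.hl (ch p) (snd (ch p) p) / (1 - a * exp (u p))" for p
    have ch: "ch p \<in> \<A> \<and> p \<in> fst (ch p)" if "c \<in> \<A>" "p \<in> fst c" for p c
      unfolding ch_def by (rule someI[of _ c]) (use that in auto)
    have H_eq: "H p = s.hl c (snd c p) / (1 - a * exp (u p))" if "c \<in> \<A>" "p \<in> fst c" for p c
    proof -
      have "s.hl c (snd c p) = s.hl (ch p) (snd (ch p) p)"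
        by (rule s.chart_independence(1)[OF that(1) _ that(2)]) (use ch[OF that] in auto)
      then show ?thesis unfolding H_def by simp
    qed
    have den: "1 / 2 \<le> 1 - a * exp (u p)" "1 - a * exp (u p) \<le> 1" "a * exp \<delta>\<^sub>1 \<le> a * exp (u
      p)" if "p \<in> topspace X" for p
    proof -
      have "a * exp (u p) \<le> a * exp \<delta>\<^sub>2" using range that a by (intro mult_left_mono) auto
      then show "1 / 2 \<le> 1 - a * exp (u p)" by (simp add: a_def exp_minus)
      show "1 - a * exp (u p) \<le> 1" using a by simp
      show "a * exp \<delta>\<^sub>1 \<le> a * exp (u p)" using range that a by (intro mult_left_mono) auto
    qed
    have inX: "chart_inv c x \<in> topspace X" if "c \<in> \<A>" "x \<in> chart_image c" for c x
      using charts(3)[OF that(1) chart_inv_in[OF charts(1)[OF that(1)] that(2)]] .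
    have H_local: "H (chart_inv c x) = s.hl c x / (1 - a * exp (u (chart_inv c x)))" if "c \<in> \<A>" "x \<in>
      chart_image c" for c x
      using H_eq[OF that(1) chart_inv_in[OF charts(1)[OF that(1)] that(2)]] chart_chart_inv[OF charts(1)[OF that(1)]
        that(2)] by simp
    have "continuous_on (chart_image c) (\<lambda>x. H (chart_inv c x))" if c: "c \<in> \<A>" for c
    proof -
      interpret cd: chart_data "chart_image c" "s.ul c" "Gl c" "Sl c" by (rule s.chart_data'[OF c])
      have "continuous_on (chart_image c) (\<lambda>x. s.hl c x / (1 - a * exp (u (chart_inv c x))))"
        by (intro continuous_intros cd.continuous_on_h Ck_on_continuous[OF s.u_C3[OF c]])
          (use den(1)[OF inX[OF c]] in fastforce)
      then show ?thesis by (rule continuous_on_eq) (simp add: H_local[OF c])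
    qed
    moreover have "closedin (top_of_set (chart_image c)) {x \<in> chart_image c. chart_inv c x \<in> topspace X}" if "c
      \<in> \<A>" for c
    proof -
      have "{x \<in> chart_image c. chart_inv c x \<in> topspace X} = chart_image c" using inX[OF that] by blast
      then show ?thesis by simp
    qed
    ultimately obtain q where q: "q \<in> topspace X" "\<And>p. p \<in> topspace X \<Longrightarrow> H p \<le> H q"
      using manifold_attains_sup[OF mf cpt subset_refl False, of H] by blast
    obtain c K where cK: "(c, K) \<in> F" "q \<in> fst c" "snd c q \<in> K" using F(3)[OF q(1)] by blast
    have c: "c \<in> \<A>" using F(2)[OF cK(1)] by blast
    let ?x = "snd c q" and ?\<kappa> = "a * H q"
    have x: "?x \<in> chart_image c" "chart_inv c ?x = q"
      using chart_in_image[OF charts(1)[OF c] cK(2)] chart_inv_chart[OF charts(1)[OF c] cK(2)] by auto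
    have h0: "0 \<le> s.hl c ?x" by (rule s.hl_nonneg[OF c x(1)])
    have hx: "s.hl c ?x = H q * (1 - a * exp (u q))" using H_eq[OF c cK(2)] den(1)[OF q(1)] by simp
    have Hq0: "0 \<le> H q" using H_eq[OF c cK(2)] den(1)[OF q(1)] h0 by simp
    have max: "s.hl c y + ?\<kappa> * exp (u (chart_inv c y)) \<le> s.hl c ?x + ?\<kappa> * exp (u (chart_inv c ?x))"
      if y: "y \<in> chart_image c" for y
    proof -
      have "s.hl c y / (1 - a * exp (u (chart_inv c y))) \<le> H q"
        using q(2)[OF inX[OF c y]] H_local[OF c y] by simp
      then have "s.hl c y \<le> H q * (1 - a * exp (u (chart_inv c y)))"
        using den(1)[OF inX[OF c y]] by (simp add: pos_divide_le_eq)
      then show ?thesis using hx x(2) by (simp add: algebra_simps)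
    qed
    have \<kappa>: "\<phi> * s.hl c ?x \<le> ?\<kappa> * exp (u (chart_inv c ?x))"
    proof -
      have "s.hl c ?x \<le> H q * 1" unfolding hx using den(2)[OF q(1)] Hq0 by (intro mult_left_mono) auto
      then have "\<phi> * s.hl c ?x \<le> \<phi> * H q" using \<phi> by (intro mult_left_mono) auto
      also have "\<dots> \<le> (a * exp (u q)) * H q"
        unfolding \<phi>_def by (rule mult_right_mono[OF den(3)[OF q(1)] Hq0])
      finally show ?thesis by (simp add: x(2) mult_ac)
    qed
    have "s.hl c ?x \<le> C (c, K)"
      by (rule C[OF cK(1), unfolded Q_def fst_conv snd_conv, THEN conjunct2, rule_format, of u ?x ?\<kappa>])
        (use s.solution_axioms cK(3) max \<kappa> in auto)
    then have hB: "s.hl c ?x \<le> B" using B[OF cK(1)] by linarith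
    have "H q \<le> 2 * B"
    proof -
      have "H q * (1 / 2) \<le> H q * (1 - a * exp (u q))" using den(1)[OF q(1)] Hq0 by (intro mult_left_mono) auto
      then show ?thesis using hB hx by simp
    qed
    have "metric_norm g d p (gradient g u d p) \<le> sqrt (4 * B)" if d: "d \<in> \<A>" "p \<in> fst d" for d p
    proof -
      note pX = charts(3)[OF d]
      have hd: "0 \<le> s.hl d (snd d p)" by (rule s.hl_nonneg[OF d(1) chart_in_image[OF charts(1)[OF d(1)] d(2)]])
      have "s.hl d (snd d p) = H p * (1 - a * exp (u p))" using H_eq[OF d] den(1)[OF pX] by simp
      also have "\<dots> \<le> H p * 1"
        using den(1,2)[OF pX] H_eq[OF d] hd by (intro mult_left_mono) auto
      also have "\<dots> \<le> 2 * B" using q(2)[OF pX] \<open>H q \<le> 2 * B\<close> by simp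
      finally show ?thesis unfolding s.gradient_norm_local[OF d] by simp
    qed
    moreover have "(SIGMA c:\<A>. fst c) \<noteq> {}" using False charts(2) by fastforce
    ultimately have "gradient_C0_norm \<A> g u \<le> sqrt (4 * B)"
      unfolding gradient_C0_norm_def by (intro cSUP_least) auto
    then show ?thesis by simp
  qed
  then show ?thesis by blast
qed

end
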